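(* Let $0<\varepsilon<1$. Let $b,q\ge 2$ be two integers such that $\gcd(b,q-1)=1$. There exist a constant $C=C(\varepsilon,b,q)>0$ and an exponent $\eta=\eta(\varepsilon,b,q)>0$ such that for every integer $a$ and every real $x>0$, $$\sum_{1\le m\le x^{1-\varepsilon}}\ \max_{\substack{y,z\\ 0\le y<z\\ z-y\le x}}\ \max_{r\ge 0}\left|N_{y,z}(a,b;r,m)-\frac{z-y}{bm}\right|\le C x^{1-\eta}.$$ Moreover, if $\varepsilon<\frac23(1-\lambda)$, where $$\lambda=\frac{1}{2\log q}\log\frac{q\sin(\pi/(2b))}{\sin(\pi/(2bq))},$$ then an admissible value of $\eta$ is $$\eta(\varepsilon)=\frac{\varepsilon^{3}\min\left(1/4,\,3\log_q(P^{-}(q))\right)}{7200\cdot 8^{1/\varepsilon}\left(\log(4q/\varepsilon)+5b\log(q)/\varepsilon\right)}\exp\left(-\frac{5}{\varepsilon}\left(\log(4q/\varepsilon)+\frac{5b\log q}{\varepsilon}\right)\right).$$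
   Context: For an integer $n\ge 0$ with base-$q$ expansion $n=\sum_{k\ge0}n_kq^k$, $n_k\in\{0,\dots,q-1\}$, put $s_q(n)=\sum_{k\ge 0}n_k$. For real numbers $0\le y<z$ and integers $a,b,r,m$, $$N_{y,z}(a,b;r,m)=\left|\{n\in\mathbb{Z}: y\le n<z,\ s_q(n)\equiv a \pmod b,\ n\equiv r\pmod m\}\right|.$$ The maximum over $y,z$ is over real numbers, the maximum over $r$ is over integers $r \ge 0$ (maxima may be read as suprema), and $m$ runs over integers. $P^-(q)$ is the smallest prime divisor of $q$ and $\log_q(x)=\log x/\log q$. *)

theory Defs
  imports Complex_Main "HOL-Number_Theory.Cong" "HOL-Computational_Algebra.Primes"
begin

text \<open>For \<^term>\<open>q \<ge> 2\<close> and \<^term>\<open>n \<ge> 0\<close> only finitely many summands are nonzero;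
  see \<open>digits_finite_support\<close> below. Other arguments are irrelevant.\<close>

definition digit_sum :: "int \<Rightarrow> int \<Rightarrow> int" where
  "digit_sum q n = (\<Sum>k. n div q ^ k mod q)"

definition count_N :: "int \<Rightarrow> real \<Rightarrow> real \<Rightarrow> int \<Rightarrow> int \<Rightarrow> int \<Rightarrow> int \<Rightarrow> nat" where
  "count_N q y z a b r m =
     card {n :: int. y \<le> of_int n \<and> of_int n < z \<and>
       [digit_sum q n = a] (mod b) \<and> [n = r] (mod m)}"

definition discrepancy :: "int \<Rightarrow> real \<Rightarrow> real \<Rightarrow> int \<Rightarrow> int \<Rightarrow> int \<Rightarrow> int \<Rightarrow> real" where
  "discrepancy q y z a b r m =
     \<bar>real (count_N q y z a b r m) - (z - y) / (of_int b * of_int m)\<bar>"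

text \<open>The maxima are real suprema. By \<open>discrepancy_le\<close> below, both families are bounded
  by \<^term>\<open>2 * x + 1\<close>, so these suprema are genuine.\<close>

definition max_discrepancy :: "int \<Rightarrow> int \<Rightarrow> int \<Rightarrow> real \<Rightarrow> int \<Rightarrow> real" where
  "max_discrepancy q a b x m =
     (SUP (y, z)\<in>{(y, z). 0 \<le> y \<and> y < z \<and> z - y \<le> x}.
        SUP r\<in>{0..}. discrepancy q y z a b r m)"

definition total_discrepancy :: "real \<Rightarrow> int \<Rightarrow> int \<Rightarrow> int \<Rightarrow> real \<Rightarrow> real" where
  "total_discrepancy \<epsilon> q a b x =
     (\<Sum>m | 1 \<le> m \<and> of_int m \<le> x powr (1 - \<epsilon>). max_discrepancy q a b x m)"

definition smallest_prime_divisor :: "int \<Rightarrow> int" where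
  "smallest_prime_divisor q = Min {p. prime p \<and> p dvd q}"

definition lambda_exponent :: "int \<Rightarrow> int \<Rightarrow> real" where
  "lambda_exponent b q =
     1 / (2 * ln (of_int q)) *
     ln (of_int q * sin (pi / (2 * of_int b)) / sin (pi / (2 * of_int b * of_int q)))"

definition eta_exponent :: "real \<Rightarrow> int \<Rightarrow> int \<Rightarrow> real" where
  "eta_exponent \<epsilon> b q =
     (let L = ln (4 * of_int q / \<epsilon>) + 5 * of_int b * ln (of_int q) / \<epsilon> in
      \<epsilon> ^ 3 * min (1 / 4) (3 * log (of_int q) (of_int (smallest_prime_divisor q)))
        / (7200 * 8 powr (1 / \<epsilon>) * L)
        * exp (- (5 / \<epsilon>) * L))"

lemma digits_finite_support:
  fixes q n :: int
  assumes "q \<ge> 2" "n \<ge> 0"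
  shows "finite {k. n div q ^ k mod q \<noteq> 0}"
proof -
  have "n div q ^ k mod q = 0" if "nat n \<le> k" for k
  proof -
    have "n \<le> int k" using that by simp
    also have "int k < 2 ^ k" by (metis of_nat_less_two_power)
    also have "(2::int) ^ k \<le> q ^ k" using assms by (intro power_mono) auto
    finally show ?thesis using assms by simp
  qed
  then have "{k. n div q ^ k mod q \<noteq> 0} \<subseteq> {..<nat n}"
    by (auto simp: not_le[symmetric])
  then show ?thesis by (rule finite_subset) simp
qed

lemma count_N_le:
  assumes "y < z"
  shows "real (count_N q y z a b r m) \<le> z - y + 1"
proof -
  have "count_N q y z a b r m \<le> card {\<lceil>y\<rceil>..<\<lceil>z\<rceil>}"
    unfolding count_N_def
    by (rule card_mono) (auto simp: ceiling_le_iff less_ceiling_iff)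
  also have "\<dots> = nat (\<lceil>z\<rceil> - \<lceil>y\<rceil>)" by simp
  finally have "real (count_N q y z a b r m) \<le> real (nat (\<lceil>z\<rceil> - \<lceil>y\<rceil>))" by linarith
  also have "\<dots> = of_int (\<lceil>z\<rceil> - \<lceil>y\<rceil>)" using ceiling_mono[of y z] assms by simp
  also have "\<dots> \<le> z - y + 1" by (simp; linarith)
  finally show ?thesis .
qed

lemma discrepancy_le:
  assumes "y < z" "z - y \<le> x" "b \<ge> 2" "m \<ge> 1"
  shows "discrepancy q y z a b r m \<le> 2 * x + 1"
proof -
  have "1 * 1 \<le> b * m" using assms by (intro mult_mono) auto
  then have "(1::real) \<le> of_int b * of_int m"
    by (metis mult_1 of_int_1_le_iff of_int_mult)
  then have "0 \<le> (z - y) / (of_int b * of_int m)"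
    and "(z - y) / (of_int b * of_int m) \<le> z - y"
    using assms by (auto simp: divide_le_eq mult_le_cancel_left1)
  then show ?thesis
    using count_N_le[of y z q a b r m] assms unfolding discrepancy_def by linarith
qed

end

(*
  Let f(n) = cis (th * s_q(n)) with th = 2 pi j / b. By orthogonality it suffices to bound the sums of f
  over blocks of N terms of progressions n m + r, uniformly in r, for all m outside a sparse set.
  Averaging n over shifts K_1 h_1 + ... + K_k h_k and applying the Gowers-Cauchy-Schwarz (box) inequality
  replaces f by its alternating product over the cubes x + sum_i kappa_i h_i, where kappa_i = K_i m. If
  kappa_i is small modulo q^a (Dirichlet), the pairs of vertices in direction i agree in the upper digits
  below position a unless a carry occurs, so these digits cancel. About 1 / epsilon such steps leave only
  few low digits, and there the cube average decays geometrically, by induction on digit blocks: from any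
  vector of carries two choices of digits lead to carry 0 with phases that differ by th (q - 1), which is
  not a multiple of 2 pi because gcd(b, q - 1) = 1. The exponent obtained in this way exceeds the one
  claimed whenever epsilon < 1/3, and lambda >= 1/2 makes this automatic.
*)

theory Submission
  imports Defs "HOL-Analysis.Analysis" "HOL-Real_Asymp.Real_Asymp"
begin

section \<open>Means and the box inequality\<close>

text \<open>A shift \<open>K * m\<close> must do two things: be small modulo
  \<open>q ^ \<alpha>\<close>, so that upper digits cancel, and let \<open>h\<close> range evenly
  over residues modulo \<open>q ^ (5 * u)\<close>, so that the low digits that survive see a
  standard cube. Dirichlet approximation gives only the first. So each shift is multiplied by some
  \<open>d \<le> q ^ (2 * u)\<close> that turns it into \<open>q ^ (2 * u)\<close> times a unit
  modulo \<open>q\<close>; moduli that could obstruct this belong to the sparse exceptional set. In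
  the last direction the shift is exactly \<open>q ^ (2 * u)\<close>, reached by inverting a unit
  once fewer than \<open>2 * w\<close> digits are left. The lengths balance as follows: multipliers
  reach \<open>q ^ (2 * w)\<close> and ranges \<open>q ^ (5 * u)\<close>, so blocks of length
  \<open>q ^ (2 * w + 6 * u)\<close> lose only \<open>1 / q ^ u\<close>. These blocks must fit into
  \<open>x powr \<epsilon>\<close>, hence \<open>w\<close> is about half of that share of the
  digits. One step removes \<open>w - 9 * u\<close> digits, so about \<open>2 / \<epsilon>\<close>
  steps are needed; \<open>3 / \<epsilon>\<close> leaves room for rounding. All errors decay
  exponentially in \<open>u\<close>, which is proportional to \<open>ln x\<close>: hence a power
  saving.\<close>

definition mean :: "'i set \<Rightarrow> ('i \<Rightarrow> 'v::real_normed_field) \<Rightarrow> 'v" where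
  "mean A f = (\<Sum>x\<in>A. f x) / of_nat (card A)"

lemma mean_cong: "A = B \<Longrightarrow> (\<And>x. x \<in> B \<Longrightarrow> f x = g x) \<Longrightarrow> mean A f = mean B g"
  by (simp add: mean_def)

lemma mean_const: "finite A \<Longrightarrow> A \<noteq> {} \<Longrightarrow> mean A (\<lambda>_. c) = c"
  by (simp add: mean_def)

lemma mean_mono:
  fixes f g :: "'i \<Rightarrow> real"
  shows "(\<And>x. x \<in> A \<Longrightarrow> f x \<le> g x) \<Longrightarrow> mean A f \<le> mean A g"
  unfolding mean_def by (intro divide_right_mono sum_mono) auto

lemma norm_mean_le: "norm (mean A f) \<le> mean A (\<lambda>x. norm (f x))"
  unfolding mean_def by (simp add: norm_divide divide_right_mono norm_sum)

lemma mean_le: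
  fixes f :: "'i \<Rightarrow> real"
  assumes "finite A" "A \<noteq> {}" "\<And>x. x \<in> A \<Longrightarrow> f x \<le> c"
  shows "mean A f \<le> c"
  using mean_mono[of A f "\<lambda>_. c"] assms by (simp add: mean_const)

lemma norm_mean_bound:
  assumes "finite A" "A \<noteq> {}" "\<And>x. x \<in> A \<Longrightarrow> norm (f x) \<le> c"
  shows "norm (mean A f) \<le> c"
  by (rule order_trans[OF norm_mean_le mean_le]) (use assms in auto)

lemma mean_nonneg:
  fixes f :: "'i \<Rightarrow> real"
  shows "(\<And>x. x \<in> A \<Longrightarrow> 0 \<le> f x) \<Longrightarrow> 0 \<le> mean A f"
  by (simp add: mean_def sum_nonneg)

lemma mean_diff: "mean A (\<lambda>x. f x - g x) = mean A f - mean A g"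
  by (simp add: mean_def sum_subtractf diff_divide_distrib)

lemma mean_cmult: "mean A (\<lambda>x. c * f x) = c * mean A f"
  by (simp add: mean_def sum_distrib_left)

lemma Re_mean: "Re (mean A f) = mean A (\<lambda>x. Re (f x))"
  by (simp add: mean_def Re_divide_of_nat)

lemma mean_swap: "mean A (\<lambda>x. mean B (f x)) = mean B (\<lambda>y. mean A (\<lambda>x. f x y))"
  unfolding mean_def sum_divide_distrib
  by (subst sum.swap) (simp add: mult.commute)

lemma mean_Times: "mean (A \<times> B) f = mean A (\<lambda>a. mean B (\<lambda>b. f (a, b)))"
  unfolding mean_def sum_divide_distrib
  by (simp add: sum.cartesian_product card_cartesian_product mult.commute)

lemma mean_reindex:
  assumes "bij_betw h A B"
  shows "mean B f = mean A (\<lambda>x. f (h x))"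
  unfolding mean_def using sum.reindex_bij_betw[OF assms, of f] bij_betw_same_card[OF assms] by simp

lemma mean_power2_le:
  fixes f :: "'i \<Rightarrow> real"
  shows "(mean A f)\<^sup>2 \<le> mean A (\<lambda>x. (f x)\<^sup>2)"
proof (cases "finite A \<and> A \<noteq> {}")
  case True
  have "(sum f A)\<^sup>2 \<le> (\<Sum>y\<in>A. (f y)\<^sup>2) * card A"
    by (rule sum_squared_le_sum_of_squares)
  moreover have "0 < real (card A)" using True by (simp add: card_gt_0_iff)
  ultimately show ?thesis
    by (simp add: mean_def power_divide) (simp add: power2_eq_square field_simps)
next
  case False
  then show ?thesis by (auto simp: mean_def)
qed

text \<open>Only exponents \<open>2 ^ k\<close> occur, so the squaring case of Jensen, iterated, is
  enough.\<close>

lemma mean_power_le: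
  fixes f :: "'i \<Rightarrow> real"
  assumes "\<And>x. x \<in> A \<Longrightarrow> 0 \<le> f x"
  shows "(mean A f) ^ (2 ^ k) \<le> mean A (\<lambda>x. f x ^ (2 ^ k))"
proof (induction k)
  case (Suc k)
  have "(mean A f) ^ (2 ^ Suc k) = ((mean A f) ^ (2 ^ k))\<^sup>2"
    by (simp add: power_mult[symmetric] mult.commute)
  also have "\<dots> \<le> (mean A (\<lambda>x. f x ^ (2 ^ k)))\<^sup>2"
    by (intro power_mono Suc zero_le_power mean_nonneg assms)
  also have "\<dots> \<le> mean A (\<lambda>x. (f x ^ (2 ^ k))\<^sup>2)" by (rule mean_power2_le)
  also have "\<dots> = mean A (\<lambda>x. f x ^ (2 ^ Suc k))"
    by (simp add: power_mult[symmetric] mult.commute)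
  finally show ?case .
qed simp

lemma mean_PiE_Suc:
  "mean (PiE {..<Suc k} A) F = mean (PiE {..<k} A) (\<lambda>g. mean (A k) (\<lambda>a. F (g(k := a))))"
proof -
  have inj: "inj_on (\<lambda>(y, g). g(k := y)) (A k \<times> PiE {..<k} A)"
    by (rule inj_combinator) simp
  have eq: "PiE {..<Suc k} A = (\<lambda>(y, g). g(k := y)) ` (A k \<times> PiE {..<k} A)"
    by (simp add: lessThan_Suc PiE_insert_eq)
  have "mean (PiE {..<Suc k} A) F = mean (A k \<times> PiE {..<k} A) (\<lambda>(y, g). F (g(k := y)))"
    by (subst mean_reindex[of "\<lambda>(y, g). g(k := y)" "A k \<times> PiE {..<k} A"])
       (use inj in \<open>auto simp: bij_betw_def eq case_prod_unfold\<close>)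
  also have "\<dots> = mean (PiE {..<k} A) (\<lambda>g. mean (A k) (\<lambda>a. F (g(k := a))))"
    by (simp add: mean_Times mean_swap[of "A k"])
  finally show ?thesis .
qed

lemma mean_PiE_0: "mean (PiE {..<0::nat} A) F = F (\<lambda>_. undefined)"
  by (simp add: mean_def)

section \<open>Vertices of cubes and alternating sums over them\<close>

definition mix :: "nat set \<Rightarrow> (nat \<Rightarrow> 'a \<times> 'a) \<Rightarrow> nat \<Rightarrow> 'a" where
  "mix S h = (\<lambda>i. if i \<in> S then snd (h i) else fst (h i))"

definition alt :: "nat \<Rightarrow> (nat set \<Rightarrow> real) \<Rightarrow> real" where
  "alt k \<phi> = (\<Sum>S\<in>Pow {..<k}. (-1) ^ card S * \<phi> S)"

lemma alt_cong: "(\<And>S. S \<subseteq> {..<k} \<Longrightarrow> \<phi> S = \<psi> S) \<Longrightarrow> alt k \<phi> = alt k \<psi>"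
  unfolding alt_def by (intro sum.cong) auto

lemma alt_add: "alt k (\<lambda>S. \<phi> S + \<psi> S) = alt k \<phi> + alt k \<psi>"
  by (simp add: alt_def sum.distrib algebra_simps)

lemma alt_diff: "alt k (\<lambda>S. \<phi> S - \<psi> S) = alt k \<phi> - alt k \<psi>"
  by (simp add: alt_def sum_subtractf algebra_simps)

lemma alt_cmult: "alt k (\<lambda>S. c * \<phi> S) = c * alt k \<phi>"
  by (simp add: alt_def sum_distrib_left mult_ac)

lemma alt_sum: "alt k (\<lambda>S. \<Sum>j\<in>J. \<phi> j S) = (\<Sum>j\<in>J. alt k (\<phi> j))"
  unfolding alt_def sum_distrib_left by (rule sum.swap)

text \<open>Each vertex is paired with its neighbour in direction \<open>j\<close>. The removal of
  digits rests on this form: a function with equal values at both ends of every edge in direction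
  \<open>j\<close> has alternating sum 0.\<close>

lemma alt_insert:
  assumes "j < k"
  shows "alt k \<phi> = (\<Sum>S\<in>Pow ({..<k} - {j}). (-1) ^ card S * (\<phi> S - \<phi> (insert j S)))"
proof -
  have k: "{..<k} = insert j ({..<k} - {j})" using assms by auto
  define X where "X = {..<k} - {j}"
  have X: "j \<notin> X" "finite X" by (auto simp: X_def)
  have fin: "S \<in> Pow X \<Longrightarrow> finite S" for S using X finite_subset by auto
  have inj: "inj_on (insert j) (Pow X)" using X by (auto simp: inj_on_def)
  have "alt k \<phi> = (\<Sum>S\<in>Pow X \<union> insert j ` Pow X. (-1) ^ card S * \<phi> S)"
    unfolding alt_def by (subst k, subst Pow_insert) (simp only: X_def)
  also have "\<dots> = (\<Sum>S\<in>Pow X. (-1) ^ card S * \<phi> S)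
      + (\<Sum>S\<in>insert j ` Pow X. (-1) ^ card S * \<phi> S)"
    using X by (intro sum.union_disjoint) auto
  also have "(\<Sum>S\<in>insert j ` Pow X. (-1) ^ card S * \<phi> S)
      = (\<Sum>S\<in>Pow X. (-1) ^ card (insert j S) * \<phi> (insert j S))"
    by (simp add: sum.reindex[OF inj])
  also have "\<dots> = (\<Sum>S\<in>Pow X. - ((-1) ^ card S * \<phi> (insert j S)))"
  proof (intro sum.cong refl)
    fix S assume S: "S \<in> Pow X"
    then have "card (insert j S) = Suc (card S)" using X fin[OF S] by (subst card_insert_disjoint) auto
    then show "(-1) ^ card (insert j S) * \<phi> (insert j S) = - ((-1) ^ card S * \<phi> (insert j S))" by simp
  qed
  finally show ?thesis
    by (simp add: X_def sum.distrib[symmetric] algebra_simps sum_subtractf sum_negf)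
qed

lemma alt_Suc: "alt (Suc k) \<phi> = alt k (\<lambda>S. \<phi> S - \<phi> (insert k S))"
proof -
  have "{..<Suc k} - {k} = {..<k}" by auto
  then show ?thesis using alt_insert[of k "Suc k" \<phi>] by (simp add: alt_def)
qed

lemma alt_const: "alt (Suc k) (\<lambda>_. c) = 0"
  by (simp add: alt_Suc) (simp add: alt_def)

text \<open>Expanding the square turns a mean into a mean over pairs; in this way each direction of
  the cube acquires its second endpoint.\<close>

lemma norm_mean_cis_power2:
  "(norm (mean A (\<lambda>a. cis (\<psi> a))))\<^sup>2 = Re (mean (A \<times> A) (\<lambda>(a, b). cis (\<psi> a - \<psi> b)))"
proof -
  let ?s = "\<Sum>a\<in>A. cis (\<psi> a)"
  have "complex_of_real ((norm ?s)\<^sup>2) = ?s * cnj ?s"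
    by (rule complex_norm_square)
  also have "\<dots> = (\<Sum>(a, b)\<in>A \<times> A. cis (\<psi> a - \<psi> b))"
    by (simp add: sum_product sum.cartesian_product cis_mult cis_cnj case_prod_unfold)
  finally have *: "complex_of_real ((norm ?s)\<^sup>2) = (\<Sum>(a, b)\<in>A \<times> A. cis (\<psi> a - \<psi> b))" .
  have "Re (mean (A \<times> A) (\<lambda>(a, b). cis (\<psi> a - \<psi> b))) = (norm ?s)\<^sup>2 / (card A * card A)"
    unfolding mean_def *[symmetric] by (simp add: card_cartesian_product del: of_real_power)
  then show ?thesis by (simp add: mean_def norm_divide power_divide power2_eq_square)
qed

lemma mix_fun_upd:
  "mix S (g(k := (a, b))) = (if k \<in> S then (mix S g)(k := b) else (mix S g)(k := a))"
  by (auto simp: mix_def)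

lemma mix_insert_upd: "(mix (insert k S) g)(k := b) = (mix S g)(k := b)"
  by (auto simp: mix_def)

text \<open>Cauchy-Schwarz in the other variables turns the last one into a pair
  \<open>(a, b)\<close> and \<open>\<phi>\<close> into the difference \<open>\<psi> a b\<close>, to
  which the induction hypothesis applies; Jensen restores the exponent. The hypothesis makes
  \<open>\<phi>\<close> blind to coordinates from \<open>Suc k\<close> on, where
  \<open>mix S h\<close> and a member of \<open>PiE\<close> may have different default
  values.\<close>

lemma box_inequality:
  assumes "\<And>g h. (\<And>i. i < Suc k \<Longrightarrow> g i = h i) \<Longrightarrow> \<phi> g = \<phi> h"
  shows "norm (mean (PiE {..<Suc k} A) (\<lambda>h. cis (\<phi> h))) ^ (2 ^ Suc k)
    \<le> Re (mean (PiE {..<Suc k} (\<lambda>i. A i \<times> A i)) (\<lambda>h. cis (alt (Suc k) (\<lambda>S. \<phi> (mix S h)))))"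
  using assms
proof (induction k arbitrary: \<phi>)
  case 0
  have c: "\<phi> ((mix S u)(0 := b)) = \<phi> ((\<lambda>_. undefined)(0 := b))" for S u b
    by (rule 0) auto
  have "norm (mean (PiE {..<Suc 0} A) (\<lambda>h. cis (\<phi> h))) ^ 2
    = Re (mean (A 0 \<times> A 0) (\<lambda>(a, b). cis (\<phi> ((\<lambda>_. undefined)(0 := a)) - \<phi> ((\<lambda>_. undefined)(0 := b)))))"
    by (simp only: mean_PiE_Suc[of 0] mean_PiE_0 norm_mean_cis_power2)
  also have "\<dots> = Re (mean (PiE {..<Suc 0} (\<lambda>i. A i \<times> A i)) (\<lambda>h. cis (alt (Suc 0) (\<lambda>S. \<phi> (mix S h)))))"
  proof (simp only: mean_PiE_Suc[of 0] mean_PiE_0, intro arg_cong[where f=Re] mean_cong refl)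
    fix ab assume "ab \<in> A 0 \<times> A 0"
    obtain a b where ab: "ab = (a, b)" by (cases ab)
    have "alt (Suc 0) (\<lambda>S. \<phi> (mix S ((\<lambda>_. undefined)(0 := ab))))
       = \<phi> (mix {} ((\<lambda>_. undefined)(0 := ab))) - \<phi> (mix {0} ((\<lambda>_. undefined)(0 := ab)))"
      by (simp add: alt_Suc) (simp add: alt_def)
    also have "\<dots> = \<phi> ((\<lambda>_. undefined)(0 := a)) - \<phi> ((\<lambda>_. undefined)(0 := b))"
      by (simp add: ab mix_fun_upd c)
    finally show "(case ab of (a, b) \<Rightarrow> cis (\<phi> ((\<lambda>_. undefined)(0 := a)) - \<phi> ((\<lambda>_. undefined)(0 := b))))
      = cis (alt (Suc 0) (\<lambda>S. \<phi> (mix S ((\<lambda>_. undefined)(0 := ab)))))"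
      by (simp add: ab)
  qed
  finally show ?case by simp
next
  case (Suc k)
  let ?P = "PiE {..<Suc k} A" and ?A = "A (Suc k)"
  let ?B = "PiE {..<Suc k} (\<lambda>i. A i \<times> A i)"
  define \<psi> where "\<psi> a b g = \<phi> (g(Suc k := a)) - \<phi> (g(Suc k := b))" for a b g
  have IH: "norm (mean ?P (\<lambda>h. cis (\<psi> a b h))) ^ (2 ^ Suc k)
      \<le> Re (mean ?B (\<lambda>h. cis (alt (Suc k) (\<lambda>S. \<psi> a b (mix S h)))))" for a b
    by (rule Suc.IH) (auto simp: \<psi>_def intro!: arg_cong2[where f=minus] Suc.prems)
  have "(norm (mean (PiE {..<Suc (Suc k)} A) (\<lambda>h. cis (\<phi> h))))\<^sup>2
      = (norm (mean ?P (\<lambda>g. mean ?A (\<lambda>a. cis (\<phi> (g(Suc k := a)))))))\<^sup>2"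
    by (simp add: mean_PiE_Suc[of "Suc k"])
  also have "\<dots> \<le> (mean ?P (\<lambda>g. norm (mean ?A (\<lambda>a. cis (\<phi> (g(Suc k := a)))))))\<^sup>2"
    by (intro power_mono norm_mean_le) auto
  also have "\<dots> \<le> mean ?P (\<lambda>g. (norm (mean ?A (\<lambda>a. cis (\<phi> (g(Suc k := a))))))\<^sup>2)"
    by (rule mean_power2_le)
  also have "\<dots> = Re (mean ?P (\<lambda>g. mean (?A \<times> ?A) (\<lambda>(a, b). cis (\<psi> a b g))))"
    by (simp add: norm_mean_cis_power2 Re_mean \<psi>_def)
  also have "\<dots> = Re (mean (?A \<times> ?A) (\<lambda>(a, b). mean ?P (\<lambda>g. cis (\<psi> a b g))))"
    by (subst mean_swap) (simp add: case_prod_unfold)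
  also have "\<dots> \<le> mean (?A \<times> ?A) (\<lambda>(a, b). norm (mean ?P (\<lambda>g. cis (\<psi> a b g))))"
    unfolding Re_mean[of "?A \<times> ?A"] by (intro mean_mono) (auto intro: complex_Re_le_cmod)
  finally have 1: "(norm (mean (PiE {..<Suc (Suc k)} A) (\<lambda>h. cis (\<phi> h))))\<^sup>2
      \<le> mean (?A \<times> ?A) (\<lambda>(a, b). norm (mean ?P (\<lambda>g. cis (\<psi> a b g))))" .
  have "norm (mean (PiE {..<Suc (Suc k)} A) (\<lambda>h. cis (\<phi> h))) ^ (2 ^ Suc (Suc k))
      = ((norm (mean (PiE {..<Suc (Suc k)} A) (\<lambda>h. cis (\<phi> h))))\<^sup>2) ^ (2 ^ Suc k)"
    by (simp add: power_mult[symmetric])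
  also have "\<dots> \<le> (mean (?A \<times> ?A) (\<lambda>(a, b). norm (mean ?P (\<lambda>g. cis (\<psi> a b g))))) ^ (2 ^ Suc k)"
    by (intro power_mono 1) auto
  also have "\<dots> \<le> mean (?A \<times> ?A) (\<lambda>x. (case x of (a, b) \<Rightarrow> norm (mean ?P (\<lambda>g. cis (\<psi> a b g)))) ^ (2 ^ Suc k))"
    by (rule mean_power_le) auto
  also have "\<dots> \<le> mean (?A \<times> ?A) (\<lambda>(a, b). Re (mean ?B (\<lambda>h. cis (alt (Suc k) (\<lambda>S. \<psi> a b (mix S h))))))"
    by (intro mean_mono) (use IH in \<open>auto simp del: power_Suc\<close>)
  also have "\<dots> = Re (mean ?B (\<lambda>h. mean (?A \<times> ?A) (\<lambda>(a, b). cis (alt (Suc k) (\<lambda>S. \<psi> a b (mix S h))))))"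
    by (subst mean_swap) (simp add: Re_mean case_prod_unfold)
  also have "\<dots> = Re (mean (PiE {..<Suc (Suc k)} (\<lambda>i. A i \<times> A i))
      (\<lambda>h. cis (alt (Suc (Suc k)) (\<lambda>S. \<phi> (mix S h)))))"
  proof (simp only: mean_PiE_Suc[of "Suc k"], intro arg_cong[where f=Re] mean_cong refl)
    fix h ab assume "ab \<in> ?A \<times> ?A"
    obtain a b where ab: "ab = (a, b)" by (cases ab)
    show "(case ab of (a, b) \<Rightarrow> cis (alt (Suc k) (\<lambda>S. \<psi> a b (mix S h))))
        = cis (alt (Suc (Suc k)) (\<lambda>S. \<phi> (mix S (h(Suc k := ab)))))"
      unfolding ab alt_Suc[of "Suc k"]
      by (auto intro!: arg_cong[where f=cis] alt_cong simp: \<psi>_def mix_fun_upd mix_insert_upd)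
  qed
  finally show ?case .
qed

section \<open>Digit sums on cubes\<close>

text \<open>A recursive digit sum on natural numbers suits inductions over blocks of digits;
  \<open>digit_sum_int\<close> links it to the series that defines \<open>digit_sum\<close>.\<close>

function ds :: "nat \<Rightarrow> nat \<Rightarrow> nat" where
  "ds q n = (if q < 2 \<or> n = 0 then 0 else n mod q + ds q (n div q))"
  by pat_completeness auto
termination by (relation "Wellfounded.measure snd") auto

declare ds.simps [simp del]

lemma ds_0 [simp]: "ds q 0 = 0"
  by (simp add: ds.simps)

lemma ds_rec: "2 \<le> q \<Longrightarrow> ds q n = n mod q + ds q (n div q)"
  by (cases "n = 0") (simp, subst ds.simps, simp)

lemma ds_less: "2 \<le> q \<Longrightarrow> n < q \<Longrightarrow> ds q n = n"
  by (simp add: ds_rec[of q n])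

lemma ds_split:
  assumes "2 \<le> q"
  shows "ds q n = ds q (n mod q ^ j) + ds q (n div q ^ j)"
proof (induction j arbitrary: n)
  case (Suc j)
  have "ds q n = n mod q + (ds q (n div q mod q ^ j) + ds q (n div q div q ^ j))"
    using ds_rec[OF assms, of n] Suc[of "n div q"] by simp
  moreover have "ds q (n mod q ^ Suc j) = n mod q + ds q (n div q mod q ^ j)"
    using assms ds_rec[OF assms, of "n mod q ^ Suc j"]
    by (simp add: mod_mult2_eq)
  ultimately show ?case by (simp add: div_mult2_eq)
qed (simp add: mod_by_1)

lemma ds_add:
  assumes "2 \<le> q" "v < q ^ j"
  shows "ds q (v + q ^ j * u) = ds q v + ds q u"
  using ds_split[OF assms(1), of "v + q ^ j * u" j] assms by simp

lemma ds_power: "2 \<le> q \<Longrightarrow> ds q (q ^ j) = 1"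
  using ds_add[of q 0 j 1] by (simp add: ds_less)

text \<open>Fubini after a change of variables in each coordinate. It is applied with
  \<open>v\<close> the low and \<open>z\<close> the high digits of every entry.\<close>

lemma mean_PiE_split:
  assumes "\<And>i. i \<in> I \<Longrightarrow> bij_betw (\<lambda>(v, z). f i v z) (V i \<times> Z i) (A i)"
  shows "mean (PiE I A) F = mean (PiE I Z) (\<lambda>z. mean (PiE I V) (\<lambda>v. F (\<lambda>i\<in>I. f i (v i) (z i))))"
proof -
  define g where "g i = the_inv_into (V i \<times> Z i) (\<lambda>(v, z). f i v z)" for i
  have g1: "g i (f i v z) = (v, z)" if "i \<in> I" "v \<in> V i" "z \<in> Z i" for i v z
    unfolding g_def using the_inv_into_f_f[OF bij_betw_imp_inj_on[OF assms[OF that(1)]], of "(v, z)"] that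
    by simp
  have g2: "g i a \<in> V i \<times> Z i" "f i (fst (g i a)) (snd (g i a)) = a" if "i \<in> I" "a \<in> A i" for i a
    using bij_betw_apply[OF bij_betw_the_inv_into[OF assms[OF that(1)]], of a]
      f_the_inv_into_f_bij_betw[OF assms[OF that(1)], of a] that
    by (auto simp: g_def case_prod_unfold)
  have fA: "f i v z \<in> A i" if "i \<in> I" "v \<in> V i" "z \<in> Z i" for i v z
    using bij_betw_apply[OF assms[OF that(1)], of "(v, z)"] that by simp
  have "bij_betw (\<lambda>(z, v). \<lambda>i\<in>I. f i (v i) (z i)) (PiE I Z \<times> PiE I V) (PiE I A)"
    by (rule bij_betw_byWitness[where f' = "\<lambda>h. (\<lambda>i\<in>I. snd (g i (h i)), \<lambda>i\<in>I. fst (g i (h i)))"])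
       (use g2(1) in \<open>auto simp: PiE_def Pi_def extensional_def fun_eq_iff g1 g2(2) fA mem_Times_iff\<close>)
  from mean_reindex[OF this] show ?thesis by (simp add: mean_Times)
qed

section \<open>Cube averages with carries\<close>

definition ysum :: "nat \<Rightarrow> nat set \<Rightarrow> (nat \<Rightarrow> nat \<times> nat) \<Rightarrow> nat" where
  "ysum k S h = (\<Sum>i<k. mix S h i)"

text \<open>The argument of \<open>Tail\<close> is the vector of carries out of the lowest digits at the vertices of the cube.\<close>

definition boxmean ::
    "nat \<Rightarrow> real \<Rightarrow> nat \<Rightarrow> nat \<Rightarrow> (nat set \<Rightarrow> nat) \<Rightarrow> ((nat set \<Rightarrow> nat) \<Rightarrow> complex) \<Rightarrow> complex" where
  "boxmean q \<theta> k M e Tail = mean (PiE {..<k} (\<lambda>_. {..<M} \<times> {..<M}))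
     (\<lambda>h. cis (\<theta> * alt k (\<lambda>S. real (ds q ((ysum k S h + e S) mod M))))
        * Tail (\<lambda>S. (ysum k S h + e S) div M))"

lemma bij_digits_pair:
  fixes B M :: nat
  assumes "0 < B"
  shows "bij_betw (\<lambda>(u, v). (fst u + B * fst v, snd u + B * snd v))
    (({..<B} \<times> {..<B}) \<times> ({..<M} \<times> {..<M})) ({..<B * M} \<times> {..<B * M})"
proof -
  have *: "u + B * v < B * M" if "u < B" "v < M" for u v
  proof -
    have "u + B * v < B * Suc v" using that by simp
    also have "\<dots> \<le> B * M" using that by (intro mult_le_mono) auto
    finally show ?thesis .
  qed
  show ?thesis
    by (rule bij_betw_byWitness[where f' = "\<lambda>(x, y). ((x mod B, y mod B), (x div B, y div B))"])
       (use assms * in \<open>auto simp: less_mult_imp_div_less mult.commute\<close>)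
qed

lemma ysum_digits:
  "ysum k S (\<lambda>i\<in>{..<k}. (fst (u i) + B * fst (v i), snd (u i) + B * snd (v i)))
    = ysum k S u + B * ysum k S v"
  by (auto simp: ysum_def mix_def sum.distrib[symmetric] sum_distrib_left intro!: sum.cong)

text \<open>The lowest \<open>l\<close> digits of all \<open>2 * k\<close> entries are averaged
  separately. What they send to the higher digits is again a carry at each vertex, so the remaining
  average has the same shape, and \<open>ds_add\<close> splits the phase.\<close>

lemma boxmean_rec:
  assumes "2 \<le> q"
  shows "boxmean q \<theta> k (q ^ l * M) e Tail =
    mean (PiE {..<k} (\<lambda>_. {..<q ^ l} \<times> {..<q ^ l}))
     (\<lambda>u. cis (\<theta> * alt k (\<lambda>S. real (ds q ((ysum k S u + e S) mod q ^ l))))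
        * boxmean q \<theta> k M (\<lambda>S. (ysum k S u + e S) div q ^ l) Tail)"
proof -
  let ?B = "q ^ l"
  have md: "(a + ?B * b + c) mod (?B * M) = (a + c) mod ?B + ?B * ((b + (a + c) div ?B) mod M)"
    "(a + ?B * b + c) div (?B * M) = (b + (a + c) div ?B) div M" for a b c
  proof -
    have dv: "(a + c + ?B * b) div ?B = b + (a + c) div ?B" "(a + c + ?B * b) mod ?B = (a + c) mod ?B"
      using assms by auto
    have e: "a + ?B * b + c = a + c + ?B * b" by simp
    have "(a + c + ?B * b) mod (?B * M) = ?B * ((a + c + ?B * b) div ?B mod M) + (a + c + ?B * b) mod ?B"
      by (rule mod_mult2_eq)
    then show "(a + ?B * b + c) mod (?B * M) = (a + c) mod ?B + ?B * ((b + (a + c) div ?B) mod M)"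
      unfolding e dv by simp
    have "(a + c + ?B * b) div (?B * M) = (a + c + ?B * b) div ?B div M" by (rule div_mult2_eq)
    then show "(a + ?B * b + c) div (?B * M) = (b + (a + c) div ?B) div M"
      unfolding e dv .
  qed
  have dsm: "ds q ((a + ?B * b + c) mod (?B * M))
     = ds q ((a + c) mod ?B) + ds q ((b + (a + c) div ?B) mod M)" for a b c
    unfolding md by (rule ds_add) (use assms in auto)
  have "boxmean q \<theta> k (?B * M) e Tail =
    mean (PiE {..<k} (\<lambda>_. {..<M} \<times> {..<M})) (\<lambda>v. mean (PiE {..<k} (\<lambda>_. {..<?B} \<times> {..<?B})) (\<lambda>u.
     cis (\<theta> * alt k (\<lambda>S. real (ds q ((ysum k S u + e S) mod ?B))))
       * (cis (\<theta> * alt k (\<lambda>S. real (ds q ((ysum k S v + (ysum k S u + e S) div ?B) mod M))))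
          * Tail (\<lambda>S. (ysum k S v + (ysum k S u + e S) div ?B) div M))))"
    unfolding boxmean_def
    by (subst mean_PiE_split[where f = "\<lambda>i u v. (fst u + ?B * fst v, snd u + ?B * snd v)",
          OF bij_digits_pair])
       (use assms in simp, simp add: ysum_digits md(2) dsm alt_add cis_mult[symmetric] distrib_left mult.assoc)
  then show ?thesis
    by (subst (asm) mean_swap) (simp add: boxmean_def mean_cmult)
qed

text \<open>Two terms that partly cancel contribute \<open>\<gamma> * g\<close> in place of
  \<open>2 * g\<close>; all other terms may be bounded trivially.\<close>

lemma norm_mean_two_le:
  assumes "finite D" "a \<in> D" "b \<in> D" "a \<noteq> b" "\<And>x. x \<in> D \<Longrightarrow> norm (F x) \<le> g"
    and "norm (F a + F b) \<le> \<gamma> * g"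
  shows "norm (mean D F) \<le> (1 - (2 - \<gamma>) / card D) * g"
proof -
  have D: "D = insert a (insert b (D - {a, b}))" using assms by auto
  have c: "card D = card (D - {a, b}) + 2"
    using assms card_Diff_subset[of "{a, b}" D] card_mono[of D "{a, b}"] by simp
  have r: "norm (sum F (D - {a, b})) \<le> real (card (D - {a, b})) * g"
    using sum_norm_le[of "D - {a, b}" F "\<lambda>_. g"] assms by simp
  have "sum F D = F a + F b + sum F (D - {a, b})"
    using assms by (subst D) (simp add: add.assoc)
  also have "norm \<dots> \<le> \<gamma> * g + real (card (D - {a, b})) * g"
    by (rule norm_triangle_le[OF add_mono]) (use assms r in auto)
  also have "\<dots> = (card D - (2 - \<gamma>)) * g"
    by (simp add: c algebra_simps)
  finally have "norm (sum F D) / card D \<le> (card D - (2 - \<gamma>)) * g / card D"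
    by (rule divide_right_mono) simp
  moreover have "(1 - (2 - \<gamma>) / card D) * g = (card D - (2 - \<gamma>)) * g / card D"
  proof -
    have "0 < real (card D)" using c by simp
    then show ?thesis by (simp add: field_simps)
  qed
  ultimately show ?thesis by (simp add: mean_def norm_divide)
qed

text \<open>For \<open>\<beta> = q ^ l0\<close> the vertices of the cube are \<open>\<beta> * (n + |S|)\<close>, so the carries \<open>e S \<le> k\<close> stay in the
  low digits. If \<open>n + k\<close> is a power of \<open>q\<close>, the increment from \<open>n + k - 1\<close> to \<open>n + k\<close> carries through
  all digits; two consecutive powers give phases that differ by \<open>\<theta> * (q - 1)\<close>.\<close>

definition test_block :: "nat \<Rightarrow> nat \<Rightarrow> nat \<Rightarrow> nat \<Rightarrow> nat \<times> nat" where
  "test_block k \<beta> n = (\<lambda>i\<in>{..<k}. if i = 0 then (\<beta> * n, \<beta> * (n + 1)) else (0, \<beta>))"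

lemma ysum_test_block:
  assumes "0 < k"
  shows "ysum k S (test_block k \<beta> n) = \<beta> * (n + card (S \<inter> {..<k}))"
proof -
  have "ysum k S (test_block k \<beta> n)
    = (\<Sum>i<k. (if i = 0 then \<beta> * n else 0) + (if i \<in> S \<inter> {..<k} then \<beta> else 0))"
    unfolding ysum_def by (intro sum.cong) (auto simp: mix_def test_block_def)
  also have "\<dots> = \<beta> * n + \<beta> * card (S \<inter> {..<k})"
    using assms by (simp add: sum.distrib sum.delta sum.If_cases) (simp add: Int_commute)
  finally show ?thesis by (simp add: algebra_simps)
qed

lemma norm_one_plus_cis_minus: "norm (1 + cis (- x)) = norm (1 + cis x)"
proof -
  have "1 + cis (- x) = cnj (1 + cis x)" by (simp add: cis_cnj)
  then show ?thesis by (simp only: complex_mod_cnj)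
qed

lemma norm_cis_add:
  assumes "a - b = x \<or> a - b = - x"
  shows "norm (cis a * G + cis b * G) = norm (1 + cis x) * norm G"
proof -
  have "cis a * G + cis b * G = cis b * (1 + cis (a - b)) * G"
    by (simp add: algebra_simps cis_mult)
  then show ?thesis using assms norm_one_plus_cis_minus[of x] by (auto simp: norm_mult)
qed

text \<open>A block of \<open>l = 2 * l0 + 2\<close> digits has room for one test cube: the lowest
  \<open>l0\<close> digits take an incoming carry, at most \<open>k < q ^ l0\<close>, and the other
  \<open>l0 + 2\<close> take the numbers \<open>n + |S| \<le> q ^ (l0 + 1)\<close>, so that nothing
  is carried out.\<close>

locale contraction =
  fixes q k l0 l :: nat and \<theta> :: real
  assumes q2: "2 \<le> q" and k0: "0 < k" and l0: "k < q ^ l0" and l_def: "l = 2 * l0 + 2"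
begin

definition \<gamma> where "\<gamma> = norm (1 + cis (\<theta> * (real q - 1)))"

text \<open>\<open>(q ^ l) ^ (2 * k)\<close> is the number of ways to fill one block of digits in
  all \<open>2 * k\<close> entries of a cube; the two test cubes are two of these ways.\<close>

definition \<rho> where "\<rho> = 1 - (2 - \<gamma>) / (real q ^ l) ^ (2 * k)"

lemma \<gamma>_nonneg: "0 \<le> \<gamma>" by (simp add: \<gamma>_def)

definition n1 where "n1 = q ^ l0 - k"
definition n2 where "n2 = q ^ (l0 + 1) - k"

lemma n12: "n1 + k = q ^ l0" "n2 + k = q ^ (l0 + 1)" "n1 < n2"
proof -
  have "q ^ l0 < q ^ (l0 + 1)" using q2 by (intro power_strict_increasing) auto
  then show "n1 + k = q ^ l0" "n2 + k = q ^ (l0 + 1)" "n1 < n2"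
    using l0 unfolding n1_def n2_def by linarith+
qed

text \<open>For \<open>c < k\<close> the number \<open>n2 + c\<close> arises from
  \<open>n1 + c < q ^ l0\<close> by adding the digit \<open>q - 1\<close> at position
  \<open>l0\<close>; for \<open>c = k\<close> both are powers of \<open>q\<close>, with digit sum
  1.\<close>

lemma ds_n12:
  assumes "c \<le> k"
  shows "real (ds q (n2 + c)) - real (ds q (n1 + c)) = (real q - 1) * (if c < k then 1 else 0)"
proof (cases "c < k")
  case True
  have lt: "n1 + c < q ^ l0" using True n12 by simp
  have "q ^ (l0 + 1) = (q - 1) * q ^ l0 + q ^ l0"
    using q2 by (cases q) auto
  then have "n2 = q ^ l0 * (q - 1) + n1" using n12 by (simp add: mult.commute)
  then have e: "n2 + c = (n1 + c) + q ^ l0 * (q - 1)" by simp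
  have "ds q (n2 + c) = ds q (n1 + c) + (q - 1)"
    unfolding e using ds_add[OF q2 lt, of "q - 1"] q2 by (simp add: ds_less)
  then show ?thesis using True q2 by (simp add: of_nat_diff)
next
  case False
  then have "c = k" using assms by simp
  then show ?thesis using n12 ds_power[OF q2, of l0] ds_power[OF q2, of "l0 + 1"] by (simp del: power_Suc)
qed

lemma test_block_mem:
  assumes "n + k \<le> q ^ (l0 + 1)"
  shows "test_block k (q ^ l0) n \<in> PiE {..<k} (\<lambda>_. {..<q ^ l} \<times> {..<q ^ l})"
proof -
  have "q ^ l0 * (n + k) \<le> q ^ l0 * q ^ (l0 + 1)" using assms by (rule mult_le_mono2)
  also have "\<dots> = q ^ (2 * l0 + 1)" by (simp add: power_add[symmetric] mult_2)
  also have "\<dots> < q ^ l" using q2 by (intro power_strict_increasing) (auto simp: l_def)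
  finally have *: "q ^ l0 * (n + k) < q ^ l" .
  have "q ^ l0 * n \<le> q ^ l0 * (n + k)" "q ^ l0 * (n + 1) \<le> q ^ l0 * (n + k)" "q ^ l0 * 1 \<le> q ^ l0 * (n + k)"
    using k0 by (intro mult_le_mono2; simp)+
  with * have "q ^ l0 * n < q ^ l" "q ^ l0 * (n + 1) < q ^ l" "q ^ l0 < q ^ l" "0 < q ^ l" by linarith+
  then show ?thesis by (auto simp: test_block_def simp del: mult_Suc_right)
qed

lemma test_block_digits:
  assumes "n + k \<le> q ^ (l0 + 1)" "e S \<le> k"
  shows "(ysum k S (test_block k (q ^ l0) n) + e S) div q ^ l = 0"
    and "ds q ((ysum k S (test_block k (q ^ l0) n) + e S) mod q ^ l)
      = ds q (e S) + ds q (n + card (S \<inter> {..<k}))"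
proof -
  let ?c = "card (S \<inter> {..<k})"
  have c: "?c \<le> k" using card_mono[of "{..<k}" "S \<inter> {..<k}"] by simp
  have "q ^ l0 * (n + ?c) \<le> q ^ l0 * q ^ (l0 + 1)" using assms c by (intro mult_le_mono2) simp
  also have "\<dots> = q ^ (2 * l0 + 1)" by (simp add: power_add[symmetric] mult_2)
  finally have "q ^ l0 * (n + ?c) + e S < q ^ (2 * l0 + 1) + q ^ (2 * l0 + 1)"
    using assms l0 power_increasing[of l0 "2 * l0 + 1" q] q2 by simp
  also have "\<dots> = 2 * q ^ (2 * l0 + 1)" by simp
  also have "\<dots> \<le> q * q ^ (2 * l0 + 1)" using q2 by (rule mult_le_mono1)
  also have "\<dots> = q ^ l" by (simp add: l_def)
  finally have lt: "q ^ l0 * (n + ?c) + e S < q ^ l" .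
  show "(ysum k S (test_block k (q ^ l0) n) + e S) div q ^ l = 0"
    using lt by (simp add: ysum_test_block[OF k0])
  have "e S < q ^ l0" using assms l0 by simp
  from ds_add[OF q2 this, of "n + ?c"] lt
  show "ds q ((ysum k S (test_block k (q ^ l0) n) + e S) mod q ^ l) = ds q (e S) + ds q (n + ?c)"
    by (simp add: ysum_test_block[OF k0] add.commute)
qed

lemma test_block_neq: "test_block k (q ^ l0) n1 \<noteq> test_block k (q ^ l0) n2"
proof
  assume "test_block k (q ^ l0) n1 = test_block k (q ^ l0) n2"
  then have "test_block k (q ^ l0) n1 0 = test_block k (q ^ l0) n2 0" by simp
  then show False using n12 q2 k0 by (simp add: test_block_def)
qed

text \<open>The function is 1 except at the top vertex \<open>{..<k}\<close>, and alternating sums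
  of constants vanish. Through \<open>ds_n12\<close> this leaves a phase difference of
  \<open>\<theta> * (q - 1)\<close> up to sign.\<close>

lemma alt_card_less: "alt k (\<lambda>S. if card (S \<inter> {..<k}) < k then 1 else 0) = - ((-1) ^ k)"
proof -
  have "(if card (S \<inter> {..<k}) < k then 1 else 0::real) = 1 - (if S = {..<k} then 1 else 0)"
    if "S \<subseteq> {..<k}" for S
    using that psubset_card_mono[of "{..<k}" S] by (auto simp: Int_absorb2)
  then have "alt k (\<lambda>S. if card (S \<inter> {..<k}) < k then 1 else 0)
     = alt k (\<lambda>S. 1 - (if S = {..<k} then 1 else 0))"
    by (intro alt_cong) simp
  also have "\<dots> = alt k (\<lambda>_. 1) - alt k (\<lambda>S. if S = {..<k} then 1 else 0)"
    by (rule alt_diff)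
  also have "alt k (\<lambda>_. 1) = 0" using k0 alt_const[of "k - 1" 1] by simp
  also have "alt k (\<lambda>S. if S = {..<k} then 1 else 0) = (-1) ^ k"
    by (simp add: alt_def if_distrib sum.delta cong: if_cong)
  finally show ?thesis by simp
qed

text \<open>The bound \<open>g\<close> is assumed for all carry vectors with entries at most
  \<open>k\<close>, since a block of digits maps this set to itself:
  \<open>k * (q ^ l - 1) + k = k * q ^ l\<close>.\<close>

lemma mean_two_blocks_le:
  assumes "\<And>S. e S \<le> k" and "\<And>e. (\<And>S. e S \<le> k) \<Longrightarrow> norm (boxmean q \<theta> k M e Tail) \<le> g"
  shows "norm (boxmean q \<theta> k (q ^ l * M) e Tail) \<le> \<rho> * g"
proof -
  let ?D = "PiE {..<k} (\<lambda>_. {..<q ^ l} \<times> {..<q ^ l})"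
  define ph where "ph u = \<theta> * alt k (\<lambda>S. real (ds q ((ysum k S u + e S) mod q ^ l)))" for u
  define G where "G u = boxmean q \<theta> k M (\<lambda>S. (ysum k S u + e S) div q ^ l) Tail" for u
  let ?a = "test_block k (q ^ l0) n1" and ?b = "test_block k (q ^ l0) n2"
  have n: "n1 + k \<le> q ^ (l0 + 1)" "n2 + k \<le> q ^ (l0 + 1)"
    using n12 power_increasing[of l0 "l0 + 1" q] q2 by auto
  have "finite ?D" by (intro finite_PiE) auto
  moreover have "?a \<in> ?D" "?b \<in> ?D" using test_block_mem n by auto
  moreover have "norm (cis (ph u) * G u) \<le> g" if u: "u \<in> ?D" for u
  proof -
    have "(ysum k S u + e S) div q ^ l \<le> k" for S
    proof -
      have "mix S u i \<le> q ^ l - 1" if "i < k" for i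
      proof -
        have "u i \<in> {..<q ^ l} \<times> {..<q ^ l}" using u that by (auto simp: PiE_def Pi_def)
        then have "fst (u i) < q ^ l" "snd (u i) < q ^ l" by (auto simp: mem_Times_iff)
        then show ?thesis unfolding mix_def by (auto simp del: power_Suc)
      qed
      then have "ysum k S u \<le> (\<Sum>i<k. q ^ l - 1)" unfolding ysum_def by (intro sum_mono) simp
      then have "ysum k S u + e S \<le> k * (q ^ l - 1) + k"
        using assms(1)[of S] by (simp del: power_Suc)
      also have "\<dots> = k * q ^ l" using q2
        by (metis Suc_pred' add.commute mult_Suc_right pos2 zero_less_power less_le_trans)
      finally have "(ysum k S u + e S) div q ^ l \<le> (k * q ^ l) div q ^ l" by (rule div_le_mono)
      also have "\<dots> = k" using q2 by simp
      finally show ?thesis .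
    qed
    then have "norm (G u) \<le> g" unfolding G_def by (rule assms(2))
    then show ?thesis by (simp add: norm_mult)
  qed
  moreover have "norm (cis (ph ?a) * G ?a + cis (ph ?b) * G ?b) \<le> \<gamma> * g"
  proof -
    note dg = test_block_digits[of n1, OF n(1), of e, OF assms(1)] test_block_digits[of n2, OF n(2), of e, OF assms(1)]
    \<comment> \<open>Both test cubes pass on the carry vector 0, so the same factor follows both
      phases; only then can they cancel.\<close>
    have G: "G ?a = boxmean q \<theta> k M (\<lambda>_. 0) Tail" "G ?b = boxmean q \<theta> k M (\<lambda>_. 0) Tail"
      unfolding G_def dg by simp_all
    have c: "card (S \<inter> {..<k}) \<le> k" for S using card_mono[of "{..<k}" "S \<inter> {..<k}"] by simp
    have "ph ?b - ph ?a = \<theta> * alt k (\<lambda>S. real (ds q (n2 + card (S \<inter> {..<k})))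
        - real (ds q (n1 + card (S \<inter> {..<k}))))"
      unfolding ph_def dg
      by (simp only: right_diff_distrib[symmetric] alt_diff[symmetric]) simp
    also have "\<dots> = \<theta> * ((real q - 1) * - ((-1) ^ k))"
      by (simp only: ds_n12[OF c] alt_cmult alt_card_less)
    finally have d: "ph ?b - ph ?a = \<theta> * ((real q - 1) * - ((-1) ^ k))" .
    have "ph ?a - ph ?b = \<theta> * (real q - 1) \<or> ph ?a - ph ?b = - (\<theta> * (real q - 1))"
      using d by (cases "even k") (auto simp: algebra_simps)
    then have "norm (cis (ph ?a) * G ?a + cis (ph ?b) * G ?b)
       = norm (1 + cis (\<theta> * (real q - 1))) * norm (boxmean q \<theta> k M (\<lambda>_. 0) Tail)"
      unfolding G by (rule norm_cis_add)
    also have "\<dots> \<le> \<gamma> * g"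
      unfolding \<gamma>_def by (intro mult_left_mono assms(2)) auto
    finally show ?thesis .
  qed
  ultimately have "norm (mean ?D (\<lambda>u. cis (ph u) * G u)) \<le> (1 - (2 - \<gamma>) / card ?D) * g"
    by (intro norm_mean_two_le[OF _ _ _ test_block_neq]) auto
  moreover have "real (card ?D) = (real q ^ l) ^ (2 * k)"
    by (simp add: card_PiE card_cartesian_product power_mult power_mult_distrib[symmetric] power2_eq_square)
  ultimately show ?thesis
    unfolding boxmean_rec[OF q2] ph_def G_def by (simp add: \<rho>_def)
qed

lemma boxmean_le:
  assumes "\<And>e. norm (Tail e) \<le> 1" and "\<And>S. e S \<le> k"
  shows "norm (boxmean q \<theta> k (q ^ (l * t)) e Tail) \<le> \<rho> ^ t"
  using assms(2)
proof (induction t arbitrary: e)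
  case 0
  have "PiE {..<k} (\<lambda>_. {..<1::nat} \<times> {..<1::nat}) \<noteq> {}"
    by (simp add: PiE_eq_empty_iff lessThan_Suc)
  then show ?case
    unfolding boxmean_def
    by (intro norm_mean_bound) (auto simp: norm_mult assms(1) intro!: finite_PiE)
next
  case (Suc t)
  have "q ^ (l * Suc t) = q ^ l * q ^ (l * t)" by (simp add: power_add)
  moreover note mean_two_blocks_le[of e "q ^ (l * t)" Tail, OF Suc.prems Suc.IH]
  ultimately show ?case by simp
qed

end

section \<open>Averages over truncated digit sums\<close>

lemmas nat_int_cong_def = unique_euclidean_semiring_class.cong_def

text \<open>With \<open>V\<close> inverse to \<open>U\<close>, the substitution
  \<open>V * (y + s)\<close> lets a full range of residues absorb both the unit \<open>U\<close> and
  an arbitrary translation \<open>s\<close>.\<close>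

lemma affine_bij_mod:
  assumes "2 \<le> q" "coprime U q"
  obtains a where "bij_betw a {..<q ^ r} {..<q ^ r}"
    "\<And>y::nat. [q ^ c * U * a y = q ^ c * (y + s)] (mod q ^ r)"
proof -
  have "coprime U (q ^ r)" using assms by simp
  then obtain V where V: "[U * V = 1] (mod q ^ r)"
    using cong_solve_coprime_nat[of U "q ^ r"] by auto
  then have cV: "coprime V (q ^ r)"
    by (metis cong_imp_coprime cong_sym coprime_1_left coprime_mult_left_iff)
  define a where "a y = (V * (y + s)) mod q ^ r" for y
  have "inj_on a {..<q ^ r}"
  proof (rule inj_onI)
    fix x y assume xy: "x \<in> {..<q ^ r}" "y \<in> {..<q ^ r}" "a x = a y"
    then have "[V * (x + s) = V * (y + s)] (mod q ^ r)" by (simp add: a_def nat_int_cong_def)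
    then have "[x = y] (mod q ^ r)"
      using cV by (simp add: cong_mult_lcancel_nat cong_add_rcancel_nat)
    then show "x = y" using xy by (simp add: nat_int_cong_def)
  qed
  moreover have "a ` {..<q ^ r} \<subseteq> {..<q ^ r}" using assms by (auto simp: a_def)
  ultimately have "bij_betw a {..<q ^ r} {..<q ^ r}"
    by (simp add: bij_betw_def endo_inj_surj)
  moreover have "[q ^ c * U * a y = q ^ c * (y + s)] (mod q ^ r)" for y
  proof -
    have "[q ^ c * U * a y = q ^ c * U * (V * (y + s))] (mod q ^ r)"
      by (intro cong_mult cong_refl) (simp add: a_def nat_int_cong_def)
    also have "q ^ c * U * (V * (y + s)) = q ^ c * (U * V) * (y + s)" by (simp add: ac_simps)
    also have "[\<dots> = q ^ c * 1 * (y + s)] (mod q ^ r)" by (intro cong_mult cong_refl V)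
    finally show ?thesis by simp
  qed
  ultimately show ?thesis using that by blast
qed

lemma bij_betw_pair:
  assumes "bij_betw a A B"
  shows "bij_betw (\<lambda>p. (a (fst p), a (snd p))) (A \<times> A) (B \<times> B)"
  using assms
  by (auto simp: bij_betw_def inj_on_def image_iff mem_Times_iff)

context contraction
begin

text \<open>New variables turn all shifts into \<open>q ^ (2 * u)\<close> and translate away the
  part of \<open>x\<close> above position \<open>2 * u\<close>. Then the lowest \<open>2 * u\<close>
  digits are those of \<open>x\<close> and constant, the next \<open>u = l * t\<close> digits form a
  standard \<open>boxmean\<close>, and those up to position \<open>5 * u\<close> go into
  \<open>Tail\<close>, which has modulus 1.\<close>

lemma truncated_box_le:
  fixes H \<kappa> :: "nat \<Rightarrow> nat"
  assumes k2: "2 \<le> k" and u: "u = l * t"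
    and H: "\<And>i. i < k - 1 \<Longrightarrow> H i = q ^ (5 * u)" "H (k - 1) = q ^ u"
    and full: "\<And>i. i < k - 1 \<Longrightarrow> \<exists>U. coprime U q \<and> [\<kappa> i = q ^ (2 * u) * U] (mod q ^ (5 * u))"
    and last: "[\<kappa> (k - 1) = q ^ (2 * u)] (mod q ^ (5 * u))"
  shows "norm (mean (PiE {..<k} (\<lambda>i. {..<H i} \<times> {..<H i}))
      (\<lambda>h. cis (\<theta> * alt k (\<lambda>S. real (ds q ((x + (\<Sum>i<k. \<kappa> i * mix S h i)) mod q ^ (5 * u)))))))
    \<le> \<rho> ^ t"
proof -
  let ?Q = "q ^ (5 * u)" and ?T = "q ^ (2 * u)"
  define x0 x1 where "x0 = x mod ?T" and "x1 = x div ?T"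
  have x_eq: "x = x0 + ?T * x1" by (simp add: x0_def x1_def)
  have Q0: "0 < ?Q" using q2 by simp
  \<comment> \<open>The whole translation is put on direction 0. Because of \<open>2 \<le> k\<close>
    it is not the last direction and has a full range; the last one, of short range
    \<open>q ^ u\<close>, keeps its variable.\<close>
  define s where "s i = (if i = 0 then ?Q - x1 mod ?Q else 0)" for i :: nat
  have s: "[x1 + (\<Sum>i<k. s i) = 0] (mod ?Q)"
  proof -
    have "(\<Sum>i<k. s i) = ?Q - x1 mod ?Q" using k0 by (simp add: s_def sum.delta)
    moreover have "(x1 mod ?Q + (?Q - x1 mod ?Q)) mod ?Q = 0"
      using Q0 by (simp add: less_imp_le)
    ultimately show ?thesis by (simp add: nat_int_cong_def) (metis mod_add_left_eq)
  qed
  have ex: "\<exists>a. bij_betw a {..<H i} {..<H i} \<and> (\<forall>y. [\<kappa> i * a y = ?T * (y + s i)] (mod ?Q))"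
    if "i < k" for i
  proof (cases "i < k - 1")
    case True
    from full[OF True] obtain U where U: "coprime U q" "[\<kappa> i = ?T * U] (mod ?Q)" by blast
    obtain a where a: "bij_betw a {..<?Q} {..<?Q}" "\<And>y. [?T * U * a y = ?T * (y + s i)] (mod ?Q)"
      using affine_bij_mod[OF q2 U(1)] by blast
    have "[\<kappa> i * a y = ?T * (y + s i)] (mod ?Q)" for y
      by (rule cong_trans[OF _ a(2)]) (intro cong_mult U cong_refl)
    then show ?thesis using a(1) H(1)[OF True] by auto
  next
    case False
    then have "i = k - 1" "i \<noteq> 0" using that k2 by auto
    then show ?thesis using last by (intro exI[of _ id]) (auto simp: s_def intro!: cong_mult)
  qed
  then obtain a where a: "\<And>i. i < k \<Longrightarrow> bij_betw (a i) {..<H i} {..<H i}"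
    "\<And>i y. i < k \<Longrightarrow> [\<kappa> i * a i y = ?T * (y + s i)] (mod ?Q)"
    by metis
  \<comment> \<open>In the last direction the range \<open>q ^ u\<close> is used up by the low part,
    so the high part can only be 0.\<close>
  define zc where "zc i = (if i < k - 1 then q ^ (4 * u) else 1)" for i :: nat
  have Hz: "H i = q ^ u * zc i" if "i < k" for i
  proof (cases "i < k - 1")
    case False
    then have "i = k - 1" using that by simp
    then show ?thesis using H by (simp add: zc_def)
  qed (use H in \<open>simp add: zc_def flip: power_add\<close>)
  define f where "f i v z = (a i (fst v + q ^ u * fst z), a i (snd v + q ^ u * snd z))"
    for i and v z :: "nat \<times> nat"
  let ?V = "\<lambda>_::nat. {..<q ^ u} \<times> {..<q ^ u}" and ?Z = "\<lambda>i::nat. {..<zc i} \<times> {..<zc i}"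
  have bij: "bij_betw (\<lambda>(v, z). f i v z) (?V i \<times> ?Z i) ({..<H i} \<times> {..<H i})" if "i \<in> {..<k}" for i
  proof -
    have i: "i < k" using that by simp
    have qu0: "0 < q ^ u" using q2 by simp
    have "bij_betw ((\<lambda>p. (a i (fst p), a i (snd p))) \<circ>
        (\<lambda>(u', v). (fst u' + q ^ u * fst v, snd u' + q ^ u * snd v))) (?V i \<times> ?Z i) ({..<H i} \<times> {..<H i})"
      by (rule bij_betw_trans[OF bij_digits_pair[OF qu0] bij_betw_pair[OF a(1)[OF i], unfolded Hz[OF i]], folded Hz[OF i]])
    then show ?thesis by (simp add: f_def comp_def case_prod_unfold)
  qed
  \<comment> \<open>The summands \<open>+ 0\<close> are the initial carry vector, kept so that the
    terms match \<open>boxmean_def\<close>.\<close>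
  have pt: "ds q ((x + (\<Sum>i<k. \<kappa> i * mix S (\<lambda>i\<in>{..<k}. f i (v i) (z i)) i)) mod ?Q)
     = ds q ((ysum k S v + 0) mod q ^ u) + (ds q x0 + ds q (((ysum k S v + 0) div q ^ u + ysum k S z) mod ?T))"
    for S and v z :: "nat \<Rightarrow> nat \<times> nat"
  proof -
    let ?Y = "ysum k S v + q ^ u * ysum k S z"
    have "mix S (\<lambda>i\<in>{..<k}. f i (v i) (z i)) i = a i (mix S v i + q ^ u * mix S z i)" if "i < k" for i
      using that by (simp add: mix_def f_def)
    then have e1: "(\<Sum>i<k. \<kappa> i * mix S (\<lambda>i\<in>{..<k}. f i (v i) (z i)) i)
      = (\<Sum>i<k. \<kappa> i * a i (mix S v i + q ^ u * mix S z i))" by simp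
    have e2: "(\<Sum>i<k. ?T * (mix S v i + q ^ u * mix S z i + s i)) = ?T * (?Y + (\<Sum>i<k. s i))"
      by (simp only: ysum_def sum_distrib_left[symmetric] sum.distrib)
    have "[(\<Sum>i<k. \<kappa> i * a i (mix S v i + q ^ u * mix S z i))
        = (\<Sum>i<k. ?T * (mix S v i + q ^ u * mix S z i + s i))] (mod ?Q)"
      by (intro cong_sum a(2)) simp
    then have "[x + (\<Sum>i<k. \<kappa> i * mix S (\<lambda>i\<in>{..<k}. f i (v i) (z i)) i)
        = x + ?T * (?Y + (\<Sum>i<k. s i))] (mod ?Q)" unfolding e1 e2 by (intro cong_add cong_refl)
    moreover have "x + ?T * (?Y + (\<Sum>i<k. s i)) = x0 + ?T * (?Y + (x1 + (\<Sum>i<k. s i)))"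
      by (subst x_eq) (simp only: distrib_left add.assoc add.left_commute)
    moreover have "[x0 + ?T * (?Y + (x1 + (\<Sum>i<k. s i))) = x0 + ?T * (?Y + 0)] (mod ?Q)"
      by (intro cong_add cong_mult cong_refl s)
    ultimately have "[x + (\<Sum>i<k. \<kappa> i * mix S (\<lambda>i\<in>{..<k}. f i (v i) (z i)) i)
        = x0 + ?T * (?Y + 0)] (mod ?Q)" by (simp only:) (rule cong_trans)
    then have "(x + (\<Sum>i<k. \<kappa> i * mix S (\<lambda>i\<in>{..<k}. f i (v i) (z i)) i)) mod ?Q
        = (x0 + ?T * ?Y) mod ?Q" by (simp add: nat_int_cong_def)
    also have "\<dots> = ?T * ((x0 + ?T * ?Y) div ?T mod q ^ (3 * u)) + (x0 + ?T * ?Y) mod ?T"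
    proof -
      have "?Q = ?T * q ^ (3 * u)" by (simp flip: power_add)
      then show ?thesis by (simp only: mod_mult2_eq)
    qed
    also have "\<dots> = x0 + ?T * (?Y mod q ^ (3 * u))"
      using q2 by (simp add: x0_def)
    also have "ds q \<dots> = ds q x0 + ds q (?Y mod q ^ (3 * u))"
      by (rule ds_add) (use q2 in \<open>auto simp: x0_def\<close>)
    also have "?Y mod q ^ (3 * u) = q ^ u * ((?Y div q ^ u) mod ?T) + ?Y mod q ^ u"
    proof -
      have "q ^ (3 * u) = q ^ u * ?T" by (simp flip: power_add)
      then show ?thesis by (simp add: mod_mult2_eq)
    qed
    also have "\<dots> = ysum k S v mod q ^ u + q ^ u * ((ysum k S v div q ^ u + ysum k S z) mod ?T)"
      using q2 by (simp add: add.commute)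
    also have "ds q \<dots> = ds q (ysum k S v mod q ^ u) + ds q ((ysum k S v div q ^ u + ysum k S z) mod ?T)"
      by (rule ds_add) (use q2 in auto)
    finally show ?thesis unfolding add_0_right by (simp only: add.left_commute)
  qed
  define Tail where "Tail z e = cis (\<theta> * alt k (\<lambda>S. real (ds q x0 + ds q ((e S + ysum k S z) mod ?T))))"
    for z :: "nat \<Rightarrow> nat \<times> nat" and e :: "nat set \<Rightarrow> nat"
  define F where "F h = cis (\<theta> * alt k (\<lambda>S. real (ds q ((x + (\<Sum>i<k. \<kappa> i * mix S h i)) mod ?Q))))"
    for h :: "nat \<Rightarrow> nat \<times> nat"
  have F: "F (\<lambda>i\<in>{..<k}. f i (v i) (z i))
    = cis (\<theta> * alt k (\<lambda>S. real (ds q ((ysum k S v + 0) mod q ^ u)))) * Tail z (\<lambda>S. (ysum k S v + 0) div q ^ u)"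
    for v z
    unfolding F_def pt Tail_def cis_mult distrib_left[symmetric] alt_add[symmetric] of_nat_add ..
  have sp: "mean (PiE {..<k} (\<lambda>i. {..<H i} \<times> {..<H i})) F
    = mean (PiE {..<k} ?Z) (\<lambda>z. mean (PiE {..<k} ?V) (\<lambda>v. F (\<lambda>i\<in>{..<k}. f i (v i) (z i))))"
    by (rule mean_PiE_split) (rule bij)
  have "mean (PiE {..<k} (\<lambda>i. {..<H i} \<times> {..<H i})) F
    = mean (PiE {..<k} ?Z) (\<lambda>z. boxmean q \<theta> k (q ^ u) (\<lambda>_. 0) (Tail z))"
    unfolding sp boxmean_def F ..
  also have "norm \<dots> \<le> \<rho> ^ t"
  proof (rule norm_mean_bound)
    show "PiE {..<k} ?Z \<noteq> {}" using q2 by (auto simp: PiE_eq_empty_iff zc_def lessThan_empty_iff)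
    show "finite (PiE {..<k} ?Z)" by (intro finite_PiE) auto
    show "norm (boxmean q \<theta> k (q ^ u) (\<lambda>_. 0) (Tail z)) \<le> \<rho> ^ t" for z
      unfolding u by (rule boxmean_le) (simp_all add: Tail_def)
  qed
  finally show ?thesis unfolding F_def .
qed

end

section \<open>Averages over shifts, and changes of the phase at few terms\<close>

lemma norm_mean_shift_le:
  fixes F :: "nat \<Rightarrow> complex"
  assumes "\<And>n. norm (F n) \<le> 1"
  shows "norm (mean {..<N} F - mean {..<N} (\<lambda>n. F (n + s))) \<le> 2 * real s / real N"
proof -
  have sh: "(\<Sum>n<N. F (n + s)) = (\<Sum>n\<in>{s..<N + s}. F n)"
    using sum.shift_bounds_nat_ivl[of F 0 s N] by (simp add: atLeast0LessThan)
  have "(\<Sum>n<N. F n) + (\<Sum>n\<in>{N..<N + s}. F n) = (\<Sum>n<s. F n) + (\<Sum>n\<in>{s..<N + s}. F n)"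
    using sum.atLeastLessThan_concat[of 0 N "N + s" F] sum.atLeastLessThan_concat[of 0 s "N + s" F]
    by (simp add: atLeast0LessThan)
  then have "(\<Sum>n<N. F n) - (\<Sum>n<N. F (n + s)) = (\<Sum>n<s. F n) - (\<Sum>n\<in>{N..<N + s}. F n)"
    unfolding sh by (simp add: algebra_simps)
  also have "norm \<dots> \<le> real s + real s"
  proof (rule order_trans[OF norm_triangle_ineq4 add_mono])
    show "norm (\<Sum>n<s. F n) \<le> real s"
      using sum_norm_le[of "{..<s}" F "\<lambda>_. 1"] assms by simp
    show "norm (\<Sum>n\<in>{N..<N + s}. F n) \<le> real s"
      using sum_norm_le[of "{N..<N + s}" F "\<lambda>_. 1"] assms by simp
  qed
  finally show ?thesis
    by (simp add: mean_def norm_divide divide_right_mono flip: diff_divide_distrib)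
qed

text \<open>Shifting \<open>n\<close> by \<open>\<sigma> h\<close> costs the first term on the
  right. After averaging over \<open>h\<close>, \<open>box_inequality\<close> applies for each fixed
  \<open>n\<close>, and Jensen carries the power \<open>2 ^ k\<close> through the mean over
  \<open>n\<close>.\<close>

lemma van_der_Corput_box:
  fixes \<phi> :: "nat \<Rightarrow> real" and K H :: "nat \<Rightarrow> nat"
  assumes k: "0 < k" and H: "\<And>i. i < k \<Longrightarrow> 0 < H i" and N: "0 < N"
  shows "norm (mean {..<N} (\<lambda>n. cis (\<phi> n))) \<le> 2 * (\<Sum>i<k. real (K i) * real (H i)) / real N
    + root (2 ^ k) (norm (mean {..<N} (\<lambda>n. mean (PiE {..<k} (\<lambda>i. {..<H i} \<times> {..<H i}))
        (\<lambda>h. cis (alt k (\<lambda>S. \<phi> (n + (\<Sum>i<k. K i * mix S h i))))))))"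
proof -
  obtain k' where k': "k = Suc k'" using k by (cases k) auto
  let ?P = "PiE {..<k} (\<lambda>i. {..<H i})"
  let ?B = "\<lambda>n. mean (PiE {..<k} (\<lambda>i. {..<H i} \<times> {..<H i}))
        (\<lambda>h. cis (alt k (\<lambda>S. \<phi> (n + (\<Sum>i<k. K i * mix S h i)))))"
  define \<sigma> where "\<sigma> h = (\<Sum>i<k. K i * h i)" for h :: "nat \<Rightarrow> nat"
  define m where "m n = mean ?P (\<lambda>h. cis (\<phi> (n + \<sigma> h)))" for n
  have P: "finite ?P" "?P \<noteq> {}" using H by (auto intro!: finite_PiE simp: PiE_eq_empty_iff lessThan_empty_iff)
  have "mean {..<N} (\<lambda>n. cis (\<phi> n)) - mean {..<N} m
    = mean ?P (\<lambda>h. mean {..<N} (\<lambda>n. cis (\<phi> n)) - mean {..<N} (\<lambda>n. cis (\<phi> (n + \<sigma> h))))"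
    unfolding m_def by (subst mean_swap) (simp add: mean_diff mean_const[OF P])
  also have "norm \<dots> \<le> 2 * (\<Sum>i<k. real (K i) * real (H i)) / real N"
  proof (rule norm_mean_bound[OF P])
    fix h assume h: "h \<in> ?P"
    have "real (\<sigma> h) \<le> (\<Sum>i<k. real (K i) * real (H i))"
      unfolding \<sigma>_def of_nat_sum of_nat_mult
      by (intro sum_mono mult_left_mono) (use h in \<open>auto simp: PiE_def Pi_def less_imp_le\<close>)
    then have "2 * real (\<sigma> h) / real N \<le> 2 * (\<Sum>i<k. real (K i) * real (H i)) / real N"
      by (intro divide_right_mono) auto
    then show "norm (mean {..<N} (\<lambda>n. cis (\<phi> n)) - mean {..<N} (\<lambda>n. cis (\<phi> (n + \<sigma> h))))
        \<le> 2 * (\<Sum>i<k. real (K i) * real (H i)) / real N"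
      by (intro order_trans[OF norm_mean_shift_le[where F = "\<lambda>n. cis (\<phi> n)"]]) auto
  qed
  finally have 1: "norm (mean {..<N} (\<lambda>n. cis (\<phi> n)) - mean {..<N} m)
    \<le> 2 * (\<Sum>i<k. real (K i) * real (H i)) / real N" .
  have box: "norm (m n) ^ (2 ^ k) \<le> Re (?B n)" for n
  proof -
    have "\<phi> (n + (\<Sum>i<Suc k'. K i * g i)) = \<phi> (n + (\<Sum>i<Suc k'. K i * h i))"
      if "\<And>i. i < Suc k' \<Longrightarrow> g i = h i" for g h
      using that by simp
    from box_inequality[of k' "\<lambda>h. \<phi> (n + (\<Sum>i<Suc k'. K i * h i))", OF this]
    show ?thesis unfolding m_def k' \<sigma>_def .
  qed
  have "norm (mean {..<N} m) ^ (2 ^ k) \<le> (mean {..<N} (\<lambda>n. norm (m n))) ^ (2 ^ k)"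
    by (intro power_mono norm_mean_le) auto
  also have "\<dots> \<le> mean {..<N} (\<lambda>n. norm (m n) ^ (2 ^ k))"
    by (rule mean_power_le) auto
  also have "\<dots> \<le> mean {..<N} (\<lambda>n. Re (?B n))"
    by (intro mean_mono box)
  also have "\<dots> \<le> norm (mean {..<N} ?B)"
    by (simp only: Re_mean[symmetric] complex_Re_le_cmod)
  finally have "norm (mean {..<N} m) \<le> root (2 ^ k) (norm (mean {..<N} ?B))"
    using real_root_le_mono[of "2 ^ k" "norm (mean {..<N} m) ^ (2 ^ k)" "norm (mean {..<N} ?B)"]
    by (simp add: real_root_power_cancel)
  then show ?thesis
    using 1 norm_triangle_sub[of "mean {..<N} (\<lambda>n. cis (\<phi> n))" "mean {..<N} m"] by linarith
qed

lemma norm_mean_cis_diff_le: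
  fixes A A' :: "nat \<Rightarrow> 'h \<Rightarrow> real"
  assumes "finite P" "P \<noteq> {}" "0 < N"
    and "\<And>h. h \<in> P \<Longrightarrow> real (card {n\<in>{..<N}. A n h \<noteq> A' n h}) \<le> d"
  shows "norm (mean {..<N} (\<lambda>n. mean P (\<lambda>h. cis (A n h))))
    \<le> norm (mean {..<N} (\<lambda>n. mean P (\<lambda>h. cis (A' n h)))) + 2 * d / real N"
proof -
  have "mean {..<N} (\<lambda>n. mean P (\<lambda>h. cis (A n h))) - mean {..<N} (\<lambda>n. mean P (\<lambda>h. cis (A' n h)))
     = mean P (\<lambda>h. mean {..<N} (\<lambda>n. cis (A n h) - cis (A' n h)))"
    by (simp add: mean_diff mean_swap[of P])
  also have "norm \<dots> \<le> 2 * d / real N"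
  proof (rule norm_mean_bound[OF assms(1,2)])
    fix h assume h: "h \<in> P"
    let ?E = "{n\<in>{..<N}. A n h \<noteq> A' n h}"
    have "(\<Sum>n<N. cis (A n h) - cis (A' n h)) = (\<Sum>n\<in>?E. cis (A n h) - cis (A' n h))"
      by (rule sum.mono_neutral_right) auto
    also have "norm \<dots> \<le> (\<Sum>n\<in>?E. 2)"
      by (rule sum_norm_le) (rule order_trans[OF norm_triangle_ineq4], simp)
    also have "\<dots> \<le> 2 * d" using assms(4)[OF h] by simp
    finally show "norm (mean {..<N} (\<lambda>n. cis (A n h) - cis (A' n h))) \<le> 2 * d / real N"
      by (simp add: mean_def norm_divide divide_right_mono)
  qed
  finally show ?thesis
    using norm_triangle_sub[of "mean {..<N} (\<lambda>n. mean P (\<lambda>h. cis (A n h)))"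
        "mean {..<N} (\<lambda>n. mean P (\<lambda>h. cis (A' n h)))"] by linarith
qed

section \<open>Removing digits\<close>

text \<open>Meant for perturbation: adding or subtracting at most \<open>Z\<close> causes neither a
  carry nor a borrow beyond the digits modulo \<open>Q\<close>.\<close>

definition safe :: "nat \<Rightarrow> nat \<Rightarrow> nat \<Rightarrow> bool" where
  "safe Q Z y \<longleftrightarrow> Z \<le> y mod Q \<and> y mod Q + Z < Q"

text \<open>Modulo \<open>Q'\<close> the shift is \<open>s * h\<close>, of absolute value at most
  \<open>Z\<close>, and a safe \<open>y\<close> absorbs it below \<open>Q\<close>. Digits beyond
  \<open>Q'\<close> may change, so both sides are reduced first.\<close>

lemma div_shift_eq:
  fixes y \<kappa> h Q Q' Z :: nat and s :: int
  assumes cg: "[int \<kappa> = s] (mod int Q')" and dv: "Q dvd Q'" and Q': "0 < Q'"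
    and sh: "\<bar>s\<bar> * int h \<le> int Z" and sf: "safe Q Z y"
  shows "(y + \<kappa> * h) mod Q' div Q = y mod Q' div Q"
proof -
  have Q: "0 < Q" using dv Q' by (auto intro!: Nat.gr0I)
  obtain c where c: "Q' = Q * c" using dv by (rule dvdE)
  define d e where "d = y mod Q' div Q" and "e = y mod Q"
  have e: "y mod Q' mod Q = e" unfolding e_def using dv by (rule mod_mod_cancel)
  have y: "y mod Q' = Q * d + e" using mult_div_mod_eq[of Q "y mod Q'"] e by (simp add: d_def)
  have "d < c"
  proof -
    have "y mod Q' < c * Q" using Q' c by (metis mod_less_divisor mult.commute)
    then show ?thesis unfolding d_def by (rule less_mult_imp_div_less)
  qed
  then have "Q * (d + 1) \<le> Q'" unfolding c by (intro mult_le_mono2) simp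
  then have Qd: "int Q * int d + int Q \<le> int Q'" by (simp add: distrib_left flip: of_nat_mult of_nat_add)
  have sb: "- int Z \<le> s * int h" "s * int h \<le> int Z"
    using sh abs_le_iff[of "s * int h" "int Z"] by (auto simp: abs_mult)
  have ze: "int Z \<le> int e" "int e + int Z < int Q" using sf by (auto simp: safe_def e_def)
  define w where "w = int e + s * int h"
  have w: "0 \<le> w" "w < int Q" using sb ze by (auto simp: w_def)
  have "int ((y + \<kappa> * h) mod Q') = (int y + int \<kappa> * int h) mod int Q'" by (simp add: zmod_int)
  also have "\<dots> = (int y mod int Q' + s * int h) mod int Q'"
    using cong_mult[OF cg cong_refl[of "int h"]]
    by (simp add: nat_int_cong_def) (metis mod_add_left_eq mod_add_right_eq)
  also have "int y mod int Q' + s * int h = int Q * int d + w"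
    using y by (simp add: w_def flip: zmod_int)
  also have "(int Q * int d + w) mod int Q' = int Q * int d + w"
    using w Qd by (intro mod_pos_pos_trivial) auto
  finally have "int ((y + \<kappa> * h) mod Q') div int Q = int d"
    using w by (simp add: div_pos_pos_trivial)
  then have "int ((y + \<kappa> * h) mod Q' div Q) = int d" by (simp add: zdiv_int)
  then show ?thesis by (simp add: d_def)
qed

lemma ds_telescope:
  assumes "2 \<le> q" "\<And>j. j < k \<Longrightarrow> \<beta> (Suc j) \<le> \<beta> j"
  shows "ds q (Y mod q ^ \<beta> 0) = ds q (Y mod q ^ \<beta> k) + (\<Sum>j<k. ds q (Y mod q ^ \<beta> j div q ^ \<beta> (Suc j)))"
  using assms(2)
proof (induction k)
  case (Suc k)
  have "q ^ \<beta> (Suc k) dvd q ^ \<beta> k" using Suc.prems by (intro le_imp_power_dvd) simp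
  then have "Y mod q ^ \<beta> k mod q ^ \<beta> (Suc k) = Y mod q ^ \<beta> (Suc k)" by (rule mod_mod_cancel)
  then have "ds q (Y mod q ^ \<beta> k) = ds q (Y mod q ^ \<beta> (Suc k)) + ds q (Y mod q ^ \<beta> k div q ^ \<beta> (Suc k))"
    using ds_split[OF assms(1), of "Y mod q ^ \<beta> k" "\<beta> (Suc k)"] by simp
  then show ?case using Suc by simp
qed simp

text \<open>The digits are cut into layers, layer \<open>j\<close> between the positions
  \<open>\<beta> (Suc j)\<close> and \<open>\<beta> j\<close>. A step in direction \<open>j\<close>
  leaves layer \<open>j\<close> unchanged, so the alternating sum of that layer vanishes by
  \<open>alt_insert\<close>, whatever the other directions do to it. The strict inequalities in the
  hypotheses allow for empty layers.\<close>

lemma alt_truncate: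
  fixes \<kappa> :: "nat \<Rightarrow> nat" and s :: "nat \<Rightarrow> int" and h :: "nat \<Rightarrow> nat \<times> nat"
  assumes q: "2 \<le> q" and mono: "\<And>j. j < k \<Longrightarrow> \<beta> (Suc j) \<le> \<beta> j"
    and top: "\<And>S. x + (\<Sum>i<k. \<kappa> i * mix S h i) < q ^ \<beta> 0"
    and shift: "\<And>j. j < k \<Longrightarrow> \<beta> (Suc j) < \<beta> j \<Longrightarrow>
      [int (\<kappa> j) = s j] (mod int (q ^ \<beta> j)) \<and> \<bar>s j\<bar> * int (fst (h j)) \<le> int (Z j)
      \<and> \<bar>s j\<bar> * int (snd (h j)) \<le> int (Z j)"
    and safe: "\<And>j S. j < k \<Longrightarrow> \<beta> (Suc j) < \<beta> j \<Longrightarrow> S \<subseteq> {..<k} \<Longrightarrow>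
      safe (q ^ \<beta> (Suc j)) (Z j) (x + (\<Sum>i\<in>{..<k} - {j}. \<kappa> i * mix S h i))"
  shows "alt k (\<lambda>S. real (ds q (x + (\<Sum>i<k. \<kappa> i * mix S h i))))
    = alt k (\<lambda>S. real (ds q ((x + (\<Sum>i<k. \<kappa> i * mix S h i)) mod q ^ \<beta> k)))"
proof -
  define Y where "Y S = x + (\<Sum>i<k. \<kappa> i * mix S h i)" for S
  define D where "D j S = real (ds q (Y S mod q ^ \<beta> j div q ^ \<beta> (Suc j)))" for j S
  have D0: "alt k (D j) = 0" if j: "j < k" for j
  proof (cases "\<beta> (Suc j) < \<beta> j")
    case False
    then have "\<beta> (Suc j) = \<beta> j" using mono[OF j] by simp
    then have "D j = (\<lambda>_. 0)" using q by (auto simp: D_def)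
    then show ?thesis by (simp add: alt_def)
  next
    case True
    have "D j S = D j (insert j S)" if S: "S \<subseteq> {..<k} - {j}" for S
    proof -
      let ?y = "x + (\<Sum>i\<in>{..<k} - {j}. \<kappa> i * mix S h i)"
      have Y1: "Y S = ?y + \<kappa> j * fst (h j)"
        using j S unfolding Y_def by (subst sum.remove[of _ j]) (auto simp: mix_def)
      have eq: "(\<Sum>i\<in>{..<k} - {j}. \<kappa> i * mix (insert j S) h i) = (\<Sum>i\<in>{..<k} - {j}. \<kappa> i * mix S h i)"
        by (rule sum.cong) (auto simp: mix_def)
      have Y2: "Y (insert j S) = ?y + \<kappa> j * snd (h j)"
        using j unfolding Y_def eq[symmetric] by (subst sum.remove[of _ j]) (auto simp: mix_def)
      have sf: "safe (q ^ \<beta> (Suc j)) (Z j) ?y" using S by (intro safe j True) auto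
      have dv: "q ^ \<beta> (Suc j) dvd q ^ \<beta> j" using True by (intro le_imp_power_dvd) simp
      have pos: "0 < q ^ \<beta> j" using q by simp
      note sh = shift[OF j True]
      show ?thesis
        unfolding D_def Y1 Y2
        using div_shift_eq[OF _ dv pos _ sf, of "\<kappa> j" "s j" "fst (h j)"]
          div_shift_eq[OF _ dv pos _ sf, of "\<kappa> j" "s j" "snd (h j)"] sh by simp
    qed
    then show ?thesis unfolding alt_insert[OF j] by (intro sum.neutral) auto
  qed
  have "real (ds q (Y S)) = real (ds q (Y S mod q ^ \<beta> k)) + (\<Sum>j<k. D j S)" for S
  proof -
    have "Y S mod q ^ \<beta> 0 = Y S" using top by (simp add: Y_def)
    then show ?thesis using ds_telescope[where Y = "Y S" and \<beta> = \<beta>, OF q mono] by (simp add: D_def)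
  qed
  then have "alt k (\<lambda>S. real (ds q (Y S))) = alt k (\<lambda>S. real (ds q (Y S mod q ^ \<beta> k))) + (\<Sum>j<k. alt k (D j))"
    by (simp add: alt_add alt_sum)
  then show ?thesis using D0 by (simp add: Y_def)
qed

context contraction
begin

text \<open>For fixed \<open>h\<close>, truncation can fail at \<open>n\<close> only if some
  direction \<open>j\<close> and some \<open>S\<close> make the base point unsafe, whence
  \<open>k * 2 ^ k * d\<close>. The bound \<open>zone\<close> is uniform in \<open>r'\<close>
  because \<open>r'\<close> includes the shifts in the other directions.\<close>

lemma norm_mean_digits_le:
  fixes K H \<beta> Z :: "nat \<Rightarrow> nat" and s :: "nat \<Rightarrow> int" and E d :: real
  assumes k2: "2 \<le> k" and u: "u = l * t" and N: "0 < N"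
    and H: "\<And>i. i < k - 1 \<Longrightarrow> H i = q ^ (5 * u)" "H (k - 1) = q ^ u"
    and full: "\<And>i. i < k - 1 \<Longrightarrow> \<exists>U. coprime U q \<and> [K i * m = q ^ (2 * u) * U] (mod q ^ (5 * u))"
    and last: "[K (k - 1) * m = q ^ (2 * u)] (mod q ^ (5 * u))"
    and E: "\<And>i. i < k \<Longrightarrow> real (K i) * real (H i) \<le> E * real N"
    and mono: "\<And>j. j < k \<Longrightarrow> \<beta> (Suc j) \<le> \<beta> j" and bot: "\<beta> k = 5 * u"
    and top: "N * m + r + (\<Sum>i<k. K i * m * H i) < q ^ \<beta> 0"
    and shift: "\<And>j. j < k \<Longrightarrow> \<beta> (Suc j) < \<beta> j \<Longrightarrow>
      [int (K j * m) = s j] (mod int (q ^ \<beta> j)) \<and> \<bar>s j\<bar> * int (H j) \<le> int (Z j)"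
    and zone: "\<And>j r'. j < k \<Longrightarrow> \<beta> (Suc j) < \<beta> j \<Longrightarrow>
      real (card {n. n < N \<and> \<not> safe (q ^ \<beta> (Suc j)) (Z j) (n * m + r')}) \<le> d"
    and d: "0 \<le> d"
  shows "norm (mean {..<N} (\<lambda>n. cis (\<theta> * real (ds q (n * m + r)))))
    \<le> 2 * real k * E + root (2 ^ k) (\<rho> ^ t + 2 * (real k * 2 ^ k * d) / real N)"
proof -
  let ?P = "PiE {..<k} (\<lambda>i. {..<H i} \<times> {..<H i})"
  define \<phi> where "\<phi> n = \<theta> * real (ds q (n * m + r))" for n
  define A where "A n h = alt k (\<lambda>S. \<phi> (n + (\<Sum>i<k. K i * mix S h i)))" for n h
  define A' where "A' n h = \<theta> * alt k (\<lambda>S. real (ds q ((n * m + r + (\<Sum>i<k. K i * m * mix S h i)) mod q ^ (5 * u))))"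
    for n h
  have H0: "0 < H i" if "i < k" for i
  proof (cases "i < k - 1")
    case False
    then have "i = k - 1" using that by simp
    then show ?thesis using H q2 by simp
  qed (use H q2 in simp)
  have P: "finite ?P" "?P \<noteq> {}"
    using H0 by (auto intro!: finite_PiE simp: PiE_eq_empty_iff lessThan_empty_iff)
  have mixlt: "mix S h i < H i" if "h \<in> ?P" "i < k" for S h i
    using that by (auto simp: PiE_def Pi_def mix_def mem_Times_iff)
  have A_eq: "A n h = \<theta> * alt k (\<lambda>S. real (ds q (n * m + r + (\<Sum>i<k. K i * m * mix S h i))))" for n h
    unfolding A_def \<phi>_def alt_cmult
    by (intro arg_cong[where f = "\<lambda>x. \<theta> * x"] alt_cong) (simp add: algebra_simps sum_distrib_left)
  have cnt: "real (card {n\<in>{..<N}. A n h \<noteq> A' n h}) \<le> real k * 2 ^ k * d" if h: "h \<in> ?P" for h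
  proof -
    define J where "J = {j. j < k \<and> \<beta> (Suc j) < \<beta> j}"
    define bad where "bad j S = {n. n < N \<and> \<not> safe (q ^ \<beta> (Suc j)) (Z j)
        (n * m + (r + (\<Sum>i\<in>{..<k} - {j}. K i * m * mix S h i)))}" for j S
    have sub: "{n\<in>{..<N}. A n h \<noteq> A' n h} \<subseteq> (\<Union>(j, S)\<in>J \<times> Pow {..<k}. bad j S)"
    proof (rule subsetI, rule ccontr)
      fix n assume n: "n \<in> {n\<in>{..<N}. A n h \<noteq> A' n h}" "n \<notin> (\<Union>(j, S)\<in>J \<times> Pow {..<k}. bad j S)"
      then have nN: "n < N" by simp
      have sf: "safe (q ^ \<beta> (Suc j)) (Z j) (n * m + r + (\<Sum>i\<in>{..<k} - {j}. K i * m * mix S h i))"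
        if "j < k" "\<beta> (Suc j) < \<beta> j" "S \<subseteq> {..<k}" for j S
        using n nN that by (auto simp: bad_def J_def add.assoc)
      have tp: "n * m + r + (\<Sum>i<k. K i * m * mix S h i) < q ^ \<beta> 0" for S
      proof -
        have "(\<Sum>i<k. K i * m * mix S h i) \<le> (\<Sum>i<k. K i * m * H i)"
          using mixlt[OF h] by (intro sum_mono mult_le_mono2) (simp add: less_imp_le)
        moreover have "n * m \<le> N * m" using nN by simp
        ultimately show ?thesis using top by linarith
      qed
      have sh: "[int (K j * m) = s j] (mod int (q ^ \<beta> j)) \<and> \<bar>s j\<bar> * int (fst (h j)) \<le> int (Z j)
          \<and> \<bar>s j\<bar> * int (snd (h j)) \<le> int (Z j)" if j: "j < k" "\<beta> (Suc j) < \<beta> j" for j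
      proof -
        have "\<bar>s j\<bar> * int (mix S h j) \<le> int (Z j)" for S
          using mixlt[OF h j(1), of S] shift[OF j] mult_left_mono[of "int (mix S h j)" "int (H j)" "\<bar>s j\<bar>"]
          by simp
        from this[of "{}"] this[of "{j}"] show ?thesis using shift[OF j] by (simp add: mix_def)
      qed
      have "A n h = A' n h"
        unfolding A_eq A'_def bot[symmetric]
        using alt_truncate[where \<kappa> = "\<lambda>i. K i * m" and \<beta> = \<beta> and x = "n * m + r" and h = h and Z = Z and s = s,
            OF q2 mono tp sh sf] by simp
      with n show False by simp
    qed
    have fin: "finite (bad j S)" for j S by (simp add: bad_def)
    have J: "finite J" "card J \<le> k"
      using card_mono[of "{..<k}" J] by (auto simp: J_def intro: finite_subset[of _ "{..<k}"])
    have "card {n\<in>{..<N}. A n h \<noteq> A' n h} \<le> card (\<Union>(j, S)\<in>J \<times> Pow {..<k}. bad j S)"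
      by (rule card_mono[OF _ sub]) (use J fin in auto)
    also have "\<dots> \<le> (\<Sum>(j, S)\<in>J \<times> Pow {..<k}. card (bad j S))"
      using card_UN_le[of "J \<times> Pow {..<k}" "\<lambda>(j, S). bad j S"] J by (simp add: case_prod_unfold)
    finally have "real (card {n\<in>{..<N}. A n h \<noteq> A' n h}) \<le> (\<Sum>(j, S)\<in>J \<times> Pow {..<k}. real (card (bad j S)))"
      by (simp add: case_prod_unfold flip: of_nat_sum)
    also have "\<dots> \<le> (\<Sum>(j, S)\<in>J \<times> Pow {..<k}. d)"
      by (rule sum_mono) (use zone in \<open>auto simp: bad_def J_def\<close>)
    also have "\<dots> = real (card J) * 2 ^ k * d"
      by (simp add: card_cartesian_product card_Pow case_prod_unfold)
    also have "\<dots> \<le> real k * 2 ^ k * d"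
      using J d by (intro mult_right_mono) auto
    finally show ?thesis .
  qed
  have "norm (mean {..<N} (\<lambda>n. mean ?P (\<lambda>h. cis (A n h))))
     \<le> norm (mean {..<N} (\<lambda>n. mean ?P (\<lambda>h. cis (A' n h)))) + 2 * (real k * 2 ^ k * d) / real N"
    by (rule norm_mean_cis_diff_le[OF P N cnt])
  also have "norm (mean {..<N} (\<lambda>n. mean ?P (\<lambda>h. cis (A' n h)))) \<le> \<rho> ^ t"
  proof (rule norm_mean_bound)
    show "norm (mean ?P (\<lambda>h. cis (A' n h))) \<le> \<rho> ^ t" for n
      unfolding A'_def by (rule truncated_box_le[where H = H and \<kappa> = "\<lambda>i. K i * m", OF k2 u H full last])
  qed (use N in auto)
  finally have 1: "norm (mean {..<N} (\<lambda>n. mean ?P (\<lambda>h. cis (A n h)))) \<le> \<rho> ^ t + 2 * (real k * 2 ^ k * d) / real N"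
    by simp
  have "(\<Sum>i<k. real (K i) * real (H i)) \<le> real k * (E * real N)"
    using sum_mono[of "{..<k}" "\<lambda>i. real (K i) * real (H i)" "\<lambda>_. E * real N"] E by simp
  then have 2: "2 * (\<Sum>i<k. real (K i) * real (H i)) / real N \<le> 2 * real k * E"
    using N by (simp add: divide_le_eq mult.assoc)
  have "norm (mean {..<N} (\<lambda>n. cis (\<phi> n))) \<le> 2 * (\<Sum>i<k. real (K i) * real (H i)) / real N
    + root (2 ^ k) (norm (mean {..<N} (\<lambda>n. mean ?P (\<lambda>h. cis (A n h)))))"
    unfolding A_def by (rule van_der_Corput_box[OF k0 H0 N])
  also have "\<dots> \<le> 2 * real k * E + root (2 ^ k) (\<rho> ^ t + 2 * (real k * 2 ^ k * d) / real N)"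
    by (intro add_mono 2 real_root_le_mono 1) simp
  finally show ?thesis unfolding \<phi>_def .
qed

end

section \<open>Good moduli\<close>

text \<open>An unsafe number is within \<open>Z\<close> of a multiple of \<open>Q\<close>. Two such
  terms, \<open>t * d\<close> indices apart, would bring \<open>t * d * m\<close> closer than
  \<open>2 * Z\<close> to a multiple, so a residue class modulo \<open>d\<close> has at most one
  unsafe index in each window of \<open>T\<close> members. Taking \<open>d > 1\<close> serves moduli
  \<open>m\<close> that are small compared with \<open>Z\<close>.\<close>

lemma card_unsafe_le:
  fixes Q Z N T d m r :: nat
  assumes Q: "0 < Q" and d: "0 < d" and T: "0 < T"
    and sep: "\<And>t A. 1 \<le> t \<Longrightarrow> t < T \<Longrightarrow> 2 * int Z \<le> \<bar>int (t * d * m) - A * int Q\<bar>"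
  shows "real (card {n. n < N \<and> \<not> safe Q Z (n * m + r)}) \<le> real N / real T + real d"
proof -
  let ?E = "{n. n < N \<and> \<not> safe Q Z (n * m + r)}"
  let ?f = "\<lambda>n. (n mod d, n div d div T)"
  have near: "\<exists>v A. int (n * m + r) = v + A * int Q \<and> - int Z \<le> v \<and> v < int Z"
    if "\<not> safe Q Z (n * m + r)" for n
  proof -
    let ?y = "n * m + r"
    have y: "int ?y = int (?y mod Q) + int (?y div Q) * int Q"
      by (simp add: zmod_int zdiv_int)
    show ?thesis
    proof (cases "?y mod Q < Z")
      case True
      then show ?thesis using y by (intro exI[of _ "int (?y mod Q)"] exI[of _ "int (?y div Q)"]) linarith
    next
      case False
      then have "Q \<le> ?y mod Q + Z" using that by (simp add: safe_def)
      moreover have "?y mod Q < Q" using Q by simp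
      ultimately show ?thesis using y
        by (intro exI[of _ "int (?y mod Q) - int Q"] exI[of _ "int (?y div Q) + 1"]) (simp add: algebra_simps)
    qed
  qed
  have inj: "inj_on ?f ?E"
  proof (rule inj_onI, rule ccontr)
    fix x y assume xy: "x \<in> ?E" "y \<in> ?E" "?f x = ?f y" "x \<noteq> y"
    have "\<exists>a b. a < b \<and> a \<in> ?E \<and> b \<in> ?E \<and> ?f a = ?f b"
    proof (cases "x < y")
      case True
      with xy show ?thesis by blast
    next
      case False
      with xy have "y < x" "?f y = ?f x" by simp_all
      with xy show ?thesis by blast
    qed
    then obtain a b where ab: "a < b" "a \<in> ?E" "b \<in> ?E" "a mod d = b mod d" "a div d div T = b div d div T"
      by auto
    define t where "t = b div d - a div d"
    have le: "a div d \<le> b div d" using ab by (simp add: div_le_mono)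
    have bd: "b = (a div d + t) * d + a mod d"
      using le ab(4) by (simp add: t_def)
    have ba: "b = a + t * d"
      using bd div_mult_mod_eq[of a d] by (simp add: add_mult_distrib)
    then have t1: "1 \<le> t" using ab(1) by (cases t) auto
    have "b div d < b div d div T * T + T" using T
      by (metis div_mult_mod_eq add_less_cancel_left mod_less_divisor)
    moreover have "b div d div T * T \<le> a div d" unfolding ab(5)[symmetric] by simp
    ultimately have t2: "t < T" unfolding t_def using T by linarith
    from near[of a] near[of b] ab obtain v A v' A' where
      v: "int (a * m + r) = v + A * int Q" "- int Z \<le> v" "v < int Z"
      "int (b * m + r) = v' + A' * int Q" "- int Z \<le> v'" "v' < int Z" by auto
    have "int (t * d * m) = int (b * m + r) - int (a * m + r)"
      by (simp add: ba algebra_simps)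
    then have "int (t * d * m) - (A' - A) * int Q = v' - v" using v by (simp add: algebra_simps)
    then show False using sep[OF t1 t2, of "A' - A"] v by linarith
  qed
  have "?f ` ?E \<subseteq> {..<d} \<times> {..N div d div T}"
    using d by (auto intro!: div_le_mono)
  then have "card ?E \<le> card ({..<d} \<times> {..N div d div T})"
    by (rule card_inj_on_le[OF inj]) auto
  also have "\<dots> = N div d div T * d + d" by (simp add: card_cartesian_product)
  finally have 1: "real (card ?E) \<le> real (N div d div T * d) + real d" by linarith
  have "N div d div T * d * T \<le> N"
    by (metis div_mult2_eq div_times_less_eq_dividend mult.assoc)
  then have "real (N div d div T * d) * real T \<le> real N" by (simp only: of_nat_mult[symmetric] of_nat_le_iff)
  then have "real (N div d div T * d) \<le> real N / real T" using T by (simp add: field_simps)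
  with 1 show ?thesis by linarith
qed

lemma card_near_multiple:
  fixes t Z :: nat and c :: int
  assumes "0 < t"
  shows "finite {m::nat. \<bar>int (t * m) - c\<bar> \<le> int Z}"
    and "real (card {m::nat. \<bar>int (t * m) - c\<bar> \<le> int Z}) \<le> 2 * real Z / real t + 1"
proof -
  let ?S = "{m::nat. \<bar>int (t * m) - c\<bar> \<le> int Z}"
  let ?lo = "\<lceil>(of_int c - real Z) / real t\<rceil>" and ?hi = "\<lfloor>(of_int c + real Z) / real t\<rfloor>"
  have sub: "int ` ?S \<subseteq> {?lo..?hi}"
  proof
    fix x assume "x \<in> int ` ?S"
    then obtain m where m: "x = int m" "\<bar>int (t * m) - c\<bar> \<le> int Z" by auto
    then have "real_of_int \<bar>int (t * m) - c\<bar> \<le> real_of_int (int Z)" by (simp only: of_int_le_iff)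
    then have "\<bar>real t * real m - of_int c\<bar> \<le> real Z" by simp
    then have "(of_int c - real Z) / real t \<le> real m" "real m \<le> (of_int c + real Z) / real t"
      using assms by (auto simp: field_simps abs_le_iff)
    then show "x \<in> {?lo..?hi}" using m by (simp add: ceiling_le_iff le_floor_iff)
  qed
  then have "finite (int ` ?S)" by (rule finite_subset) simp
  then show fin: "finite ?S" by (rule finite_imageD) simp
  have "card ?S = card (int ` ?S)" by (simp add: card_image)
  also have "\<dots> \<le> nat (?hi + 1 - ?lo)" using card_mono[OF _ sub] by simp
  finally have "real (card ?S) \<le> real (nat (?hi + 1 - ?lo))" by simp
  also have "\<dots> \<le> 2 * real Z / real t + 1"
  proof (cases "0 \<le> ?hi + 1 - ?lo")
    case True
    have "of_int ?hi - of_int ?lo \<le> (of_int c + real Z) / real t - (of_int c - real Z) / real t"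
      by (intro diff_mono) simp_all
    also have "\<dots> = 2 * real Z / real t" by (simp flip: diff_divide_distrib)
    finally show ?thesis using True by simp
  qed simp
  finally show "real (card ?S) \<le> 2 * real Z / real t + 1" .
qed

text \<open>\<open>Z < M0\<close> rules out the multiple 0, which makes a bound without additive
  constant possible: at most \<open>2 * t * M1 / Q\<close> positive multiples are in reach, each
  near at most \<open>2 * Z / t + 1\<close> products \<open>t * m\<close>.\<close>

lemma card_near_multiples:
  fixes t Z Q M0 M1 :: nat
  assumes t: "0 < t" and Q: "0 < Q" and Z: "Z < M0" "2 * Z \<le> Q"
  shows "real (card {m\<in>{M0..<M1}. \<exists>A::int. \<bar>int (t * m) - A * int Q\<bar> \<le> int Z})
    \<le> 4 * real Z * real M1 / real Q + 2 * real t * real M1 / real Q"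
proof -
  let ?S = "{m\<in>{M0..<M1}. \<exists>A::int. \<bar>int (t * m) - A * int Q\<bar> \<le> int Z}"
  let ?a = "(t * M1 + Z) div Q"
  let ?I = "\<lambda>A. {m::nat. \<bar>int (t * m) - int A * int Q\<bar> \<le> int Z}"
  have sub: "?S \<subseteq> (\<Union>A\<in>{1..?a}. ?I A)"
  proof
    fix m assume "m \<in> ?S"
    then obtain A :: int where m: "M0 \<le> m" "m < M1" and A: "\<bar>int (t * m) - A * int Q\<bar> \<le> int Z" by auto
    have "m \<le> t * m" using t by simp
    then have "int Z < int (t * m)" using m Z by linarith
    then have "0 < A * int Q" using A by linarith
    then have A0: "0 < A" using Q by (simp add: zero_less_mult_iff)
    have "int (nat A * Q) \<le> int (t * M1 + Z)"
    proof -
      have "t * m \<le> t * M1" using m by simp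
      then have "int (t * m) \<le> int (t * M1)" by (simp only: of_nat_le_iff)
      then show ?thesis using A A0 by simp
    qed
    then have "nat A \<le> ?a" using Q by (simp only: of_nat_le_iff less_eq_div_iff_mult_less_eq)
    then show "m \<in> (\<Union>A\<in>{1..?a}. ?I A)" using A A0 by (intro UN_I[of "nat A"]) auto
  qed
  have a: "real ?a \<le> 2 * real t * real M1 / real Q"
  proof (cases "?a = 0")
    case False
    then have "Q \<le> t * M1 + Z" by (metis div_less not_le)
    then have "Z \<le> t * M1" using Z by linarith
    then have "?a * Q \<le> 2 * (t * M1)" by (metis add_left_mono div_times_less_eq_dividend le_trans mult_2)
    then have "real (?a * Q) \<le> real (2 * (t * M1))" by (simp only: of_nat_le_iff)
    then show ?thesis using Q by (simp add: pos_le_divide_eq mult.assoc)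
  qed simp
  have "card ?S \<le> card (\<Union>A\<in>{1..?a}. ?I A)"
    by (rule card_mono[OF _ sub]) (use card_near_multiple(1)[OF t] in auto)
  also have "\<dots> \<le> (\<Sum>A\<in>{1..?a}. card (?I A))" by (rule card_UN_le) simp
  finally have "real (card ?S) \<le> (\<Sum>A\<in>{1..?a}. real (card (?I A)))"
    by (simp only: of_nat_sum[symmetric] of_nat_le_iff)
  also have "\<dots> \<le> (\<Sum>A\<in>{1..?a}. 2 * real Z / real t + 1)"
    by (intro sum_mono card_near_multiple(2) t)
  also have "\<dots> = real ?a * (2 * real Z / real t + 1)" by simp
  also have "\<dots> \<le> 2 * real t * real M1 / real Q * (2 * real Z / real t + 1)"
    by (intro mult_right_mono a) auto
  also have "\<dots> = 4 * real Z * real M1 / real Q + 2 * real t * real M1 / real Q"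
    using t Q by (simp add: field_simps)
  finally show ?thesis .
qed

text \<open>The first two conditions bound the powers of primes \<open>p dvd q\<close> dividing the shifts \<open>K * m\<close> of the
  van der Corput steps, so that these shifts cover residues modulo powers of \<open>q\<close> evenly. The third
  keeps \<open>n * m + r\<close> away from carries for most \<open>n\<close>.\<close>

definition good :: "nat \<Rightarrow> nat \<Rightarrow> nat \<Rightarrow> nat \<Rightarrow> nat \<Rightarrow> bool" where
  "good q u w \<mu> m \<longleftrightarrow>
    (\<forall>p. prime p \<and> p dvd q \<longrightarrow> \<not> p ^ (u + 1) dvd m) \<and>
    (\<forall>\<alpha>\<in>{2 * w..\<mu> + 1 + 9 * u}. \<forall>p. prime p \<and> p dvd q \<longrightarrow>
      (\<forall>K\<in>{1..q ^ w}. p ^ (u + 1) dvd K \<longrightarrow>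
        (\<nexists>A::int. \<bar>int (K * m) - A * int (q ^ \<alpha>)\<bar> \<le> int (q ^ (\<alpha> - w))))) \<and>
    (\<forall>\<alpha>\<in>{5 * u..\<mu>}. \<forall>t\<in>{1..<q ^ u}.
        (\<nexists>A::int. \<bar>int (t * m) - A * int (q ^ \<alpha>)\<bar> \<le> int (2 * q ^ (\<alpha> - 2 * u))))"

lemma card_multiples_le:
  fixes P M :: nat
  assumes "0 < P"
  shows "real (card {x\<in>{1..M}. P dvd x}) \<le> real M / real P"
proof -
  have "{x\<in>{1..M}. P dvd x} \<subseteq> (\<lambda>y. P * y) ` {1..M div P}"
    using assms by (auto elim!: dvdE simp: less_eq_div_iff_mult_less_eq mult.commute)
  then have "card {x\<in>{1..M}. P dvd x} \<le> card {1..M div P}"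
    by (rule surj_card_le[rotated]) simp
  then have "real (card {x\<in>{1..M}. P dvd x}) \<le> real (M div P)" by simp
  also have "\<dots> \<le> real M / real P"
  proof -
    have "real (M div P * P) \<le> real M" by (simp only: of_nat_le_iff div_times_less_eq_dividend)
    then show ?thesis using assms by (simp add: pos_le_divide_eq)
  qed
  finally show ?thesis .
qed

lemma card_UN_le_real:
  assumes "finite I" "\<And>i. i \<in> I \<Longrightarrow> real (card (A i)) \<le> c"
  shows "real (card (\<Union>i\<in>I. A i)) \<le> real (card I) * c"
proof -
  have "real (card (\<Union>i\<in>I. A i)) \<le> (\<Sum>i\<in>I. real (card (A i)))"
    using card_UN_le[OF assms(1), of A] by (simp only: of_nat_sum[symmetric] of_nat_le_iff)
  also have "\<dots> \<le> (\<Sum>i\<in>I. c)" by (intro sum_mono assms(2))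
  finally show ?thesis by simp
qed

text \<open>A union bound, with \<open>2 \<le> p\<close> for every prime. In the second condition at
  most \<open>q ^ w / p ^ (u + 1)\<close> values of \<open>K\<close> meet a proportion
  \<open>6 / q ^ w\<close> of \<open>M\<close>; in the third, fewer than \<open>q ^ u\<close> values
  of \<open>t\<close> meet a proportion \<open>10 / q ^ (2 * u)\<close>. The factor
  \<open>\<mu> + 9 * u + 2\<close> bounds the number of positions \<open>\<alpha>\<close>.\<close>

lemma card_not_good_le:
  assumes q: "2 \<le> q" and u: "1 \<le> u" and w: "20 * u \<le> w"
  shows "real (card {m\<in>{q ^ \<mu>..<q ^ (\<mu> + 1)}. \<not> good q u w \<mu> m})
    \<le> 10 * (real q)\<^sup>2 * real (\<mu> + 9 * u + 2) * real q ^ \<mu> / 2 ^ u"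
proof -
  define M where "M = q ^ (\<mu> + 1)"
  let ?I = "{q ^ \<mu>..<M}" and ?P = "{p. prime p \<and> p dvd q}"
  define X where "X = real (\<mu> + 9 * u + 2)"
  have X1: "1 \<le> X" by (simp add: X_def)
  have q1: "1 \<le> real q" using q by simp
  have Psub: "?P \<subseteq> {1..q}" using q by (auto simp: dvd_imp_le prime_gt_0_nat Suc_leI)
  then have P: "finite ?P" "real (card ?P) \<le> real q"
    using finite_subset card_mono[OF _ Psub] by auto
  have p2: "2 ^ (u + 1) \<le> real (p ^ (u + 1))" if "p \<in> ?P" for p
    using prime_ge_2_nat[of p] that by (simp only: of_nat_power) (intro power_mono, auto)
  define A1 where "A1 p = {m\<in>?I. p ^ (u + 1) dvd m}" for p
  define A2 where "A2 \<alpha> p K = {m\<in>?I. \<exists>A::int. \<bar>int (K * m) - A * int (q ^ \<alpha>)\<bar> \<le> int (q ^ (\<alpha> - w))}"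
    for \<alpha> p K :: nat
  define A3 where "A3 \<alpha> t = {m\<in>?I. \<exists>A::int. \<bar>int (t * m) - A * int (q ^ \<alpha>)\<bar> \<le> int (2 * q ^ (\<alpha> - 2 * u))}"
    for \<alpha> t :: nat
  let ?KK = "\<lambda>p. {K\<in>{1..q ^ w}. p ^ (u + 1) dvd K}"
  have c1: "real (card (\<Union>p\<in>?P. A1 p)) \<le> real q * (real M / 2 ^ (u + 1))"
  proof -
    have "real (card (A1 p)) \<le> real M / 2 ^ (u + 1)" if p: "p \<in> ?P" for p
    proof -
      have p0: "0 < p ^ (u + 1)" using p by (simp add: prime_gt_0_nat)
      have "A1 p \<subseteq> {x\<in>{1..M}. p ^ (u + 1) dvd x}" using q by (auto simp: A1_def Suc_leI intro: order_trans[of _ "q ^ \<mu>"])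
      then have "real (card (A1 p)) \<le> real (card {x\<in>{1..M}. p ^ (u + 1) dvd x})"
        by (simp only: of_nat_le_iff) (rule card_mono, auto)
      also have "\<dots> \<le> real M / real (p ^ (u + 1))" by (rule card_multiples_le[OF p0])
      also have "\<dots> \<le> real M / 2 ^ (u + 1)" by (intro divide_left_mono mult_pos_pos) (use p2[OF p] p0 in \<open>auto simp del: power_Suc of_nat_power\<close>)
      finally show ?thesis .
    qed
    then have "real (card (\<Union>p\<in>?P. A1 p)) \<le> real (card ?P) * (real M / 2 ^ (u + 1))"
      by (rule card_UN_le_real[OF P(1)])
    also have "\<dots> \<le> real q * (real M / 2 ^ (u + 1))" using P by (intro mult_right_mono) auto
    finally show ?thesis .
  qed
  have c2: "real (card (\<Union>p\<in>?P. \<Union>K\<in>?KK p. A2 \<alpha> p K)) \<le> real q * (6 * real M / 2 ^ (u + 1))"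
    if \<alpha>: "\<alpha> \<in> {2 * w..\<mu> + 1 + 9 * u}" for \<alpha>
  proof -
    have "real (card (\<Union>K\<in>?KK p. A2 \<alpha> p K)) \<le> 6 * real M / 2 ^ (u + 1)" if p: "p \<in> ?P" for p
    proof -
      have p0: "0 < p ^ (u + 1)" using p by (simp add: prime_gt_0_nat)
      have "real (card (A2 \<alpha> p K)) \<le> 6 * real M / real q ^ w" if K: "K \<in> ?KK p" for K
      proof -
        \<comment> \<open>\<open>\<alpha>\<close> may exceed \<open>\<mu>\<close> by
          \<open>1 + 9 * u\<close>, but \<open>20 * u \<le> w\<close> brings
          \<open>\<alpha> - w\<close> below \<open>\<mu>\<close>.\<close>
        have z1: "q ^ (\<alpha> - w) < q ^ \<mu>" using \<alpha> u w q by (intro power_strict_increasing) auto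
        have z2: "2 * q ^ (\<alpha> - w) \<le> q ^ \<alpha>"
        proof -
          have "2 * q ^ (\<alpha> - w) \<le> q * q ^ (\<alpha> - w)" using q by (rule mult_le_mono1)
          also have "\<dots> = q ^ (Suc (\<alpha> - w))" by simp
          also have "\<dots> \<le> q ^ \<alpha>" using \<alpha> u w q by (intro power_increasing) auto
          finally show ?thesis .
        qed
        have "real (card (A2 \<alpha> p K)) \<le> 4 * real (q ^ (\<alpha> - w)) * real M / real (q ^ \<alpha>) + 2 * real K * real M / real (q ^ \<alpha>)"
          unfolding A2_def by (rule card_near_multiples) (use K q z1 z2 in auto)
        also have "real (q ^ \<alpha>) = real q ^ w * real q ^ (\<alpha> - w)" using \<alpha> by (simp flip: power_add)
        also have "4 * real (q ^ (\<alpha> - w)) * real M / (real q ^ w * real q ^ (\<alpha> - w)) = 4 * real M / real q ^ w"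
          using q by simp
        also have "2 * real K * real M / (real q ^ w * real q ^ (\<alpha> - w)) \<le> 2 * real M / real q ^ w"
        proof -
          have "real K \<le> real (q ^ w)" using K by (simp only: of_nat_le_iff) simp
          also have "\<dots> = real q ^ w" by simp
          also have "real q ^ w \<le> real q ^ (\<alpha> - w)" using \<alpha> q1 by (intro power_increasing) auto
          finally have "real K * (2 * real M) \<le> real q ^ (\<alpha> - w) * (2 * real M)" by (rule mult_right_mono) simp
          then show ?thesis using q by (simp add: field_simps)
        qed
        finally show ?thesis by simp
      qed
      then have "real (card (\<Union>K\<in>?KK p. A2 \<alpha> p K)) \<le> real (card (?KK p)) * (6 * real M / real q ^ w)"
        by (intro card_UN_le_real) auto
      also have "\<dots> \<le> (real (q ^ w) / real (p ^ (u + 1))) * (6 * real M / real q ^ w)"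
        by (intro mult_right_mono card_multiples_le p0) auto
      also have "\<dots> = 6 * real M / real (p ^ (u + 1))" using q by simp
      also have "\<dots> \<le> 6 * real M / 2 ^ (u + 1)" by (intro divide_left_mono mult_pos_pos) (use p2[OF p] p0 in \<open>auto simp del: power_Suc of_nat_power\<close>)
      finally show ?thesis .
    qed
    then have "real (card (\<Union>p\<in>?P. \<Union>K\<in>?KK p. A2 \<alpha> p K)) \<le> real (card ?P) * (6 * real M / 2 ^ (u + 1))"
      by (rule card_UN_le_real[OF P(1)])
    also have "\<dots> \<le> real q * (6 * real M / 2 ^ (u + 1))" using P by (intro mult_right_mono) auto
    finally show ?thesis .
  qed
  have c3: "real (card (\<Union>t\<in>{1..<q ^ u}. A3 \<alpha> t)) \<le> 10 * real M / 2 ^ u"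
    if \<alpha>: "\<alpha> \<in> {5 * u..\<mu>}" for \<alpha>
  proof -
    have "real (card (A3 \<alpha> t)) \<le> 10 * real M / real q ^ (2 * u)" if t: "t \<in> {1..<q ^ u}" for t
    proof -
      have q4: "4 \<le> q ^ (2 * u)"
      proof -
        have "2 ^ 2 \<le> q ^ 2" using q by (rule power_mono) simp
        also have "\<dots> \<le> q ^ (2 * u)" using u q by (intro power_increasing) auto
        finally show ?thesis by simp
      qed
      have qa: "q ^ \<alpha> = q ^ (2 * u) * q ^ (\<alpha> - 2 * u)" using \<alpha> by (simp flip: power_add)
      have "4 * q ^ (\<alpha> - 2 * u) \<le> q ^ \<alpha>" unfolding qa by (rule mult_le_mono1[OF q4])
      moreover have "q ^ \<alpha> \<le> q ^ \<mu>" using \<alpha> q by (intro power_increasing) auto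
      moreover have "0 < q ^ (\<alpha> - 2 * u)" using q by simp
      ultimately have z: "2 * q ^ (\<alpha> - 2 * u) < q ^ \<mu>" "2 * (2 * q ^ (\<alpha> - 2 * u)) \<le> q ^ \<alpha>" by linarith+
      have "real (card (A3 \<alpha> t)) \<le> 4 * real (2 * q ^ (\<alpha> - 2 * u)) * real M / real (q ^ \<alpha>) + 2 * real t * real M / real (q ^ \<alpha>)"
        unfolding A3_def by (rule card_near_multiples) (use t q z in auto)
      also have "real (q ^ \<alpha>) = real q ^ (2 * u) * real q ^ (\<alpha> - 2 * u)" using \<alpha> by (simp flip: power_add)
      also have "4 * real (2 * q ^ (\<alpha> - 2 * u)) * real M / (real q ^ (2 * u) * real q ^ (\<alpha> - 2 * u)) = 8 * real M / real q ^ (2 * u)"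
        using q by simp
      also have "2 * real t * real M / (real q ^ (2 * u) * real q ^ (\<alpha> - 2 * u)) \<le> 2 * real M / real q ^ (2 * u)"
      proof -
        have "real t \<le> real (q ^ u)" using t by (simp only: of_nat_le_iff) simp
        also have "\<dots> = real q ^ u" by simp
        also have "real q ^ u \<le> real q ^ (\<alpha> - 2 * u)" using \<alpha> q1 by (intro power_increasing) auto
        finally have "real t * (2 * real M) \<le> real q ^ (\<alpha> - 2 * u) * (2 * real M)" by (rule mult_right_mono) simp
        then show ?thesis using q by (simp add: field_simps)
      qed
      finally show ?thesis by simp
    qed
    then have "real (card (\<Union>t\<in>{1..<q ^ u}. A3 \<alpha> t)) \<le> real (card {1..<q ^ u}) * (10 * real M / real q ^ (2 * u))"
      by (intro card_UN_le_real) auto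
    also have "\<dots> \<le> real q ^ u * (10 * real M / real q ^ (2 * u))"
      by (intro mult_right_mono) (auto simp flip: of_nat_power)
    also have "\<dots> = 10 * real M / real q ^ u"
      using q by (simp add: mult_2 power_add)
    also have "\<dots> \<le> 10 * real M / 2 ^ u" using q by (intro divide_left_mono power_mono) auto
    finally show ?thesis .
  qed
  let ?U1 = "\<Union>p\<in>?P. A1 p"
  let ?U2 = "\<Union>\<alpha>\<in>{2 * w..\<mu> + 1 + 9 * u}. \<Union>p\<in>?P. \<Union>K\<in>?KK p. A2 \<alpha> p K"
  let ?U3 = "\<Union>\<alpha>\<in>{5 * u..\<mu>}. \<Union>t\<in>{1..<q ^ u}. A3 \<alpha> t"
  have "{m\<in>?I. \<not> good q u w \<mu> m} \<subseteq> ?U1 \<union> ?U2 \<union> ?U3"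
  proof
    fix m assume "m \<in> {m\<in>?I. \<not> good q u w \<mu> m}"
    then have m: "m \<in> ?I" "\<not> good q u w \<mu> m" by auto
    from m(2) consider p where "p \<in> ?P" "p ^ (u + 1) dvd m"
      | \<alpha> p K A where "\<alpha> \<in> {2 * w..\<mu> + 1 + 9 * u}" "p \<in> ?P" "K \<in> ?KK p"
          "\<bar>int (K * m) - A * int (q ^ \<alpha>)\<bar> \<le> int (q ^ (\<alpha> - w))"
      | \<alpha> t A where "\<alpha> \<in> {5 * u..\<mu>}" "t \<in> {1..<q ^ u}"
          "\<bar>int (t * m) - A * int (q ^ \<alpha>)\<bar> \<le> int (2 * q ^ (\<alpha> - 2 * u))"
      unfolding good_def by blast
    then show "m \<in> ?U1 \<union> ?U2 \<union> ?U3"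
    proof cases
      case 1
      then have "m \<in> A1 p" using m unfolding A1_def by blast
      then show ?thesis using 1 by blast
    next
      case 2
      then have "m \<in> A2 \<alpha> p K" using m unfolding A2_def by blast
      then show ?thesis using 2 by blast
    next
      case 3
      then have "m \<in> A3 \<alpha> t" using m unfolding A3_def by blast
      then show ?thesis using 3 by blast
    qed
  qed
  moreover have "finite (?U1 \<union> ?U2 \<union> ?U3)"
    by (rule finite_subset[of _ ?I]) (auto simp: A1_def A2_def A3_def)
  ultimately have "card {m\<in>?I. \<not> good q u w \<mu> m} \<le> card (?U1 \<union> ?U2 \<union> ?U3)"
    by (intro card_mono) assumption+
  also have "\<dots> \<le> card ?U1 + card ?U2 + card ?U3"
    using card_Un_le[of "?U1 \<union> ?U2" ?U3] card_Un_le[of ?U1 ?U2] by linarith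
  finally have "real (card {m\<in>?I. \<not> good q u w \<mu> m}) \<le> real (card ?U1) + real (card ?U2) + real (card ?U3)"
    by linarith
  also have "\<dots> \<le> real q * (real M / 2 ^ (u + 1)) + X * (real q * (6 * real M / 2 ^ (u + 1))) + X * (10 * real M / 2 ^ u)"
  proof (intro add_mono c1)
    have "real (card ?U2) \<le> real (card {2 * w..\<mu> + 1 + 9 * u}) * (real q * (6 * real M / 2 ^ (u + 1)))"
      by (intro card_UN_le_real c2) auto
    also have "\<dots> \<le> X * (real q * (6 * real M / 2 ^ (u + 1)))"
      by (intro mult_right_mono) (auto simp: X_def)
    finally show "real (card ?U2) \<le> X * (real q * (6 * real M / 2 ^ (u + 1)))" .
    have "real (card ?U3) \<le> real (card {5 * u..\<mu>}) * (10 * real M / 2 ^ u)"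
      by (intro card_UN_le_real c3) auto
    also have "\<dots> \<le> X * (10 * real M / 2 ^ u)"
      by (intro mult_right_mono) (auto simp: X_def)
    finally show "real (card ?U3) \<le> X * (10 * real M / 2 ^ u)" .
  qed
  also have "\<dots> = (real q / 2 + 3 * real q * X + 10 * X) * (real M / 2 ^ u)"
  proof -
    have "a * (b / (2 * c)) + x * (a * (6 * b / (2 * c))) + x * (10 * b / c) = (a / 2 + 3 * a * x + 10 * x) * (b / c)"
      if "c \<noteq> 0" for a b c x :: real
      using that by (simp add: field_simps)
    from this[of "2 ^ u" "real q" "real M" X] show ?thesis by (simp only: power_Suc Suc_eq_plus1[symmetric]) simp
  qed
  also have "\<dots> \<le> (10 * real q * X) * (real M / 2 ^ u)"
  proof (rule mult_right_mono)
    have "1 * real q \<le> X * real q" using X1 by (intro mult_right_mono) auto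
    moreover have "2 * X \<le> real q * X" using q X1 by (intro mult_right_mono) auto
    ultimately have "real q / 2 + 3 * (real q * X) + 10 * X \<le> 10 * (real q * X)" using X1 q1
      by (simp only: mult.commute[of X])
    then show "real q / 2 + 3 * real q * X + 10 * X \<le> 10 * real q * X" by (simp only: mult.assoc)
  qed simp
  also have "\<dots> = 10 * (real q)\<^sup>2 * X * real q ^ \<mu> / 2 ^ u"
    by (simp add: M_def power2_eq_square)
  finally show ?thesis unfolding M_def X_def .
qed

section \<open>The estimate for a block of a progression\<close>

text \<open>\<open>c\<close> is \<open>q ^ e\<close> divided by its gcd with \<open>n0\<close>.
  Primes dividing \<open>q\<close> occur in \<open>n0\<close> with exponent at most
  \<open>e\<close>, so the gcd contains these powers completely and the cofactor \<open>U\<close> is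
  prime to \<open>q\<close>.\<close>

lemma scale_to_power_times_unit:
  fixes q n0 e :: nat
  assumes q: "2 \<le> q" and n0: "0 < n0"
    and nd: "\<And>p. prime p \<Longrightarrow> p dvd q \<Longrightarrow> \<not> p ^ (e + 1) dvd n0"
  obtains c U where "1 \<le> c" "c \<le> q ^ e" "c * n0 = q ^ e * U" "coprime U q"
proof -
  define g where "g = gcd n0 (q ^ e)"
  have g0: "0 < g" using n0 by (simp add: g_def)
  define c where "c = q ^ e div g"
  define U where "U = n0 div g"
  have gq: "c * g = q ^ e" by (simp add: c_def g_def)
  have gn: "U * g = n0" by (simp add: U_def g_def)
  have c0: "0 < c" using gq q by (intro Nat.gr0I) auto
  have "coprime U q"
  proof (rule ccontr)
    assume "\<not> coprime U q"
    then obtain p where p: "prime p" "p dvd U" "p dvd q"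
      by (metis coprime_iff_gcd_eq_1 gcd_dvd1 gcd_dvd2 dvd_trans prime_factor_nat)
    define v where "v = multiplicity p n0"
    have "v < e + 1"
      using nd[OF p(1,3)] multiplicity_dvd'[of "e + 1" p n0] by (auto simp: v_def not_le[symmetric])
    then have "p ^ v dvd p ^ e" by (intro le_imp_power_dvd) simp
    also have "p ^ e dvd q ^ e" using p(3) by (rule dvd_power_same)
    finally have "p ^ v dvd g" unfolding g_def v_def by (simp add: multiplicity_dvd)
    then have "p ^ v * p dvd g * U" using p(2) by (rule mult_dvd_mono)
    then have "p ^ (v + 1) dvd n0" using gn by (simp add: mult.commute)
    then have "v + 1 \<le> multiplicity p n0" using n0 p(1) by (intro multiplicity_geI) auto
    then show False by (simp add: v_def)
  qed
  moreover have "c * n0 = q ^ e * U" unfolding gn[symmetric] gq[symmetric] by (simp only: mult_ac)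
  moreover have "c \<le> q ^ e" unfolding c_def by simp
  ultimately show ?thesis using that[of c U] c0 by simp
qed

text \<open>The number of digits left after \<open>j\<close> van der Corput steps that start with \<open>\<alpha>\<close> digits: a step whose
  shift comes from Dirichlet approximation with denominator at most \<open>q ^ w\<close> removes \<open>w - 9 * u\<close>.\<close>

fun scale :: "nat \<Rightarrow> nat \<Rightarrow> nat \<Rightarrow> nat \<Rightarrow> nat" where
  "scale u w \<alpha> 0 = \<alpha>"
| "scale u w \<alpha> (Suc j) = (if 2 * w \<le> scale u w \<alpha> j then scale u w \<alpha> j - (w - 9 * u) else scale u w \<alpha> j)"

lemma scale_mono: "scale u w \<alpha> (Suc j) \<le> scale u w \<alpha> j"
  by simp

lemma scale_le: "scale u w \<alpha> j \<le> \<alpha>"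
  by (induction j) (auto intro: order_trans[OF scale_mono])

lemma scale_ge: "9 * u \<le> \<alpha> \<Longrightarrow> 9 * u \<le> scale u w \<alpha> j"
  by (induction j) auto

lemma scale_less:
  assumes "20 * u \<le> w" "\<alpha> < 2 * w + J * (w - 9 * u)"
  shows "scale u w \<alpha> J < 2 * w"
proof -
  have "scale u w \<alpha> j < 2 * w \<or> scale u w \<alpha> j + j * (w - 9 * u) \<le> \<alpha>" for j
  proof (induction j)
    case (Suc j)
    then show ?case by (auto simp: not_le)
  qed simp
  from this[of J] show ?thesis using assms by linarith
qed

lemma dirichlet_nat:
  fixes m q w \<alpha> :: nat
  assumes q: "2 \<le> q" and w: "w \<le> \<alpha>"
  obtains K and A :: int where "K \<in> {1..q ^ w}" "\<bar>int (K * m) - A * int (q ^ \<alpha>)\<bar> \<le> int (q ^ (\<alpha> - w))"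
proof -
  have "0 < q ^ w" using q by simp
  then obtain h k where hk: "0 < k" "k \<le> int (q ^ w)"
      "\<bar>of_int k * (real m / real q ^ \<alpha>) - of_int h\<bar> < 1 / real (q ^ w)"
    using Dirichlet_approx[of "q ^ w" "real m / real q ^ \<alpha>"] by metis
  have q0: "0 < real q ^ \<alpha>" using q by simp
  have "\<bar>of_int k * real m - of_int h * real q ^ \<alpha>\<bar> = \<bar>of_int k * (real m / real q ^ \<alpha>) - of_int h\<bar> * real q ^ \<alpha>"
  proof -
    have "of_int k * real m - of_int h * X = (of_int k * (real m / X) - of_int h) * X" if "0 < X" for X
      using that by (simp add: field_simps)
    from this[OF q0] show ?thesis by (simp only: abs_mult) (use q0 in simp)
  qed
  also have "\<dots> \<le> 1 / real (q ^ w) * real q ^ \<alpha>" using hk(3) q0 by (intro mult_right_mono) auto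
  also have "\<dots> = real q ^ (\<alpha> - w)" using q w by (simp add: power_diff)
  finally have "real_of_int \<bar>k * int m - h * int (q ^ \<alpha>)\<bar> \<le> real_of_int (int (q ^ (\<alpha> - w)))" by simp
  then have "\<bar>k * int m - h * int (q ^ \<alpha>)\<bar> \<le> int (q ^ (\<alpha> - w))" by (simp only: of_int_le_iff)
  moreover have "int (nat k * m) = k * int m" using hk(1) by simp
  moreover have "nat k \<in> {1..q ^ w}" using hk(1,2) by (auto simp: nat_le_iff)
  ultimately show ?thesis using that[of "nat k" h] by (simp del: of_nat_mult)
qed

context contraction
begin

text \<open>Layers: above \<open>\<mu> + 1 + 9 * u\<close> the shift \<open>c * m\<close> is small
  as an integer; then at most \<open>k - 2\<close> Dirichlet steps lead below \<open>2 * w\<close>;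
  the last direction goes from there to \<open>5 * u\<close>. The \<open>9 * u\<close> lost in a
  Dirichlet step are \<open>2 * u\<close> for reaching a unit, \<open>5 * u\<close> for the range
  \<open>H\<close>, and \<open>2 * u\<close> for a margin that makes unsafe positions rare.\<close>

lemma block_estimate:
  assumes k2: "2 \<le> k" and u: "u = l * t" and u3: "3 \<le> u" and w: "20 * u \<le> w" and \<mu>: "5 * u \<le> \<mu>"
    and len: "\<mu> + 1 + 9 * u < 2 * w + (k - 2) * (w - 9 * u)"
    and m: "q ^ \<mu> \<le> m" "m < q ^ (\<mu> + 1)" and gd: "good q u w \<mu> m"
    and N: "N = q ^ (2 * w + 6 * u)"
  shows "norm (mean {..<N} (\<lambda>n. cis (\<theta> * real (ds q (n * m + r)))))
    \<le> 2 * real k / real q ^ u + root (2 ^ k) (\<rho> ^ t + 4 * real k * 2 ^ k / real q ^ u)"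
proof -
  define J where "J = k - 2"
  define \<alpha> where "\<alpha> = scale u w (\<mu> + 1 + 9 * u)"
  have k: "k = J + 2" using k2 by (simp add: J_def)
  have aJ: "\<alpha> J < 2 * w" unfolding \<alpha>_def using len w by (intro scale_less) (auto simp: J_def)
  have a5: "5 * u \<le> \<alpha> j" for j
    using scale_ge[of u "\<mu> + 1 + 9 * u" w j] by (simp add: \<alpha>_def)
  have "0 < q ^ \<mu>" using q2 by simp
  then have m0: "0 < m" using m by linarith
  have g1: "\<not> p ^ (u + 1) dvd m" if "prime p" "p dvd q" for p
    using gd[unfolded good_def, THEN conjunct1, rule_format, of p] that by blast
  have g2: "\<not> p ^ (u + 1) dvd K"
    if "a \<in> {2 * w..\<mu> + 1 + 9 * u}" "prime p" "p dvd q" "K \<in> {1..q ^ w}"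
      "\<bar>int (K * m) - A * int (q ^ a)\<bar> \<le> int (q ^ (a - w))" for a p K A
    using gd[unfolded good_def, THEN conjunct2, THEN conjunct1, rule_format, of a p K] that by blast
  have g3: "int (2 * q ^ (a - 2 * u)) < \<bar>int (t * m) - A * int (q ^ a)\<bar>"
    if "a \<in> {5 * u..\<mu>}" "1 \<le> t" "t < q ^ u" for a t A
  proof -
    have "t \<in> {1..<q ^ u}" using that by simp
    then have "\<not> \<bar>int (t * m) - A * int (q ^ a)\<bar> \<le> int (2 * q ^ (a - 2 * u))"
      using gd[unfolded good_def, THEN conjunct2, THEN conjunct2, rule_format, OF that(1)] by blast
    then show ?thesis by simp
  qed
  obtain c U where c: "1 \<le> c" "c \<le> q ^ (2 * u)" "c * m = q ^ (2 * u) * U" "coprime U q"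
  proof (rule scale_to_power_times_unit[OF q2 m0, of "2 * u"])
    show "\<not> p ^ (2 * u + 1) dvd m" if "prime p" "p dvd q" for p
      using g1[OF that] dvd_trans[OF le_imp_power_dvd[of "u + 1" "2 * u + 1" p], of m] by auto
  qed
  \<comment> \<open>The last range is short, so that it times the shift \<open>q ^ (2 * u)\<close>
    is \<open>q ^ (3 * u)\<close>, exactly the margin allowed at position
    \<open>5 * u\<close>.\<close>
  define H where "H i = (if i < k - 1 then q ^ (5 * u) else q ^ u)" for i :: nat
  \<comment> \<open>\<open>Top\<close> plays the role of infinity: no number that occurs has that many digits.\<close>
  define Top where "Top = N * m + r + k * (q ^ (2 * w) * m * q ^ (5 * u)) + \<mu> + 1 + 9 * u"
  define \<beta> where "\<beta> j = (if j = 0 then Top else if j < k then \<alpha> (j - 1) else 5 * u)" for j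
  \<comment> \<open>Chosen so that \<open>2 * Z j\<close> is the separation in the third condition
    of \<open>good\<close>.\<close>
  define Z where "Z j = q ^ (\<beta> (Suc j) - 2 * u)" for j
  have \<beta>S: "\<beta> (Suc j) = (if j = J + 1 then 5 * u else \<alpha> j)" if "j < k" for j
    using that by (auto simp: \<beta>_def k)
  have mono: "\<beta> (Suc j) \<le> \<beta> j" if "j < k" for j
  proof (cases j)
    case 0
    have "\<alpha> 0 \<le> Top" by (simp add: \<alpha>_def Top_def)
    then show ?thesis using 0 by (simp add: \<beta>_def k)
  next
    case (Suc i)
    then show ?thesis using that a5 scale_mono[of u w "\<mu> + 1 + 9 * u" i] by (auto simp: \<beta>_def k \<alpha>_def)
  qed
  have ex: "\<exists>K s. K \<le> q ^ (2 * w) \<and>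
     (if j < k - 1 then \<exists>U. coprime U q \<and> [K * m = q ^ (2 * u) * U] (mod q ^ (5 * u))
      else [K * m = q ^ (2 * u)] (mod q ^ (5 * u))) \<and>
     (\<beta> (Suc j) < \<beta> j \<longrightarrow> [int (K * m) = s] (mod int (q ^ \<beta> j)) \<and> \<bar>s\<bar> * int (H j) \<le> int (Z j))"
    if j: "j < k" for j
  proof -
    have c2w: "c \<le> q ^ (2 * w)"
      using c(2) power_increasing[of "2 * u" "2 * w" q] w q2 by linarith
    have cfull: "\<exists>U. coprime U q \<and> [c * m = q ^ (2 * u) * U] (mod q ^ (5 * u))"
      using c by (intro exI[of _ U]) (simp add: cong_refl)
    consider "j = 0" | "1 \<le> j" "j \<le> J" "2 * w \<le> \<alpha> (j - 1)" | "1 \<le> j" "j \<le> J" "\<not> 2 * w \<le> \<alpha> (j - 1)" | "j = J + 1"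
      using j by (auto simp: k) linarith
    then show ?thesis
    proof cases
      case 1
      have "c * m * q ^ (5 * u) \<le> q ^ (2 * u) * q ^ (\<mu> + 1) * q ^ (5 * u)"
        using c(2) m by (intro mult_le_mono) auto
      also have "\<dots> = q ^ (2 * u + (\<mu> + 1) + 5 * u)" by (simp only: power_add)
      also have "2 * u + (\<mu> + 1) + 5 * u = \<beta> (Suc 0) - 2 * u" by (simp add: \<beta>_def k \<alpha>_def)
      also have "q ^ \<dots> = Z 0" by (simp only: Z_def)
      finally have "int (c * m * q ^ (5 * u)) \<le> int (Z 0)" by (simp only: of_nat_le_iff)
      then show ?thesis using 1 c2w cfull
        by (intro exI[of _ c] exI[of _ "int (c * m)"]) (simp add: H_def k cong_refl)
    next
      case 2
      let ?a = "\<alpha> (j - 1)"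
      have bj: "\<beta> j = ?a" using 2 j by (simp add: \<beta>_def)
      have bS: "\<beta> (Suc j) = ?a - (w - 9 * u)"
        using 2 by (cases j) (auto simp: \<beta>_def k \<alpha>_def)
      have ain: "?a \<in> {2 * w..\<mu> + 1 + 9 * u}" using 2 scale_le by (simp add: \<alpha>_def)
      obtain K A where KA: "K \<in> {1..q ^ w}" "\<bar>int (K * m) - A * int (q ^ ?a)\<bar> \<le> int (q ^ (?a - w))"
        using dirichlet_nat[OF q2, of w ?a m] ain by auto
      \<comment> \<open>A factor \<open>p ^ (2 * u + 1)\<close> of \<open>K * m\<close> would put
        \<open>p ^ (u + 1)\<close> into \<open>K\<close> or \<open>m\<close>; the first two
        conditions of \<open>good\<close> exclude both.\<close>
      have nd: "\<not> p ^ (2 * u + 1) dvd K * m" if p: "prime p" "p dvd q" for p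
      proof
        assume "p ^ (2 * u + 1) dvd K * m"
        then have "2 * u + 1 \<le> multiplicity p (K * m)"
          using KA m0 p by (intro multiplicity_geI) auto
        also have "\<dots> = multiplicity p K + multiplicity p m"
          using KA m0 p by (intro prime_elem_multiplicity_mult_distrib) auto
        finally have "u + 1 \<le> multiplicity p K \<or> u + 1 \<le> multiplicity p m" by linarith
        then have "p ^ (u + 1) dvd K \<or> p ^ (u + 1) dvd m"
          using multiplicity_dvd'[of "u + 1" p K] multiplicity_dvd'[of "u + 1" p m] by blast
        then show False using g1[OF p] g2[OF ain p KA] by blast
      qed
      have "0 < K * m" using KA m0 by simp
      then obtain d V where d: "1 \<le> d" "d \<le> q ^ (2 * u)" "d * (K * m) = q ^ (2 * u) * V" "coprime V q"
        by (rule scale_to_power_times_unit[OF q2 _ nd])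
      define s where "s = int d * (int (K * m) - A * int (q ^ ?a))"
      have "d * K \<le> q ^ (2 * u) * q ^ w" using d KA by (intro mult_le_mono) auto
      also have "\<dots> = q ^ (2 * u + w)" by (simp add: power_add)
      also have "\<dots> \<le> q ^ (2 * w)" using w q2 by (intro power_increasing) auto
      finally have 1: "d * K \<le> q ^ (2 * w)" .
      have 2: "\<exists>U. coprime U q \<and> [d * K * m = q ^ (2 * u) * U] (mod q ^ (5 * u))"
        using d by (intro exI[of _ V]) (simp add: cong_refl mult.assoc)
      have 3: "[int (d * K * m) = s] (mod int (q ^ ?a))"
      proof -
        have "int (d * K * m) - s = int (q ^ ?a) * (int d * A)" by (simp add: s_def algebra_simps)
        then show ?thesis by (simp add: cong_iff_dvd_diff)
      qed
      have "\<bar>s\<bar> * int (H j) = int d * \<bar>int (K * m) - A * int (q ^ ?a)\<bar> * int (q ^ (5 * u))"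
        using \<open>1 \<le> j\<close> \<open>j \<le> J\<close> by (simp add: s_def abs_mult H_def k)
      also have "\<dots> \<le> int (q ^ (2 * u)) * int (q ^ (?a - w)) * int (q ^ (5 * u))"
        using d KA by (intro mult_right_mono mult_mono) (auto simp del: of_nat_power)
      also have "\<dots> = int (q ^ (2 * u + (?a - w) + 5 * u))" by (simp only: power_add of_nat_mult)
      also have "2 * u + (?a - w) + 5 * u = \<beta> (Suc j) - 2 * u" using bS ain w by simp
      finally have 4: "\<bar>s\<bar> * int (H j) \<le> int (Z j)" by (simp add: Z_def)
      show ?thesis using 1 2 3 4 \<open>j \<le> J\<close> unfolding bj
        by (intro exI[of _ "d * K"] exI[of _ s]) (simp add: k)
    next
      \<comment> \<open>Fewer than \<open>2 * w\<close> digits are left: an idle step with an empty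
        layer, which supplies a shift of full range.\<close>
      case 3
      have "\<beta> (Suc j) = \<beta> j" using 3 by (cases j) (auto simp: \<beta>_def k \<alpha>_def)
      then show ?thesis using 3 c2w cfull by (intro exI[of _ c]) (simp add: k)
    next
      case 4
      have bj: "\<beta> j = \<alpha> J" using 4 by (simp add: \<beta>_def k)
      have Zj: "Z j = q ^ (3 * u)" using 4 by (simp add: Z_def \<beta>_def k)
      have "coprime U (q ^ \<alpha> J)" using c(4) by simp
      then obtain V where V: "[U * V = 1] (mod q ^ \<alpha> J)"
        using cong_solve_coprime_nat[of U "q ^ \<alpha> J"] by auto
      \<comment> \<open>\<open>c * m\<close> is \<open>q ^ (2 * u) * U\<close>, so the inverse
        \<open>V\<close> of \<open>U\<close> leaves \<open>q ^ (2 * u)\<close>. Reduction modulo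
        \<open>q ^ \<alpha> J\<close> keeps the multiplier below \<open>q ^ (2 * w)\<close>.\<close>
      define K where "K = (c * V) mod q ^ \<alpha> J"
      have "[K * m = c * V * m] (mod q ^ \<alpha> J)"
        unfolding K_def by (intro cong_mult cong_refl) simp
      also have "c * V * m = c * m * V" by (simp only: mult_ac)
      also have "c * m * V = q ^ (2 * u) * (U * V)" unfolding c(3) by (simp only: mult_ac)
      also have "[q ^ (2 * u) * (U * V) = q ^ (2 * u) * 1] (mod q ^ \<alpha> J)" by (intro cong_mult cong_refl V)
      finally have Km: "[K * m = q ^ (2 * u)] (mod q ^ \<alpha> J)" by simp
      then have "[int (K * m) = int (q ^ (2 * u))] (mod int (q ^ \<alpha> J))" by (simp only: cong_int_iff)
      moreover have "[K * m = q ^ (2 * u)] (mod q ^ (5 * u))"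
        using Km by (rule cong_dvd_modulus_nat) (intro le_imp_power_dvd a5)
      moreover have "K \<le> q ^ (2 * w)"
      proof -
        have "K < q ^ \<alpha> J" using q2 by (simp add: K_def)
        also have "\<dots> \<le> q ^ (2 * w)" using aJ q2 by (intro power_increasing) auto
        finally show ?thesis by simp
      qed
      moreover have "\<bar>int (q ^ (2 * u))\<bar> * int (H j) \<le> int (Z j)"
        unfolding Zj using 4 by (simp add: H_def k flip: power_add)
      ultimately show ?thesis using 4 unfolding bj
        by (intro exI[of _ K] exI[of _ "int (q ^ (2 * u))"]) (simp add: k)
    qed
  qed
  then obtain K s where Ks: "\<And>j. j < k \<Longrightarrow> K j \<le> q ^ (2 * w) \<and>
     (if j < k - 1 then \<exists>U. coprime U q \<and> [K j * m = q ^ (2 * u) * U] (mod q ^ (5 * u))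
      else [K j * m = q ^ (2 * u)] (mod q ^ (5 * u))) \<and>
     (\<beta> (Suc j) < \<beta> j \<longrightarrow> [int (K j * m) = s j] (mod int (q ^ \<beta> j)) \<and> \<bar>s j\<bar> * int (H j) \<le> int (Z j))"
    by metis
  have N0: "0 < N" using N q2 by simp
  have H5: "H j \<le> q ^ (5 * u)" for j
    unfolding H_def using q2 by (auto intro!: power_increasing)
  let ?d = "2 * real N / real q ^ u"
  have dN: "2 * q ^ (7 * u + 1) * q ^ u \<le> N"
  proof -
    have "2 * q ^ (7 * u + 1) * q ^ u \<le> q * q ^ (7 * u + 1) * q ^ u" using q2 by (intro mult_le_mono) auto
    also have "\<dots> = q ^ (1 + (7 * u + 1) + u)" by (simp only: power_add power_one_right)
    also have "1 + (7 * u + 1) + u = 8 * u + 2" by simp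
    also have "q ^ (8 * u + 2) \<le> N" unfolding N using w u3 q2 by (intro power_increasing) auto
    finally show ?thesis .
  qed
  have zone: "real (card {n. n < N \<and> \<not> safe (q ^ \<beta> (Suc j)) (Z j) (n * m + r')}) \<le> ?d"
    if j: "j < k" "\<beta> (Suc j) < \<beta> j" for j r'
  proof -
    have "\<exists>d. 0 < d \<and> d \<le> 2 * q ^ (7 * u + 1) \<and> (\<forall>t A. 1 \<le> t \<longrightarrow> t < q ^ u \<longrightarrow>
        2 * int (Z j) \<le> \<bar>int (t * d * m) - A * int (q ^ \<beta> (Suc j))\<bar>)"
    proof (cases "j = 0")
      case True
      \<comment> \<open>In the top layer \<open>Z\<close> exceeds \<open>m\<close>, so neighbouring
        terms are too close to be separated. Steps of \<open>?d\<close> indices move by at least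
        \<open>2 * Z\<close> and, for \<open>t < q ^ u\<close>, stay at least \<open>2 * Z\<close>
        short of \<open>q ^ \<beta> (Suc j)\<close>.\<close>
      let ?d = "2 * q ^ (7 * u + 1)"
      have b1: "\<beta> (Suc j) = \<mu> + 1 + 9 * u" using True by (simp add: \<beta>_def k \<alpha>_def)
      have Z0: "Z j = q ^ (\<mu> + 1 + 7 * u)" unfolding Z_def b1 by (rule arg_cong[where f = "power q"]) simp
      have "2 * int (Z j) \<le> \<bar>int (t * ?d * m) - A * int (q ^ \<beta> (Suc j))\<bar>"
        if t: "1 \<le> t" "t < q ^ u" for t A
      proof -
        have e1: "\<mu> + 1 + 7 * u = (7 * u + 1) + \<mu>" by simp
        have "2 * Z j = 1 * ?d * q ^ \<mu>" unfolding Z0 e1 power_add by (simp only: mult_ac mult_1)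
        also have "\<dots> \<le> t * ?d * m" using t m by (intro mult_le_mono) auto
        finally have lo: "2 * Z j \<le> t * ?d * m" .
        have hi: "t * ?d * m + 2 * Z j \<le> q ^ \<beta> (Suc j)"
        proof -
          have q22: "4 \<le> q ^ 2" using power_mono[OF q2, of 2] by simp
          have "t * ?d * m \<le> q ^ u * ?d * q ^ (\<mu> + 1)" using t m by (intro mult_le_mono) auto
          also have "\<dots> = 2 * q ^ (u + (7 * u + 1) + (\<mu> + 1))" unfolding power_add by (simp only: mult_ac)
          also have "u + (7 * u + 1) + (\<mu> + 1) = 8 * u + \<mu> + 2" by simp
          finally have 1: "t * ?d * m \<le> 2 * q ^ (8 * u + \<mu> + 2)" .
          have "Z j \<le> q ^ (8 * u + \<mu> + 2)" unfolding Z0 using q2 by (intro power_increasing) auto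
          with 1 have "t * ?d * m + 2 * Z j \<le> 4 * q ^ (8 * u + \<mu> + 2)" by linarith
          also have "\<dots> \<le> q ^ 2 * q ^ (8 * u + \<mu> + 2)" using q22 by (rule mult_le_mono1)
          also have "\<dots> = q ^ (2 + (8 * u + \<mu> + 2))" by (simp only: power_add)
          also have "\<dots> \<le> q ^ \<beta> (Suc j)" unfolding b1 using u3 q2 by (intro power_increasing) auto
          finally show ?thesis .
        qed
        show ?thesis
        proof (cases "A \<le> 0")
          case True
          then have "A * int (q ^ \<beta> (Suc j)) \<le> 0" by (intro mult_nonpos_nonneg) auto
          moreover have "int (2 * Z j) \<le> int (t * ?d * m)" using lo by (simp only: of_nat_le_iff)
          ultimately show ?thesis by simp
        next
          case False
          then have "1 * int (q ^ \<beta> (Suc j)) \<le> A * int (q ^ \<beta> (Suc j))" by (intro mult_right_mono) auto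
          moreover have "int (t * ?d * m + 2 * Z j) \<le> int (q ^ \<beta> (Suc j))" using hi by (simp only: of_nat_le_iff)
          ultimately show ?thesis by simp
        qed
      qed
      then show ?thesis using q2 by (intro exI[of _ ?d]) auto
    next
      case False
      \<comment> \<open>A nonempty later layer either ends at \<open>5 * u\<close> or has lost
        \<open>w - 9 * u \<ge> 11 * u\<close> digits, so it ends at or below \<open>\<mu>\<close>,
        where \<open>good\<close> separates the multiples of \<open>m\<close> themselves.\<close>
      have "\<beta> (Suc j) \<in> {5 * u..\<mu>}"
      proof (cases "j = J + 1")
        case True
        then show ?thesis using \<mu> by (simp add: \<beta>_def k)
      next
        case F: False
        then have "\<beta> (Suc j) = \<alpha> j" "\<beta> j = \<alpha> (j - 1)" using False j by (auto simp: \<beta>_def k)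
        then have "\<alpha> j = \<alpha> (j - 1) - (w - 9 * u)"
          using False j by (cases j) (auto simp: \<alpha>_def split: if_splits)
        moreover have "\<alpha> (j - 1) \<le> \<mu> + 1 + 9 * u" unfolding \<alpha>_def by (rule scale_le)
        ultimately have "\<alpha> j \<le> \<mu>" using w u3 by linarith
        then show ?thesis using a5 \<open>\<beta> (Suc j) = \<alpha> j\<close> by simp
      qed
      then have "2 * int (Z j) \<le> \<bar>int (t * 1 * m) - A * int (q ^ \<beta> (Suc j))\<bar>" if "1 \<le> t" "t < q ^ u" for t A
        using g3[OF _ that, of "\<beta> (Suc j)" A] by (simp add: Z_def)
      then show ?thesis using q2 by (intro exI[of _ 1]) auto
    qed
    then obtain d where d: "0 < d" "d \<le> 2 * q ^ (7 * u + 1)" "\<And>t A. 1 \<le> t \<Longrightarrow> t < q ^ u \<Longrightarrow>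
        2 * int (Z j) \<le> \<bar>int (t * d * m) - A * int (q ^ \<beta> (Suc j))\<bar>" by blast
    have "real (card {n. n < N \<and> \<not> safe (q ^ \<beta> (Suc j)) (Z j) (n * m + r')}) \<le> real N / real (q ^ u) + real d"
      by (rule card_unsafe_le[OF _ d(1) _ d(3)]) (use q2 in auto)
    also have "real d \<le> real N / real (q ^ u)"
    proof -
      have "d * q ^ u \<le> N" using mult_le_mono1[OF d(2), of "q ^ u"] dN by (rule le_trans)
      then have "real (d * q ^ u) \<le> real N" by (simp only: of_nat_le_iff)
      then show ?thesis using q2 by (simp add: pos_le_divide_eq)
    qed
    finally show ?thesis by simp
  qed
  have E: "real (K i) * real (H i) \<le> 1 / real q ^ u * real N" if "i < k" for i
  proof -
    have "K i * H i * q ^ u \<le> q ^ (2 * w) * q ^ (5 * u) * q ^ u"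
      using Ks[OF that] H5 by (intro mult_le_mono) auto
    also have "\<dots> = q ^ (2 * w + 5 * u + u)" by (simp only: power_add)
    also have "2 * w + 5 * u + u = 2 * w + 6 * u" by simp
    also have "q ^ \<dots> = N" by (simp only: N)
    finally have "real (K i * H i * q ^ u) \<le> real N" by (simp only: of_nat_le_iff)
    then show ?thesis using q2 by (simp add: pos_le_divide_eq)
  qed
  have top: "N * m + r + (\<Sum>i<k. K i * m * H i) < q ^ \<beta> 0"
  proof -
    have "(\<Sum>i<k. K i * m * H i) \<le> (\<Sum>i<k. q ^ (2 * w) * m * q ^ (5 * u))"
      using Ks H5 by (intro sum_mono mult_le_mono) auto
    then have "N * m + r + (\<Sum>i<k. K i * m * H i) \<le> Top" by (simp add: Top_def)
    also have "Top < 2 ^ Top" by simp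
    also have "2 ^ Top \<le> q ^ Top" using q2 by (rule power_mono) simp
    finally show ?thesis by (simp add: \<beta>_def)
  qed
  have "norm (mean {..<N} (\<lambda>n. cis (\<theta> * real (ds q (n * m + r)))))
    \<le> 2 * real k * (1 / real q ^ u) + root (2 ^ k) (\<rho> ^ t + 2 * (real k * 2 ^ k * ?d) / real N)"
  proof (rule norm_mean_digits_le[where K = K and H = H and \<beta> = \<beta> and Z = Z and s = s, OF k2 u N0])
    show "H i = q ^ (5 * u)" if "i < k - 1" for i using that by (simp add: H_def)
    show "H (k - 1) = q ^ u" by (simp add: H_def)
    show "\<exists>U. coprime U q \<and> [K i * m = q ^ (2 * u) * U] (mod q ^ (5 * u))" if "i < k - 1" for i
      using Ks[of i] that by simp
    show "[K (k - 1) * m = q ^ (2 * u)] (mod q ^ (5 * u))"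
      using Ks[of "k - 1"] k0 by simp
    show "\<beta> k = 5 * u" using k0 by (simp add: \<beta>_def)
    show "[int (K j * m) = s j] (mod int (q ^ \<beta> j)) \<and> \<bar>s j\<bar> * int (H j) \<le> int (Z j)"
      if "j < k" "\<beta> (Suc j) < \<beta> j" for j using Ks[OF that(1)] that(2) by blast
    show "0 \<le> ?d" by simp
  qed (use E mono top zone in blast)+
  also have "2 * (real k * 2 ^ k * ?d) / real N = 4 * real k * 2 ^ k / real q ^ u"
    using N0 by simp
  finally show ?thesis by simp
qed

end

section \<open>Counting in residue classes\<close>

text \<open>Induction through \<open>n div q\<close>: without its term for \<open>k = 0\<close>, the
  series is that of the quotient.\<close>

lemma digit_sum_int:
  assumes "2 \<le> q"
  shows "digit_sum (int q) (int n) = int (ds q n)"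
proof -
  have "(\<lambda>k. int n div int q ^ k mod int q) sums int (ds q n)"
  proof (induction n rule: less_induct)
    case (less n)
    show ?case
    proof (cases "n = 0")
      case False
      then have "n div q < n" using assms by simp
      from less[OF this] have "(\<lambda>k. int (n div q) div int q ^ k mod int q) sums int (ds q (n div q))" .
      moreover have "int (n div q) div int q ^ k = int n div int q ^ Suc k" for k
        by (simp add: zdiv_int zdiv_zmult2_eq)
      ultimately have "(\<lambda>k. int n div int q ^ Suc k mod int q) sums int (ds q (n div q))" by simp
      then have "(\<lambda>k. int n div int q ^ k mod int q) sums (int (ds q (n div q)) + int n div int q ^ 0 mod int q)"
        by (rule sums_Suc)
      then show ?thesis using ds_rec[OF assms, of n] by (simp add: zmod_int add.commute)
    qed simp
  qed
  then show ?thesis by (simp add: digit_sum_def sums_iff)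
qed

lemma norm_progression_sum_le:
  fixes g :: "nat \<Rightarrow> complex" and D N L r :: nat
  assumes g: "\<And>n. norm (g n) \<le> 1" and N: "0 < N" and \<beta>: "0 \<le> \<beta>"
    and block: "\<And>r. norm (\<Sum>n<N. g (n * D + r)) \<le> real N * \<beta>"
  shows "norm (\<Sum>n<L. g (n * D + r)) \<le> real L * \<beta> + real N"
proof (induction L arbitrary: r rule: less_induct)
  case (less L)
  show ?case
  proof (cases "L < N")
    case True
    have "norm (\<Sum>n<L. g (n * D + r)) \<le> (\<Sum>n<L. 1)" by (rule sum_norm_le) (rule g)
    then show ?thesis using True \<beta> by (simp add: add_increasing)
  next
    case False
    then obtain L' where L': "L = N + L'" by (metis le_Suc_ex not_less)
    have "(\<Sum>n<L. g (n * D + r)) = (\<Sum>n<N. g (n * D + r)) + (\<Sum>n<L'. g ((n + N) * D + r))"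
      unfolding L' using sum.atLeastLessThan_concat[of 0 N "N + L'" "\<lambda>n. g (n * D + r)"]
        sum.shift_bounds_nat_ivl[of "\<lambda>n. g (n * D + r)" 0 N L']
      by (simp add: atLeast0LessThan add.commute)
    also have "(\<Sum>n<L'. g ((n + N) * D + r)) = (\<Sum>n<L'. g (n * D + (N * D + r)))"
      by (simp add: algebra_simps)
    also have "norm ((\<Sum>n<N. g (n * D + r)) + \<dots>) \<le> real N * \<beta> + (real L' * \<beta> + real N)"
      by (intro norm_triangle_le add_mono block less) (use L' N in simp)
    finally show ?thesis by (simp add: L' algebra_simps)
  qed
qed

text \<open>Sorting indices by their residue modulo \<open>e\<close> gives \<open>e\<close>
  progressions of difference \<open>m * e\<close>, each with its own leftover of at most
  \<open>N\<close>; the incomplete last group costs at most \<open>e\<close>.\<close>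

lemma norm_progression_sum_coarse_le:
  fixes g :: "nat \<Rightarrow> complex" and m e N L r :: nat
  assumes g: "\<And>n. norm (g n) \<le> 1" and N: "0 < N" and \<beta>: "0 \<le> \<beta>" and e: "0 < e"
    and block: "\<And>r. norm (\<Sum>n<N. g (n * (m * e) + r)) \<le> real N * \<beta>"
  shows "norm (\<Sum>n<L. g (n * m + r)) \<le> real L * \<beta> + real e * (real N + 1)"
proof -
  define Q R where "Q = L div e" and "R = L mod e"
  have L: "L = Q * e + R" by (simp add: Q_def R_def)
  have "(\<Sum>n<Q * e. g (n * m + r)) = (\<Sum>i<Q. \<Sum>n\<in>{i * e..<i * e + e}. g (n * m + r))"
    by (rule sum.nat_group[symmetric])
  also have "\<dots> = (\<Sum>i<Q. \<Sum>n<e. g ((n + i * e) * m + r))"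
  proof (rule sum.cong[OF refl])
    have "(\<Sum>n\<in>{d..<d + e}. G n) = (\<Sum>n<e. G (n + d))" for d and G :: "nat \<Rightarrow> complex"
      using sum.shift_bounds_nat_ivl[of G 0 d e] by (simp add: atLeast0LessThan add.commute)
    then show "(\<Sum>n\<in>{i * e..<i * e + e}. g (n * m + r)) = (\<Sum>n<e. g ((n + i * e) * m + r))" for i
      by simp
  qed
  also have "\<dots> = (\<Sum>n<e. \<Sum>i<Q. g (i * (m * e) + (n * m + r)))"
    by (subst sum.swap) (simp add: algebra_simps)
  also have "norm \<dots> \<le> (\<Sum>n<e. real Q * \<beta> + real N)"
    by (intro sum_norm_le norm_progression_sum_le g N \<beta> block)
  finally have 1: "norm (\<Sum>n<Q * e. g (n * m + r)) \<le> real e * (real Q * \<beta> + real N)" by simp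
  have "(\<Sum>n<L. g (n * m + r)) = (\<Sum>n<Q * e. g (n * m + r)) + (\<Sum>n\<in>{Q * e..<L}. g (n * m + r))"
    using sum.atLeastLessThan_concat[of 0 "Q * e" L "\<lambda>n. g (n * m + r)"] L
    by (simp add: atLeast0LessThan)
  moreover have "norm (\<Sum>n\<in>{Q * e..<L}. g (n * m + r)) \<le> (\<Sum>n\<in>{Q * e..<L}. 1)"
    by (rule sum_norm_le) (rule g)
  moreover have "(\<Sum>n\<in>{Q * e..<L}. 1) \<le> real e"
  proof -
    have "L - Q * e \<le> e" using L mod_less_divisor[OF e, of L] unfolding R_def by linarith
    then show ?thesis by simp
  qed
  ultimately have "norm (\<Sum>n<L. g (n * m + r)) \<le> real e * (real Q * \<beta> + real N) + real e"
    using 1 by (smt (verit) norm_triangle_ineq)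
  also have "\<dots> = real (Q * e) * \<beta> + real e * (real N + 1)" by (simp add: algebra_simps)
  also have "real (Q * e) * \<beta> \<le> real L * \<beta>"
    using \<beta> L by (intro mult_right_mono) (simp_all only: of_nat_le_iff)
  finally show ?thesis by simp
qed

lemma sum_roots_of_unity:
  fixes d :: int and b :: nat
  assumes "0 < b"
  shows "(\<Sum>j<b. cis (2 * pi * real j * real_of_int d / real b)) = (if int b dvd d then of_nat b else 0)"
proof (cases "int b dvd d")
  case True
  then obtain c where c: "d = int b * c" by (rule dvdE)
  have "cis (2 * pi * real j * real_of_int d / real b) = 1" for j
  proof -
    have "2 * pi * real j * real_of_int d / real b = 2 * pi * real_of_int (int j * c)"
      using assms by (simp add: c)
    then show ?thesis by (simp add: cis_multiple_2pi)
  qed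
  then show ?thesis using True by simp
next
  case False
  define z where "z = cis (2 * pi * real_of_int d / real b)"
  have zj: "cis (2 * pi * real j * real_of_int d / real b) = z ^ j" for j
    unfolding z_def Complex.DeMoivre by (rule arg_cong[where f = cis]) simp
  have "z ^ b = 1"
  proof -
    have "real b * (2 * pi * real_of_int d / real b) = 2 * pi * real_of_int d" using assms by simp
    then show ?thesis unfolding z_def Complex.DeMoivre by (simp add: cis_multiple_2pi)
  qed
  moreover have "z \<noteq> 1"
  proof
    assume "z = 1"
    then have "cos (2 * pi * real_of_int d / real b) = 1" by (simp add: z_def complex_eq_iff)
    then obtain i :: int where "2 * pi * real_of_int d / real b = of_int i * 2 * pi"
      unfolding cos_one_2pi_int by blast
    then have "real_of_int d = real_of_int (i * int b)" using assms by (simp add: field_simps)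
    then have "d = i * int b" by (simp only: of_int_eq_iff)
    then show False using False by simp
  qed
  ultimately have "(\<Sum>j<b. z ^ j) = 0" by (simp add: geometric_sum)
  then show ?thesis using False by (simp add: zj)
qed

definition wave :: "nat \<Rightarrow> nat \<Rightarrow> nat \<Rightarrow> nat \<Rightarrow> complex" where
  "wave q b j n = cis (2 * pi * real j / real b * real (ds q n))"

lemma norm_wave [simp]: "norm (wave q b j n) = 1"
  by (simp add: wave_def)

text \<open>Orthogonality of the additive characters modulo \<open>b\<close>: \<open>j = 0\<close>
  gives \<open>L / b\<close>, and the other \<open>b - 1\<close> sums are divided by
  \<open>b\<close>.\<close>

lemma card_residue_class_digit_sum:
  fixes q b L n0 m :: nat and a :: int and B :: real
  assumes b: "0 < b" and B0: "0 \<le> B"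
    and B: "\<And>j. 0 < j \<Longrightarrow> j < b \<Longrightarrow> norm (\<Sum>i<L. wave q b j (i * m + n0)) \<le> B"
  shows "\<bar>real (card {i\<in>{..<L}. [int (ds q (i * m + n0)) = a] (mod int b)}) - real L / real b\<bar> \<le> B"
proof -
  let ?s = "\<lambda>i. ds q (i * m + n0)"
  let ?f = "\<lambda>j. \<Sum>i<L. cis (2 * pi * real j * real_of_int (int (?s i) - a) / real b)"
  have "of_nat b * of_nat (card {i\<in>{..<L}. [int (?s i) = a] (mod int b)})
    = (\<Sum>i<L. if int b dvd int (?s i) - a then of_nat b else (0::complex))"
    by (simp add: sum.If_cases cong_iff_dvd_diff Int_def conj_commute)
  also have "\<dots> = (\<Sum>i<L. \<Sum>j<b. cis (2 * pi * real j * real_of_int (int (?s i) - a) / real b))"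
    by (simp only: sum_roots_of_unity[OF b])
  also have "\<dots> = (\<Sum>j<b. ?f j)" by (rule sum.swap)
  also have "\<dots> = ?f 0 + (\<Sum>j\<in>{1..<b}. ?f j)"
    using b by (simp add: sum.atLeast_Suc_lessThan flip: atLeast0LessThan)
  finally have eq: "of_nat b * of_nat (card {i\<in>{..<L}. [int (?s i) = a] (mod int b)}) - of_nat L = (\<Sum>j\<in>{1..<b}. ?f j)"
    by simp
  have fj: "norm (?f j) \<le> B" if j: "j \<in> {1..<b}" for j
  proof -
    have "?f j = (\<Sum>i<L. cis (2 * pi * real j / real b * real (?s i)) * cis (- (2 * pi * real j * real_of_int a / real b)))"
      by (simp add: cis_mult diff_divide_distrib algebra_simps)
    also have "norm \<dots> = norm (\<Sum>i<L. wave q b j (i * m + n0))"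
      by (simp add: norm_mult wave_def flip: sum_distrib_right)
    also have "\<dots> \<le> B" using B j by simp
    finally show ?thesis .
  qed
  have "\<bar>real b * real (card {i\<in>{..<L}. [int (?s i) = a] (mod int b)}) - real L\<bar>
    = norm (complex_of_real (real b * real (card {i\<in>{..<L}. [int (?s i) = a] (mod int b)}) - real L))"
    by (simp only: norm_of_real)
  also have "\<dots> = norm (\<Sum>j\<in>{1..<b}. ?f j)" by (simp only: eq[symmetric] of_real_diff of_real_mult of_real_of_nat_eq)
  also have "\<dots> \<le> (\<Sum>j\<in>{1..<b}. B)" by (intro sum_norm_le fj)
  also have "\<dots> \<le> real b * B" using B0 b by (simp add: mult_right_mono)
  finally have "\<bar>real b * (real (card {i\<in>{..<L}. [int (?s i) = a] (mod int b)}) - real L / real b)\<bar> \<le> real b * B"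
    using b by (simp add: right_diff_distrib)
  then show ?thesis using b by (simp add: abs_mult)
qed

text \<open>The integers in the residue class of \<open>r\<close> form a progression of
  \<open>L\<close> terms that starts at the first such \<open>n0 \<ge> y\<close>. \<open>L\<close>
  differs from \<open>(z - y) / m\<close> by at most 1, which accounts for the
  \<open>+ 1\<close>.\<close>

lemma discrepancy_le_progression:
  fixes q b m :: nat and a r :: int and y z x B :: real
  assumes q: "2 \<le> q" and b: "2 \<le> b" and m: "1 \<le> m" and yz: "0 \<le> y" "y < z" "z - y \<le> x"
    and B0: "0 \<le> B"
    and B: "\<And>j L n0. 0 < j \<Longrightarrow> j < b \<Longrightarrow> real L \<le> x / real m + 1 \<Longrightarrow>
      norm (\<Sum>i<L. wave q b j (i * m + n0)) \<le> B"
  shows "discrepancy (int q) y z a (int b) r (int m) \<le> B + 1"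
proof -
  define y' where "y' = \<lceil>y\<rceil>"
  have y': "0 \<le> y'" "y \<le> of_int n \<longleftrightarrow> y' \<le> n" for n :: int
    using yz by (auto simp: y'_def ceiling_le_iff)
  have z': "of_int n < z \<longleftrightarrow> n < \<lceil>z\<rceil>" for n :: int by (simp add: less_ceiling_iff)
  define n0 where "n0 = y' + (r - y') mod int m"
  have md: "0 \<le> (r - y') mod int m" "(r - y') mod int m < int m" using m by auto
  have n0: "y' \<le> n0" "n0 < y' + int m" using md by (auto simp: n0_def)
  have n0r: "[n0 = r] (mod int m)"
    unfolding n0_def nat_int_cong_def by (simp add: mod_add_right_eq)
  define L where "L = nat \<lceil>(z - of_int n0) / real m\<rceil>"
  have mem: "i < L \<longleftrightarrow> of_int (n0 + int i * int m) < z" for i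
  proof -
    have "i < L \<longleftrightarrow> real i < (z - of_int n0) / real m"
      unfolding L_def zless_nat_eq_int_zless less_ceiling_iff by simp
    also have "\<dots> \<longleftrightarrow> of_int (n0 + int i * int m) < z" using m by (simp add: field_simps)
    finally show ?thesis .
  qed
  let ?h = "\<lambda>i. n0 + int i * int m"
  have set: "{n :: int. y \<le> of_int n \<and> of_int n < z \<and> [digit_sum (int q) n = a] (mod int b) \<and> [n = r] (mod int m)}
    = ?h ` {i\<in>{..<L}. [int (ds q (i * m + nat n0)) = a] (mod int b)}" (is "?S = ?T")
  proof (intro equalityI subsetI)
    fix n assume n: "n \<in> ?S"
    then have nn: "y' \<le> n" "[n = r] (mod int m)" using y' by auto
    then have "[n = n0] (mod int m)" using n0r cong_sym cong_trans by blast
    then have "int m dvd n - n0" by (simp add: cong_iff_dvd_diff)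
    then obtain c where c: "n - n0 = int m * c" by (rule dvdE)
    have "- 1 < c"
    proof (rule ccontr)
      assume "\<not> - 1 < c"
      then have "int m * c \<le> int m * (- 1)" by (intro mult_left_mono) auto
      then show False using c nn n0 by linarith
    qed
    then have ni: "n = ?h (nat c)" using c by (simp add: mult.commute)
    have "of_int n < z" using n by simp
    then have "real_of_int (?h (nat c)) < z" by (simp only: ni[symmetric])
    then have "nat c < L" by (simp only: mem)
    moreover have "digit_sum (int q) n = int (ds q (nat c * m + nat n0))"
      using digit_sum_int[OF q, of "nat c * m + nat n0"] n0 y' unfolding ni by (simp add: add.commute)
    ultimately have "nat c \<in> {i\<in>{..<L}. [int (ds q (i * m + nat n0)) = a] (mod int b)}" using n by simp
    then have "?h (nat c) \<in> ?T" by (rule imageI)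
    then show "n \<in> ?T" by (simp only: ni[symmetric])
  next
    fix n assume "n \<in> ?T"
    then obtain i where i: "n = ?h i" "i < L" "[int (ds q (i * m + nat n0)) = a] (mod int b)" by auto
    have "digit_sum (int q) n = int (ds q (i * m + nat n0))"
      using digit_sum_int[OF q, of "i * m + nat n0"] n0 y' unfolding i by (simp add: add.commute)
    moreover have "y' \<le> n" using n0 unfolding i by (simp add: add_increasing2)
    moreover have "[n = r] (mod int m)" using n0r unfolding i by (simp add: nat_int_cong_def)
    moreover have "of_int n < z" using mem i by blast
    ultimately show "n \<in> ?S" using i y' by auto
  qed
  have inj: "inj_on ?h A" for A using m by (auto simp: inj_on_def)
  have cnt: "count_N (int q) y z a (int b) r (int m) = card {i\<in>{..<L}. [int (ds q (i * m + nat n0)) = a] (mod int b)}"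
    unfolding count_N_def set by (rule card_image[OF inj])
  have ypos: "of_int y' < y + 1" "y \<le> of_int y'" unfolding y'_def by linarith+
  have m1: "1 \<le> real m" using m by simp
  have L: "\<bar>real L - (z - y) / real m\<bar> \<le> 1"
  proof -
    let ?v = "(z - of_int n0) / real m"
    have n0_hi: "of_int n0 \<le> y + real m"
    proof -
      have "of_int n0 \<le> real_of_int (y' + int m - 1)" using n0 by (simp only: of_int_le_iff)
      then show ?thesis using ypos by simp
    qed
    have n0_lo: "y \<le> of_int n0" using ypos n0 by linarith
    have v1: "?v \<le> (z - y) / real m" using n0_lo m1 by (intro divide_right_mono) auto
    have v2: "(z - y) / real m - 1 \<le> ?v"
    proof -
      have "(z - y) / real m - 1 = (z - (y + real m)) / real m" using m1 by (simp add: field_simps)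
      also have "\<dots> \<le> ?v" using n0_hi m1 by (intro divide_right_mono) auto
      finally show ?thesis .
    qed
    have "0 \<le> (z - y) / real m" using yz m1 by simp
    then have l1: "real L \<le> (z - y) / real m + 1"
      unfolding L_def using v1 by linarith
    have "?v \<le> real L" unfolding L_def by linarith
    then show ?thesis using l1 v2 by linarith
  qed
  have "(z - y) / real m \<le> x / real m" using yz m1 by (intro divide_right_mono) auto
  then have Lx: "real L \<le> x / real m + 1" using L by linarith
  have "\<bar>real (count_N (int q) y z a (int b) r (int m)) - real L / real b\<bar> \<le> B"
    unfolding cnt by (rule card_residue_class_digit_sum) (use b B0 B Lx in auto)
  moreover have "\<bar>real L / real b - (z - y) / (real b * real m)\<bar> \<le> 1"
  proof -
    have "real L / real b - (z - y) / (real b * real m) = (real L - (z - y) / real m) / real b"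
      using b m1 by (simp add: field_simps)
    also have "\<bar>\<dots>\<bar> \<le> 1 / real b" using L b by (simp add: abs_divide divide_right_mono)
    also have "\<dots> \<le> 1" using b by simp
    finally show ?thesis .
  qed
  ultimately show ?thesis unfolding discrepancy_def by simp
qed

lemma max_discrepancy_le:
  fixes q b m :: nat and a :: int and x B :: real
  assumes q: "2 \<le> q" and b: "2 \<le> b" and m: "1 \<le> m" and x: "0 < x" and B0: "0 \<le> B"
    and B: "\<And>j L n0. 0 < j \<Longrightarrow> j < b \<Longrightarrow> real L \<le> x / real m + 1 \<Longrightarrow>
      norm (\<Sum>i<L. wave q b j (i * m + n0)) \<le> B"
  shows "max_discrepancy (int q) a (int b) x (int m) \<le> B + 1"
  unfolding max_discrepancy_def
proof (rule cSUP_least)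
  show "{(y, z). 0 \<le> y \<and> y < z \<and> z - y \<le> x} \<noteq> {}"
  proof -
    have "(0, x) \<in> {(y, z). 0 \<le> y \<and> y < z \<and> z - y \<le> x}" using x by simp
    then show ?thesis by blast
  qed
  fix yz assume "yz \<in> {(y, z). 0 \<le> y \<and> y < z \<and> z - y \<le> x}"
  then obtain y z where yz: "yz = (y, z)" "0 \<le> y" "y < z" "z - y \<le> x" by auto
  show "(case yz of (y, z) \<Rightarrow> SUP r\<in>{0..}. discrepancy (int q) y z a (int b) r (int m)) \<le> B + 1"
    unfolding yz(1) prod.case
  proof (rule cSUP_least)
    show "{0::int..} \<noteq> {}" by auto
    show "discrepancy (int q) y z a (int b) r (int m) \<le> B + 1" for r
      by (rule discrepancy_le_progression[OF q b m yz(2-4) B0 B])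
  qed
qed

section \<open>Summation over the moduli\<close>

text \<open>The first \<open>b\<close> powers of \<open>z\<close> sum to 0 and start with 1, so some
  \<open>z ^ n\<close> has negative real part. Then \<open>|1 - z ^ n| \<ge> 1\<close>, while
  \<open>|1 - z ^ n| \<le> n * |1 - z|\<close>.\<close>

lemma norm_one_minus_root_of_unity_ge:
  fixes z :: complex
  assumes "z ^ b = 1" "z \<noteq> 1" "0 < b"
  shows "1 / real b \<le> norm (1 - z)"
proof -
  have nz: "norm z = 1"
    using assms(1,3) by (metis norm_one norm_power norm_ge_zero power_eq_1_iff less_irrefl)
  have "\<exists>n<b. Re (z ^ n) < 0"
  proof (rule ccontr)
    assume "\<not> ?thesis"
    then have nn: "0 \<le> Re (z ^ n)" if "n < b" for n using that by force
    have "(\<Sum>n<b. z ^ n) = 0" using assms(1,2) by (simp add: geometric_sum)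
    then have "(\<Sum>n<b. Re (z ^ n)) = 0" by (simp flip: Re_sum)
    moreover have "Re (z ^ 0) \<le> (\<Sum>n<b. Re (z ^ n))"
      by (rule member_le_sum[of 0 "{..<b}" "\<lambda>n. Re (z ^ n)"]) (use nn assms(3) in auto)
    ultimately show False by simp
  qed
  then obtain n where n: "n < b" "Re (z ^ n) < 0" by blast
  have "1 \<le> Re (1 - z ^ n)" using n by simp
  also have "\<dots> \<le> norm (1 ^ n - z ^ n)" using complex_Re_le_cmod[of "1 - z ^ n"] by simp
  also have "\<dots> \<le> real n * norm (1 - z)" by (rule norm_power_diff) (use nz in auto)
  also have "\<dots> \<le> real b * norm (1 - z)" using n by (intro mult_right_mono) auto
  finally show ?thesis using assms(3) by (simp add: divide_le_eq mult.commute)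
qed

text \<open>By the parallelogram law the squares of \<open>|1 + cis x|\<close> and
  \<open>|1 - cis x|\<close> add up to 4; with \<open>n = |1 + cis x|\<close>, the difference
  \<open>4 - n ^ 2\<close> is at most \<open>4 * (2 - n)\<close>.\<close>

lemma norm_one_plus_cis_le:
  assumes "1 / B \<le> norm (1 - cis x)" "0 < B"
  shows "norm (1 + cis x) \<le> 2 - 1 / (4 * B\<^sup>2)"
proof -
  let ?n = "norm (1 + cis x)"
  have cs: "(cos x)\<^sup>2 + (sin x)\<^sup>2 = 1" by simp
  have "?n\<^sup>2 + (norm (1 - cis x))\<^sup>2 = 4"
    unfolding cmod_power2 by (simp add: power2_sum power2_diff) (use cs in linarith)
  moreover have "(1 / B)\<^sup>2 \<le> (norm (1 - cis x))\<^sup>2" using assms by (intro power_mono) auto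
  ultimately have "(1 / B)\<^sup>2 \<le> (2 - ?n) * (2 + ?n)" by (simp add: power2_eq_square algebra_simps)
  also have "\<dots> \<le> (2 - ?n) * 4"
  proof (rule mult_left_mono)
    show "2 + ?n \<le> 4" using norm_triangle_ineq[of 1 "cis x"] by simp
    then show "0 \<le> 2 - ?n" by simp
  qed
  finally show ?thesis by (simp add: power_divide field_simps)
qed

section \<open>Constants common to all nontrivial characters modulo \<open>b\<close>\<close>

locale digit_params =
  fixes q b k l0 l :: nat
  assumes q2: "2 \<le> q" and b2: "2 \<le> b" and cop: "coprime b (q - 1)" and k2: "2 \<le> k"
    and l0: "k < q ^ l0" and l_def: "l = 2 * l0 + 2"
begin

text \<open>A lower bound for \<open>1 - \<rho>\<close> at every frequency
  \<open>2 * pi * j / b\<close>: the gap \<open>2 - \<gamma>\<close> is at least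
  \<open>1 / (4 * b ^ 2)\<close>.\<close>

definition c0 :: real where "c0 = 1 / (4 * (real b)\<^sup>2 * (real q ^ l) ^ (2 * k))"
definition \<rho>0 :: real where "\<rho>0 = 1 - c0"
definition \<sigma> :: real where "\<sigma> = root (2 ^ k) \<rho>0"
definition C1 :: real where "C1 = 2 * real k + 1 + 4 * real k * 2 ^ k"
text \<open>The width is \<open>w = W * u\<close>. \<open>W\<close> is so large that even the blocks
  used for small moduli, built with \<open>6 * q * u\<close> in place of \<open>u\<close>, fit into
  \<open>q ^ ((2 * W + 8) * u)\<close>.\<close>

definition W :: nat where "W = 400 * q"

lemma c0_bounds: "0 < c0" "c0 \<le> 1 / 2"
proof -
  have "1 \<le> (real b)\<^sup>2" using b2 by (intro one_le_power) simp
  moreover have "1 \<le> (real q ^ l) ^ (2 * k)" using q2 by (intro one_le_power) simp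
  ultimately have "4 * 1 * 1 \<le> 4 * (real b)\<^sup>2 * (real q ^ l) ^ (2 * k)" by (intro mult_mono) auto
  then show "0 < c0" "c0 \<le> 1 / 2" by (auto simp: c0_def field_simps)
qed

lemma \<rho>0_bounds: "1 / 2 \<le> \<rho>0" "\<rho>0 < 1"
  using c0_bounds by (auto simp: \<rho>0_def)

lemma \<sigma>_bounds: "\<rho>0 \<le> \<sigma>" "0 < \<sigma>" "\<sigma> < 1"
proof -
  have pos: "0 < (2::nat) ^ k" by simp
  have "\<rho>0 ^ (2 ^ k) \<le> \<rho>0 ^ 1" using \<rho>0_bounds by (intro power_decreasing) auto
  then have "root (2 ^ k) (\<rho>0 ^ (2 ^ k)) \<le> root (2 ^ k) \<rho>0" using pos by simp
  then show *: "\<rho>0 \<le> \<sigma>" using \<rho>0_bounds pos by (simp add: \<sigma>_def real_root_power_cancel)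
  then show "0 < \<sigma>" using \<rho>0_bounds by linarith
  show "\<sigma> < 1" using \<rho>0_bounds pos by (simp add: \<sigma>_def)
qed

lemma inverse_power_le_\<sigma>: "1 / 2 ^ (l * t) \<le> \<rho>0 ^ t" "1 / real q ^ (l * t) \<le> 1 / 2 ^ (l * t)" "\<rho>0 ^ t \<le> \<sigma> ^ t"
proof -
  have "1 / 2 ^ (l * t) \<le> 1 / (2::real) ^ t"
    using l_def by (intro divide_left_mono power_increasing) auto
  also have "\<dots> = (1 / 2) ^ t" by (simp add: power_one_over)
  also have "\<dots> \<le> \<rho>0 ^ t" using \<rho>0_bounds by (intro power_mono) auto
  finally show "1 / 2 ^ (l * t) \<le> \<rho>0 ^ t" .
  show "1 / real q ^ (l * t) \<le> 1 / 2 ^ (l * t)" using q2 by (intro divide_left_mono power_mono) auto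
  show "\<rho>0 ^ t \<le> \<sigma> ^ t" using \<rho>0_bounds \<sigma>_bounds by (intro power_mono) auto
qed

lemma inverse_q_power_le: "1 / real q ^ (l * t) \<le> \<sigma> ^ t" "1 / 2 ^ (l * t) \<le> \<sigma> ^ t"
  using inverse_power_le_\<sigma>[of t] by linarith+

lemma C1_ge: "1 \<le> C1"
  unfolding C1_def by (simp add: add_increasing)

lemma contraction_rate:
  assumes j: "0 < j" "j < b"
  shows "contraction q k l0 l"
    and "0 \<le> contraction.\<rho> q k l (2 * pi * real j / real b)"
    and "contraction.\<rho> q k l (2 * pi * real j / real b) \<le> \<rho>0"
proof -
  show C: "contraction q k l0 l" using q2 k2 l0 l_def by unfold_locales auto
  interpret contraction q k l0 l "2 * pi * real j / real b" by (rule C)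
  let ?x = "2 * pi * real j / real b * (real q - 1)"
  have nd: "\<not> b dvd j * (q - 1)"
  proof
    assume "b dvd j * (q - 1)"
    then have "b dvd j" using cop by (simp add: coprime_dvd_mult_left_iff)
    then show False using j by (auto dest: dvd_imp_le)
  qed
  have x: "?x = 2 * pi * real_of_int (int (j * (q - 1))) / real b" using q2 by (simp add: of_nat_diff)
  have b0: "0 < b" using b2 by simp
  have "1 / real b \<le> norm (1 - cis ?x)"
  proof (rule norm_one_minus_root_of_unity_ge[OF _ _ b0])
    have "real b * ?x = 2 * pi * real_of_int (int (j * (q - 1)))" unfolding x using b0 by simp
    then show "cis ?x ^ b = 1" unfolding Complex.DeMoivre by (simp only: cis_multiple_2pi Ints_of_int)
    show "cis ?x \<noteq> 1"
    proof
      assume 1: "cis ?x = 1"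
      have "(\<Sum>i<b. cis (2 * pi * real i * real_of_int (int (j * (q - 1))) / real b)) = 0"
        unfolding sum_roots_of_unity[OF b0] using nd by (simp only: of_nat_dvd_iff if_False)
      moreover have "cis (2 * pi * real i * real_of_int (int (j * (q - 1))) / real b) = 1" for i
      proof -
        have "cis (2 * pi * real i * real_of_int (int (j * (q - 1))) / real b) = cis ?x ^ i"
          unfolding Complex.DeMoivre x by (rule arg_cong[where f = cis]) simp
        then show ?thesis using 1 by simp
      qed
      ultimately show False using b0 by simp
    qed
  qed
  then have "\<gamma> \<le> 2 - 1 / (4 * (real b)\<^sup>2)" unfolding \<gamma>_def using b0 by (intro norm_one_plus_cis_le) auto
  then have "1 / (4 * (real b)\<^sup>2) / (real q ^ l) ^ (2 * k) \<le> (2 - \<gamma>) / (real q ^ l) ^ (2 * k)"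
    using q2 by (intro divide_right_mono) auto
  then show "\<rho> \<le> \<rho>0" by (simp add: \<rho>_def \<rho>0_def c0_def)
  have "(2 - \<gamma>) / (real q ^ l) ^ (2 * k) \<le> 1"
  proof -
    have "2 ^ 1 \<le> real q ^ (l * (2 * k))"
      using q2 k2 l_def by (intro order_trans[OF power_increasing power_mono]) auto
    then show ?thesis using \<gamma>_nonneg q2 by (simp add: power_mult divide_le_eq)
  qed
  then show "0 \<le> \<rho>" by (simp add: \<rho>_def)
qed

lemma block_bound:
  assumes u: "u = l * t" and u3: "3 \<le> u" and w: "20 * u \<le> w" and \<mu>: "5 * u \<le> \<mu>"
    and len: "\<mu> + 1 + 9 * u < 2 * w + (k - 2) * (w - 9 * u)"
    and m: "q ^ \<mu> \<le> m" "m < q ^ (\<mu> + 1)" and gd: "good q u w \<mu> m"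
    and N: "N = q ^ (2 * w + 6 * u)" and j: "0 < j" "j < b"
  shows "norm (\<Sum>n<N. wave q b j (n * m + r)) \<le> real N * (C1 * \<sigma> ^ t)"
proof -
  interpret contraction q k l0 l "2 * pi * real j / real b" by (rule contraction_rate[OF j])
  have \<rho>: "0 \<le> \<rho>" "\<rho> \<le> \<rho>0" using contraction_rate[OF j] by auto
  let ?A = "4 * real k * 2 ^ k"
  have N0: "0 < real N" using N q2 by simp
  have qu: "1 / real q ^ u \<le> \<rho>0 ^ t" "1 / real q ^ u \<le> \<sigma> ^ t"
    using inverse_power_le_\<sigma>[of t] u by auto
  have "\<rho> ^ t + ?A / real q ^ u \<le> \<rho>0 ^ t + ?A * \<rho>0 ^ t"
    using \<rho> mult_left_mono[OF qu(1), of ?A] by (intro add_mono power_mono) auto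
  also have "\<dots> = (1 + ?A) * \<rho>0 ^ t" by (simp add: algebra_simps)
  finally have "root (2 ^ k) (\<rho> ^ t + ?A / real q ^ u) \<le> root (2 ^ k) ((1 + ?A) * \<rho>0 ^ t)"
    by (intro real_root_le_mono) auto
  also have "\<dots> = root (2 ^ k) (1 + ?A) * \<sigma> ^ t"
    by (simp add: real_root_mult real_root_power \<sigma>_def)
  also have "\<dots> \<le> (1 + ?A) * \<sigma> ^ t"
  proof (rule mult_right_mono)
    have "(1 + ?A) ^ 1 \<le> (1 + ?A) ^ (2 ^ k)" by (intro power_increasing) auto
    then have "root (2 ^ k) (1 + ?A) \<le> root (2 ^ k) ((1 + ?A) ^ (2 ^ k))" by (intro real_root_le_mono) auto
    then show "root (2 ^ k) (1 + ?A) \<le> 1 + ?A" by (simp add: real_root_power_cancel)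
  qed (use \<sigma>_bounds in simp)
  finally have "2 * real k / real q ^ u + root (2 ^ k) (\<rho> ^ t + ?A / real q ^ u) \<le> 2 * real k * \<sigma> ^ t + (1 + ?A) * \<sigma> ^ t"
    using mult_left_mono[OF qu(2), of "2 * real k"] by (intro add_mono) auto
  also have "\<dots> = C1 * \<sigma> ^ t" by (simp add: C1_def algebra_simps)
  finally have "norm (mean {..<N} (\<lambda>n. wave q b j (n * m + r))) \<le> C1 * \<sigma> ^ t"
    unfolding wave_def using block_estimate[OF k2 u u3 w \<mu> len m gd N, of r] by linarith
  then show ?thesis using N0 by (simp add: mean_def norm_divide divide_le_eq mult.commute)
qed

lemma max_discrepancy_from_sums:
  assumes m: "1 \<le> m" and x: "real m \<le> x" and R: "1 \<le> R" "R \<le> x / real m * \<sigma> ^ t"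
    and S: "\<And>j L n0. 0 < j \<Longrightarrow> j < b \<Longrightarrow>
      norm (\<Sum>i<L. wave q b j (i * m + n0)) \<le> real L * (C1 * \<sigma> ^ t) + R"
  shows "max_discrepancy (int q) a (int b) x (int m) \<le> (2 * C1 + 2) * (x / real m) * \<sigma> ^ t"
proof -
  have xm1: "1 \<le> x / real m" using x m by (simp add: le_divide_eq)
  have \<beta>0: "0 \<le> C1 * \<sigma> ^ t" using C1_ge \<sigma>_bounds by simp
  have "max_discrepancy (int q) a (int b) x (int m) \<le> (2 * (x / real m) * (C1 * \<sigma> ^ t) + R) + 1"
  proof (rule max_discrepancy_le[OF q2 b2 m])
    show "0 < x" using x m by linarith
    show "0 \<le> 2 * (x / real m) * (C1 * \<sigma> ^ t) + R"
      using mult_nonneg_nonneg[OF _ \<beta>0, of "2 * (x / real m)"] xm1 R by linarith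
    fix j L n0 assume j: "0 < j" "j < b" and L: "real L \<le> x / real m + 1"
    have "real L * (C1 * \<sigma> ^ t) \<le> 2 * (x / real m) * (C1 * \<sigma> ^ t)"
      using L xm1 \<beta>0 by (intro mult_right_mono) auto
    then show "norm (\<Sum>i<L. wave q b j (i * m + n0)) \<le> 2 * (x / real m) * (C1 * \<sigma> ^ t) + R"
      using S[OF j, of n0 L] by linarith
  qed
  also have "\<dots> \<le> 2 * (x / real m) * (C1 * \<sigma> ^ t) + 2 * (x / real m * \<sigma> ^ t)" using R by linarith
  also have "\<dots> = (2 * C1 + 2) * (x / real m) * \<sigma> ^ t"
  proof -
    have *: "2 * z * (c * s) + 2 * (z * s) = (2 * c + 2) * z * s" for z c s :: real
      by (simp add: algebra_simps)
    show ?thesis by (rule *)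
  qed
  finally show ?thesis .
qed

text \<open>\<open>N\<close> is smaller than \<open>q ^ ((2 * W + 8) * u) \<le> x / m\<close> by the
  factor \<open>q ^ (2 * u)\<close>, which pays for a leftover block. The upper bound on
  \<open>x\<close> makes \<open>k - 2\<close> Dirichlet steps suffice.\<close>

lemma max_discrepancy_large:
  assumes u: "u = l * t" and u3: "3 \<le> u" and \<mu>: "5 * u \<le> \<mu>"
    and x: "real q ^ ((2 * W + 8) * u) * real m \<le> x" "x \<le> real q ^ ((k - 2) * (W - 9) * u)"
    and m: "q ^ \<mu> \<le> m" "m < q ^ (\<mu> + 1)" and gd: "good q u (W * u) \<mu> m"
  shows "max_discrepancy (int q) a (int b) x (int m) \<le> (2 * C1 + 2) * (x / real m) * \<sigma> ^ t"
proof -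
  define N where "N = q ^ (2 * (W * u) + 6 * u)"
  have q1: "1 \<le> real q" using q2 by simp
  have "0 < q ^ \<mu>" using q2 by simp
  then have m1: "1 \<le> m" using m by linarith
  have len: "\<mu> + 1 + 9 * u < 2 * (W * u) + (k - 2) * (W * u - 9 * u)"
  proof -
    have "real q ^ \<mu> \<le> real m" using m(1) by (simp flip: of_nat_power)
    also have "\<dots> \<le> real q ^ ((2 * W + 8) * u) * real m"
      using q1 by (simp add: mult_le_cancel_right1 one_le_power)
    also have "\<dots> \<le> real q ^ ((k - 2) * (W - 9) * u)" using x by linarith
    finally have "\<mu> \<le> (k - 2) * (W - 9) * u"
      using q2 by (simp add: power_le_imp_le_exp)
    also have "\<dots> = (k - 2) * (W * u - 9 * u)" by (simp add: diff_mult_distrib mult.assoc)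
    finally have "\<mu> \<le> (k - 2) * (W * u - 9 * u)" .
    moreover have "1 + 9 * u < 2 * (W * u)"
    proof -
      have "800 \<le> W" using q2 by (simp add: W_def)
      then have "800 * u \<le> W * u" by (rule mult_le_mono1)
      then show ?thesis using u3 by linarith
    qed
    ultimately show ?thesis by linarith
  qed
  have w: "20 * u \<le> W * u" using q2 by (simp add: W_def)
  have N0: "0 < N" using q2 by (simp add: N_def)
  have \<beta>0: "0 \<le> C1 * \<sigma> ^ t" using C1_ge \<sigma>_bounds by simp
  have xm: "real q ^ ((2 * W + 8) * u) \<le> x / real m" using x(1) m1 by (simp add: le_divide_eq)
  have xm1: "1 \<le> x / real m" using xm q1 by (meson one_le_power order_trans)
  have N_le: "real N \<le> x / real m * \<sigma> ^ t"
  proof -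
    have "real N * real q ^ (2 * u) = real q ^ ((2 * W + 8) * u)"
      by (simp add: N_def algebra_simps flip: power_add)
    then have "real N = real q ^ ((2 * W + 8) * u) * (1 / real q ^ (2 * u))" using q2 by (simp add: field_simps)
    also have "\<dots> \<le> x / real m * (1 / real q ^ u)"
      using xm xm1 q1 by (intro mult_mono divide_left_mono power_increasing) auto
    also have "\<dots> \<le> x / real m * \<sigma> ^ t"
      using xm1 inverse_q_power_le[of t] u by (intro mult_left_mono) auto
    finally show ?thesis .
  qed
  show ?thesis
  proof (rule max_discrepancy_from_sums[OF m1 _ _ N_le])
    show "real m \<le> x" using xm1 m1 by (simp add: le_divide_eq)
    show "1 \<le> real N" using N0 by simp
    show "norm (\<Sum>i<L. wave q b j (i * m + n0)) \<le> real L * (C1 * \<sigma> ^ t) + real N"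
      if "0 < j" "j < b" for j L n0
      by (rule norm_progression_sum_le[OF _ N0 \<beta>0])
         (simp, rule block_bound[OF u u3 w \<mu> len m gd N_def that])
  qed
qed

lemma max_discrepancy_trivial:
  assumes m1: "1 \<le> m" and x: "real m \<le> x"
  shows "max_discrepancy (int q) a (int b) x (int m) \<le> 3 * x / real m"
proof -
  have xm1: "1 \<le> x / real m" using x m1 by (simp add: le_divide_eq)
  have "max_discrepancy (int q) a (int b) x (int m) \<le> (x / real m + 1) + 1"
  proof (rule max_discrepancy_le[OF q2 b2 m1])
    show "0 < x" using x m1 by linarith
    show "0 \<le> x / real m + 1" using xm1 by simp
    fix j L n0 assume L: "real L \<le> x / real m + 1"
    have "norm (\<Sum>i<L. wave q b j (i * m + n0)) \<le> (\<Sum>i<L. 1)"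
      by (rule sum_norm_le) simp
    then show "norm (\<Sum>i<L. wave q b j (i * m + n0)) \<le> x / real m + 1"
      using L by simp
  qed
  also have "\<dots> \<le> 3 * x / real m" using xm1 by simp
  finally show ?thesis .
qed

text \<open>A small modulus need not be good, but it has a good multiple of moderate size, because its
  multiples there outnumber the bad integers; a progression of difference \<open>m\<close> splits into \<open>e\<close>
  progressions of difference \<open>m * e\<close>.\<close>

lemma good_multiple:
  assumes u: "1 \<le> u" and m: "1 \<le> m" "m < q ^ (5 * u)"
    and big: "10 * (real q)\<^sup>2 * (84 * real q * real u + 2) + 2 < real q ^ u"
  obtains e where "q ^ (30 * q * u) \<le> m * e" "m * e < q ^ (30 * q * u + 1)"
    "good q (6 * q * u) (120 * q * u) (30 * q * u) (m * e)"
proof -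
  \<comment> \<open>\<open>q \<le> 2 ^ q\<close> gives \<open>q ^ (6 * u) \<le> 2 ^ v\<close>, so
    bad integers have proportion about \<open>q ^ (- 6 * u)\<close>, whereas multiples of
    \<open>m\<close> have density above \<open>q ^ (- 5 * u)\<close>. Then
    \<open>\<mu> = 5 * v\<close> and \<open>w = 20 * v\<close> meet the size conditions of
    \<open>block_bound\<close> with equality.\<close>
  define v where "v = 6 * q * u"
  define \<mu> where "\<mu> = 30 * q * u"
  define w where "w = 120 * q * u"
  let ?B = "{M\<in>{q ^ \<mu>..<q ^ (\<mu> + 1)}. \<not> good q v w \<mu> M}"
  define lo where "lo = q ^ \<mu> div m + 1"
  define hi where "hi = 2 * q ^ \<mu> div m"
  have q1: "1 \<le> real q" using q2 by simp
  have range: "q ^ \<mu> \<le> m * e \<and> m * e < q ^ (\<mu> + 1)" if "e \<in> {lo..<hi}" for e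
  proof
    have "q ^ \<mu> < m * lo" unfolding lo_def using m(1) by (simp add: dividend_less_times_div)
    also have "\<dots> \<le> m * e" using that by simp
    finally show "q ^ \<mu> \<le> m * e" by simp
    have "m * e < m * hi" using that m by simp
    also have "\<dots> \<le> 2 * q ^ \<mu>" unfolding hi_def by simp
    also have "\<dots> \<le> q ^ (\<mu> + 1)" using q2 by simp
    finally show "m * e < q ^ (\<mu> + 1)" .
  qed
  have "real (card ?B) \<le> 10 * (real q)\<^sup>2 * real (\<mu> + 9 * v + 2) * real q ^ \<mu> / 2 ^ v"
    by (rule card_not_good_le[OF q2]) (use u q2 in \<open>auto simp: v_def w_def\<close>)
  also have "\<dots> \<le> 10 * (real q)\<^sup>2 * real (\<mu> + 9 * v + 2) * real q ^ \<mu> / real q ^ (6 * u)"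
  proof (rule divide_left_mono)
    have "q \<le> 2 ^ q" by (simp add: less_imp_le)
    then have "q ^ (6 * u) \<le> (2 ^ q) ^ (6 * u)" by (rule power_mono) simp
    also have "((2::nat) ^ q) ^ (6 * u) = 2 ^ v" unfolding v_def by (simp add: mult_ac flip: power_mult)
    finally have "q ^ (6 * u) \<le> 2 ^ v" by simp
    then have "real (q ^ (6 * u)) \<le> real (2 ^ v)" by (simp only: of_nat_le_iff)
    then show "real q ^ (6 * u) \<le> 2 ^ v" by simp
  qed (use q2 in auto)
  also have "real (\<mu> + 9 * v + 2) = 84 * real q * real u + 2" by (simp add: \<mu>_def v_def)
  finally have B: "real (card ?B) \<le> 10 * (real q)\<^sup>2 * (84 * real q * real u + 2) * (real q ^ \<mu> / real q ^ (6 * u))"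
    by simp
  have "real (card ?B) < real (card {lo..<hi})"
  proof -
    let ?Y = "real q ^ \<mu> / real q ^ (6 * u)"
    have Y1: "1 \<le> ?Y" using u q2 by (simp add: le_divide_eq \<mu>_def power_increasing)
    have Yu: "?Y * real q ^ u = real q ^ \<mu> / real q ^ (5 * u)"
    proof -
      have "real q ^ (6 * u) = real q ^ (5 * u) * real q ^ u" by (simp flip: power_add)
      then show ?thesis using q2 by simp
    qed
    have "real (card ?B) + 3 \<le> (10 * (real q)\<^sup>2 * (84 * real q * real u + 2) + 2) * ?Y + 1"
      using B Y1 by (simp add: algebra_simps)
    also have "\<dots> < real q ^ u * ?Y + 1" using big Y1 by (intro add_strict_right_mono mult_strict_right_mono) auto
    also have "\<dots> = real q ^ \<mu> / real q ^ (5 * u) + 1" using Yu by (simp add: mult.commute)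
    also have "real q ^ \<mu> / real q ^ (5 * u) \<le> real q ^ \<mu> / real m"
    proof (rule divide_left_mono)
      have "real m \<le> real (q ^ (5 * u))" using m by (simp only: of_nat_le_iff)
      then show "real m \<le> real q ^ (5 * u)" by simp
    qed (use m q2 in auto)
    also have "real q ^ \<mu> / real m + 1 \<le> real (hi - lo) + 3"
    proof -
      have "hi * m + m > 2 * q ^ \<mu>" unfolding hi_def using m(1)
        by (metis dividend_less_div_times mult.commute Suc_le_eq One_nat_def add.commute)
      then have "real (2 * q ^ \<mu>) \<le> real (hi * m + m)" by (simp only: of_nat_le_iff)
      then have h: "2 * real q ^ \<mu> / real m \<le> real hi + 1" using m(1) by (simp add: divide_le_eq algebra_simps)
      have "(lo - 1) * m \<le> q ^ \<mu>" unfolding lo_def by simp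
      then have "real ((lo - 1) * m) \<le> real (q ^ \<mu>)" by (simp only: of_nat_le_iff)
      then have "real lo - 1 \<le> real q ^ \<mu> / real m" using m(1) by (simp add: le_divide_eq lo_def)
      then show ?thesis using h by simp
    qed
    finally show ?thesis by simp
  qed
  moreover have "card ((\<lambda>e. m * e) ` {lo..<hi}) = card {lo..<hi}"
    using m by (intro card_image) (auto simp: inj_on_def)
  ultimately have "card ?B < card ((\<lambda>e. m * e) ` {lo..<hi})" by simp
  then have "\<not> (\<lambda>e. m * e) ` {lo..<hi} \<subseteq> ?B" using card_mono[of ?B "(\<lambda>e. m * e) ` {lo..<hi}"] by auto
  then obtain e where e': "e \<in> {lo..<hi}" "m * e \<notin> ?B" by blast
  have e: "q ^ \<mu> \<le> m * e" "m * e < q ^ (\<mu> + 1)" using range[OF e'(1)] by blast+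
  then have "m * e \<in> {q ^ \<mu>..<q ^ (\<mu> + 1)}" by simp
  with e'(2) have "good q v w \<mu> (m * e)" by blast
  note e = e this
  show ?thesis by (rule that[of e]) (use e in \<open>simp_all only: v_def \<mu>_def w_def\<close>)
qed

end

section \<open>All moduli together\<close>

lemma sum_UN_le_sum:
  fixes g :: "'a \<Rightarrow> real"
  assumes "finite I" "\<And>i. i \<in> I \<Longrightarrow> finite (A i)" "\<And>x. 0 \<le> g x"
  shows "sum g (\<Union>i\<in>I. A i) \<le> (\<Sum>i\<in>I. sum g (A i))"
  using assms(1,2)
proof (induction I rule: finite_induct)
  case (insert i I)
  have "sum g (A i \<union> (\<Union>i\<in>I. A i)) \<le> sum g (A i) + sum g (\<Union>i\<in>I. A i)"
    using insert sum.union_inter[of "A i" "\<Union>i\<in>I. A i" g] sum_nonneg[of "A i \<inter> (\<Union>i\<in>I. A i)" g] assms(3)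
    by simp
  then show ?case using insert by simp
qed simp

lemma mem_range_floor:
  fixes X :: real
  assumes "1 \<le> X"
  shows "m \<in> {1..nat \<lfloor>X\<rfloor>} \<longleftrightarrow> 1 \<le> m \<and> real m \<le> X"
  using assms by (auto simp: le_nat_iff le_floor_iff)

lemma total_discrepancy_nat:
  "total_discrepancy \<epsilon> Q a B x = (\<Sum>m\<in>{1..nat \<lfloor>x powr (1 - \<epsilon>)\<rfloor>}. max_discrepancy Q a B x (int m))"
proof -
  have "{m::int. 1 \<le> m \<and> of_int m \<le> x powr (1 - \<epsilon>)} = int ` {1..nat \<lfloor>x powr (1 - \<epsilon>)\<rfloor>}"
  proof (intro equalityI subsetI)
    fix m :: int assume "m \<in> {m. 1 \<le> m \<and> of_int m \<le> x powr (1 - \<epsilon>)}"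
    then have m: "1 \<le> m" "m \<le> \<lfloor>x powr (1 - \<epsilon>)\<rfloor>" by (auto simp: le_floor_iff)
    then show "m \<in> int ` {1..nat \<lfloor>x powr (1 - \<epsilon>)\<rfloor>}"
      by (intro image_eqI[of _ _ "nat m"]) (auto simp: nat_mono)
  next
    fix m :: int assume "m \<in> int ` {1..nat \<lfloor>x powr (1 - \<epsilon>)\<rfloor>}"
    then obtain i where i: "m = int i" "1 \<le> i" "i \<le> nat \<lfloor>x powr (1 - \<epsilon>)\<rfloor>" by auto
    then have "int i \<le> \<lfloor>x powr (1 - \<epsilon>)\<rfloor>" by linarith
    then show "m \<in> {m. 1 \<le> m \<and> of_int m \<le> x powr (1 - \<epsilon>)}" using i by (simp add: le_floor_iff)
  qed
  then show ?thesis unfolding total_discrepancy_def by (simp add: sum.reindex)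
qed

context digit_params
begin

text \<open>The block estimate is applied to a good multiple \<open>m * e\<close>, with
  \<open>v = 6 * q * u\<close> and \<open>6 * q * t\<close> in the roles of \<open>u\<close> and
  \<open>t\<close>. The price \<open>e * (N + 1)\<close> of passing to the multiple is smaller than
  \<open>x / m\<close> by a factor \<open>q ^ u\<close>, thanks to the size of
  \<open>W\<close>.\<close>

lemma max_discrepancy_small:
  assumes u: "u = l * t" and u3: "3 \<le> u"
    and x: "real q ^ ((2 * W + 8) * u) * real m \<le> x"
    and m: "1 \<le> m" "m < q ^ (5 * u)"
    and big: "10 * (real q)\<^sup>2 * (84 * real q * real u + 2) + 2 < real q ^ u"
  shows "max_discrepancy (int q) a (int b) x (int m) \<le> (2 * C1 + 2) * (x / real m) * \<sigma> ^ t"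
proof -
  define v where "v = 6 * q * u"
  define w where "w = 120 * q * u"
  define \<mu> where "\<mu> = 30 * q * u"
  define N where "N = q ^ (2 * w + 6 * v)"
  obtain e where e: "q ^ \<mu> \<le> m * e" "m * e < q ^ (\<mu> + 1)" "good q v w \<mu> (m * e)"
    using good_multiple[OF _ m big] u3 unfolding v_def w_def \<mu>_def by auto
  have q1: "1 \<le> real q" using q2 by simp
  have vl: "v = l * (6 * q * t)" by (simp add: v_def u mult_ac)
  have qu: "2 * u \<le> q * u" using q2 by (rule mult_le_mono1)
  have v3: "3 \<le> v" "20 * v \<le> w" "5 * v \<le> \<mu>" "u \<le> v" using u3 qu by (simp_all add: v_def w_def \<mu>_def)
  \<comment> \<open>At this low position already \<open>\<mu> + 1 + 9 * v < 2 * w\<close>, so all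
    Dirichlet steps are idle.\<close>
  have len: "\<mu> + 1 + 9 * v < 2 * w + (k - 2) * (w - 9 * v)"
  proof -
    define z where "z = q * u"
    have "v = 6 * z" "w = 120 * z" "\<mu> = 30 * z" "2 * u \<le> z"
      using qu by (simp_all add: v_def w_def \<mu>_def z_def)
    then show ?thesis using u3 by linarith
  qed
  have "0 < q ^ \<mu>" using q2 by simp
  then have e0: "0 < e" using e(1) by (intro Nat.gr0I) auto
  have N0: "0 < N" using q2 by (simp add: N_def)
  have \<beta>0: "0 \<le> C1 * \<sigma> ^ (6 * q * t)" using C1_ge \<sigma>_bounds by simp
  have \<sigma>t: "\<sigma> ^ (6 * q * t) \<le> \<sigma> ^ t" using \<sigma>_bounds q2 by (intro power_decreasing) auto
  have xm: "real q ^ ((2 * W + 8) * u) \<le> x / real m" using x m(1) by (simp add: le_divide_eq)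
  have xm1: "1 \<le> x / real m" using xm q1 by (meson one_le_power order_trans)
  have rest: "real e * (real N + 1) \<le> x / real m * \<sigma> ^ t"
  proof -
    have "e * 1 \<le> m * e" using m by simp
    then have "e \<le> q ^ (\<mu> + 1)" using e(2) by linarith
    moreover have "N + 1 \<le> q * N" using N0 q2 mult_le_mono1[OF q2, of N] by linarith
    ultimately have "e * (N + 1) \<le> q ^ (\<mu> + 1) * (q * N)" by (rule mult_le_mono)
    also have "\<dots> = q ^ ((\<mu> + 1) + 1 + (2 * w + 6 * v))" by (simp add: N_def power_add)
    also have "\<dots> * q ^ u \<le> q ^ ((2 * W + 8) * u)"
    proof -
      have "(\<mu> + 1) + 1 + (2 * w + 6 * v) + u \<le> (2 * W + 8) * u"
        using u3 qu by (simp add: \<mu>_def w_def v_def W_def algebra_simps)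
      then have "q ^ ((\<mu> + 1) + 1 + (2 * w + 6 * v) + u) \<le> q ^ ((2 * W + 8) * u)"
        using q2 by (intro power_increasing) auto
      then show ?thesis by (simp only: power_add)
    qed
    finally have "e * (N + 1) * q ^ u \<le> q ^ ((2 * W + 8) * u)" by simp
    then have "real (e * (N + 1) * q ^ u) \<le> real (q ^ ((2 * W + 8) * u))" by (simp only: of_nat_le_iff)
    moreover have "real (e * (N + 1) * q ^ u) = real e * (real N + 1) * real q ^ u"
      by (simp only: of_nat_mult of_nat_add of_nat_1 of_nat_power)
    ultimately have "real e * (real N + 1) * real q ^ u \<le> real q ^ ((2 * W + 8) * u)"
      by (simp only: of_nat_power)
    also note xm
    finally have "real e * (real N + 1) * real q ^ u \<le> x / real m" .
    then have "real e * (real N + 1) \<le> x / real m / real q ^ u"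
      using q2 by (subst pos_le_divide_eq) auto
    also have "\<dots> = x / real m * (1 / real q ^ u)" by simp
    also have "\<dots> \<le> x / real m * \<sigma> ^ t"
      using xm1 inverse_q_power_le[of t] u by (intro mult_left_mono) auto
    finally show ?thesis .
  qed
  show ?thesis
  proof (rule max_discrepancy_from_sums[OF m(1) _ _ rest])
    show "real m \<le> x" using xm1 m(1) by (simp add: le_divide_eq)
    have "1 * 1 \<le> real e * (real N + 1)" using e0 by (intro mult_mono) auto
    then show "1 \<le> real e * (real N + 1)" by simp
    fix j L n0 assume j: "0 < j" "j < b"
    have "norm (\<Sum>i<L. wave q b j (i * m + n0)) \<le> real L * (C1 * \<sigma> ^ (6 * q * t)) + real e * (real N + 1)"
      by (rule norm_progression_sum_coarse_le[OF _ N0 \<beta>0 e0])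
         (simp, rule block_bound[OF vl v3(1-3) len e N_def j])
    also have "real L * (C1 * \<sigma> ^ (6 * q * t)) \<le> real L * (C1 * \<sigma> ^ t)"
      using \<sigma>t C1_ge by (intro mult_left_mono) auto
    finally show "norm (\<Sum>i<L. wave q b j (i * m + n0)) \<le> real L * (C1 * \<sigma> ^ t) + real e * (real N + 1)"
      by simp
  qed
qed

lemma sum_inverse_le: "1 \<le> M \<Longrightarrow> (\<Sum>m\<in>{1..M}. 1 / real m) \<le> 1 + ln (real M)"
  using euler_mascheroni_sequence_decreasing[of 1 M]
  by (simp add: harm_def inverse_eq_divide)

definition bad :: "nat \<Rightarrow> nat \<Rightarrow> nat set" where
  "bad u \<mu> = {m\<in>{q ^ \<mu>..<q ^ (\<mu> + 1)}. \<not> good q u (W * u) \<mu> m}"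

text \<open>Moduli below \<open>q ^ (5 * u)\<close> and good moduli save
  \<open>\<sigma> ^ t\<close>; for the bad set \<open>U\<close> the trivial bound
  \<open>3 * x / m\<close> meets its small density. The harmonic sum, the number of ranges
  \<open>\<mu>\<close> and the factor in \<open>card_not_good_le\<close> account for the
  logarithms.\<close>

lemma total_discrepancy_le:
  assumes \<epsilon>: "0 < \<epsilon>" "\<epsilon> < 1" and u: "u = l * t" and u3: "3 \<le> u"
    and big: "10 * (real q)\<^sup>2 * (84 * real q * real u + 2) + 2 < real q ^ u"
    and x: "real q ^ ((2 * W + 8) * u) \<le> x powr \<epsilon>" "x \<le> real q ^ ((k - 2) * (W - 9) * u)" and x1: "1 \<le> x"
  shows "total_discrepancy \<epsilon> (int q) a (int b) x \<le> (2 * C1 + 2 + 240 * (real q)\<^sup>2) * x * (1 + ln x)\<^sup>2 * \<sigma> ^ t"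
proof -
  define f where "f m = max_discrepancy (int q) a (int b) x (int m)" for m
  define M where "M = nat \<lfloor>x powr (1 - \<epsilon>)\<rfloor>"
  \<comment> \<open>\<open>q ^ \<mu> \<le> x\<close> forces \<open>\<mu> * ln 2 \<le> ln x\<close>,
    and \<open>1 / 2 \<le> ln 2\<close>.\<close>
  define \<Lambda> where "\<Lambda> = nat \<lfloor>2 * ln x\<rfloor>"
  define U where "U = (\<Union>\<mu>\<in>{5 * u..\<Lambda>}. bad u \<mu>)"
  have q1: "1 \<le> real q" using q2 by simp
  have xe: "x powr (1 - \<epsilon>) * x powr \<epsilon> = x" using x1 by (simp flip: powr_add)
  have xp1: "1 \<le> x powr (1 - \<epsilon>)" using \<epsilon> x1 by (simp add: ge_one_powr_ge_zero)
  have mM: "real m \<le> x powr (1 - \<epsilon>)" if "m \<in> {1..M}" for m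
    using that xp1 by (simp add: M_def le_nat_iff le_floor_iff)
  have M1: "1 \<le> M" using xp1 by (simp add: M_def le_nat_iff le_floor_iff)
  have xm: "real q ^ ((2 * W + 8) * u) * real m \<le> x" if "m \<in> {1..M}" for m
  proof -
    have "real q ^ ((2 * W + 8) * u) * real m \<le> x powr \<epsilon> * x powr (1 - \<epsilon>)"
      using x(1) mM[OF that] by (intro mult_mono) auto
    then show ?thesis using xe by (simp add: mult.commute)
  qed
  have mx: "real m \<le> x" if "m \<in> {1..M}" for m
  proof -
    have "1 * real m \<le> real q ^ ((2 * W + 8) * u) * real m"
      using q1 by (intro mult_right_mono one_le_power) auto
    then show ?thesis using xm[OF that] by simp
  qed
  have lnx: "0 \<le> ln x" using x1 by simp
  have ln2: "1 / 2 \<le> ln (2::real)" using ln2_ge_two_thirds by simp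
  have lnq: "real n \<le> 2 * ln x" if "real q ^ n \<le> x" for n
  proof -
    have "2 ^ n \<le> real q ^ n" using q2 by (intro power_mono) auto
    then have "2 ^ n \<le> x" using that by linarith
    then have "ln (2 ^ n) \<le> ln x" using x1 by (subst ln_le_cancel_iff) auto
    then have "real n * ln 2 \<le> ln x" by (simp add: ln_realpow)
    moreover have "real n * (1 / 2) \<le> real n * ln 2" by (intro mult_left_mono ln2) simp
    ultimately show ?thesis by linarith
  qed
  have fin: "finite (bad u \<mu>)" for \<mu> by (simp add: bad_def)
  have C1n: "0 \<le> C1" using C1_ge by linarith
  have f_le: "f m \<le> (2 * C1 + 2) * (x / real m) * \<sigma> ^ t + (if m \<in> U then 3 * x / real m else 0)"
    if m: "m \<in> {1..M}" for m
  proof -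
    have n1: "0 \<le> (2 * C1 + 2) * (x / real m) * \<sigma> ^ t" using C1n \<sigma>_bounds x1 by simp
    have n2: "0 \<le> 3 * x / real m" using x1 by simp
    consider "m < q ^ (5 * u)" | "q ^ (5 * u) \<le> m" "m \<notin> U" | "m \<in> U" by linarith
    then show ?thesis
    proof cases
      case 1
      have "f m \<le> (2 * C1 + 2) * (x / real m) * \<sigma> ^ t"
        unfolding f_def using m 1 by (intro max_discrepancy_small[OF u u3 xm[OF m] _ _ big]) auto
      then show ?thesis using n2 by simp
    next
      case 2
      obtain \<mu> where \<mu>: "q ^ \<mu> \<le> m" "m < q ^ (\<mu> + 1)"
        using ex_power_ivl1[of q m] q2 m by auto
      have "q ^ (5 * u) < q ^ (\<mu> + 1)" using 2 \<mu> by linarith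
      from power_less_imp_less_exp[OF _ this] have \<mu>5: "5 * u \<le> \<mu>" using q2 by simp
      have "real (q ^ \<mu>) \<le> real m" using \<mu> by (simp only: of_nat_le_iff)
      then have "real q ^ \<mu> \<le> x" using mx[OF m] by (simp only: of_nat_power)
      then have "real \<mu> \<le> 2 * ln x" by (rule lnq)
      then have "\<mu> \<le> \<Lambda>" using lnx by (simp add: \<Lambda>_def le_nat_iff le_floor_iff)
      then have "good q u (W * u) \<mu> m" using 2 \<mu> \<mu>5 by (auto simp: U_def bad_def)
      then have "f m \<le> (2 * C1 + 2) * (x / real m) * \<sigma> ^ t"
        unfolding f_def using \<mu> \<mu>5 by (intro max_discrepancy_large[OF u u3 _ xm[OF m] x(2)]) auto
      then show ?thesis using n2 by simp
    next
      case 3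
      have "f m \<le> 3 * x / real m" unfolding f_def using m mx[OF m] by (intro max_discrepancy_trivial) auto
      then show ?thesis using 3 n1 by simp
    qed
  qed
  have U_sum: "(\<Sum>m\<in>U. 3 * x / real m) \<le> 240 * (real q)\<^sup>2 * x * (1 + ln x)\<^sup>2 * \<sigma> ^ t"
  proof -
    have "(\<Sum>m\<in>U. 3 * x / real m) \<le> (\<Sum>\<mu>\<in>{5 * u..\<Lambda>}. \<Sum>m\<in>bad u \<mu>. 3 * x / real m)"
      unfolding U_def by (rule sum_UN_le_sum) (use fin x1 in auto)
    also have "\<dots> \<le> (\<Sum>\<mu>\<in>{5 * u..\<Lambda>}. 120 * (real q)\<^sup>2 * x * (1 + ln x) * \<sigma> ^ t)"
    proof (rule sum_mono)
      fix \<mu> assume \<mu>: "\<mu> \<in> {5 * u..\<Lambda>}"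
      have "(\<Sum>m\<in>bad u \<mu>. 3 * x / real m) \<le> (\<Sum>m\<in>bad u \<mu>. 3 * x / real q ^ \<mu>)"
      proof (rule sum_mono)
        fix m assume "m \<in> bad u \<mu>"
        then have "q ^ \<mu> \<le> m" by (simp add: bad_def)
        then have "real (q ^ \<mu>) \<le> real m" by (simp only: of_nat_le_iff)
        then have a: "real q ^ \<mu> \<le> real m" by (simp only: of_nat_power)
        moreover have p: "0 < real q ^ \<mu>" using q2 by simp
        ultimately have "0 < real m" by linarith
        with a p show "3 * x / real m \<le> 3 * x / real q ^ \<mu>"
          using x1 by (intro divide_left_mono mult_pos_pos) auto
      qed
      also have "\<dots> = real (card (bad u \<mu>)) * (3 * x / real q ^ \<mu>)" by simp
      also have "\<dots> \<le> 10 * (real q)\<^sup>2 * real (\<mu> + 9 * u + 2) * real q ^ \<mu> / 2 ^ u * (3 * x / real q ^ \<mu>)"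
        unfolding bad_def using x1 u3 q2 by (intro mult_right_mono card_not_good_le) (auto simp: W_def)
      also have "\<dots> = 30 * (real q)\<^sup>2 * x * real (\<mu> + 9 * u + 2) * (1 / 2 ^ u)"
        using q2 by (simp add: field_simps)
      also have "\<dots> \<le> 30 * (real q)\<^sup>2 * x * (4 * (1 + ln x)) * \<sigma> ^ t"
      proof (intro mult_mono)
        have "real \<mu> \<le> 2 * ln x" using \<mu> lnx by (simp add: \<Lambda>_def le_nat_iff le_floor_iff)
        moreover have "real (9 * u) \<le> 2 * ln x"
        proof (rule lnq)
          have "real q ^ (9 * u) \<le> real q ^ ((2 * W + 8) * u)"
            using q2 by (intro power_increasing) (auto simp: W_def)
          also have "\<dots> * 1 \<le> x" using xm[of 1] M1 by simp
          finally show "real q ^ (9 * u) \<le> x" by simp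
        qed
        ultimately show "real (\<mu> + 9 * u + 2) \<le> 4 * (1 + ln x)" by simp
        show "1 / 2 ^ u \<le> \<sigma> ^ t" using inverse_q_power_le u by simp
      qed (use x1 lnx in auto)
      also have "\<dots> = 120 * (real q)\<^sup>2 * x * (1 + ln x) * \<sigma> ^ t"
      proof -
        have *: "30 * c * x * (4 * y) * s = 120 * c * x * y * s" for c y s :: real by simp
        show ?thesis by (rule *)
      qed
      finally show "(\<Sum>m\<in>bad u \<mu>. 3 * x / real m) \<le> 120 * (real q)\<^sup>2 * x * (1 + ln x) * \<sigma> ^ t" .
    qed
    also have "\<dots> = real (card {5 * u..\<Lambda>}) * (120 * (real q)\<^sup>2 * x * (1 + ln x) * \<sigma> ^ t)" by simp
    also have "\<dots> \<le> (2 * (1 + ln x)) * (120 * (real q)\<^sup>2 * x * (1 + ln x) * \<sigma> ^ t)"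
    proof (rule mult_right_mono)
      have "real \<Lambda> \<le> 2 * ln x" using lnx by (simp add: \<Lambda>_def)
      then show "real (card {5 * u..\<Lambda>}) \<le> 2 * (1 + ln x)" using lnx by simp
    qed (use x1 lnx \<sigma>_bounds in auto)
    also have "\<dots> = 240 * (real q)\<^sup>2 * x * (1 + ln x)\<^sup>2 * \<sigma> ^ t"
    proof -
      have *: "(2 * y) * (120 * c * x * y * s) = 240 * c * x * y\<^sup>2 * s" for c y s :: real
        by (simp add: power2_eq_square)
      show ?thesis by (rule *)
    qed
    finally show ?thesis .
  qed
  have "total_discrepancy \<epsilon> (int q) a (int b) x = (\<Sum>m\<in>{1..M}. f m)"
    unfolding f_def M_def by (rule total_discrepancy_nat)
  also have "\<dots> \<le> (\<Sum>m\<in>{1..M}. (2 * C1 + 2) * (x / real m) * \<sigma> ^ t + (if m \<in> U then 3 * x / real m else 0))"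
    by (intro sum_mono f_le)
  also have "\<dots> = (2 * C1 + 2) * x * \<sigma> ^ t * (\<Sum>m\<in>{1..M}. 1 / real m) + (\<Sum>m\<in>{1..M} \<inter> U. 3 * x / real m)"
  proof -
    have "(\<Sum>m\<in>{1..M}. if m \<in> U then 3 * x / real m else 0) = (\<Sum>m\<in>{1..M} \<inter> U. 3 * x / real m)"
      by (rule sum.inter_restrict[symmetric]) simp
    then show ?thesis by (simp only: sum.distrib) (simp add: sum_distrib_left mult_ac)
  qed
  also have "(2 * C1 + 2) * x * \<sigma> ^ t * (\<Sum>m\<in>{1..M}. 1 / real m) \<le> (2 * C1 + 2) * x * \<sigma> ^ t * (1 + ln x)\<^sup>2"
  proof (rule mult_left_mono)
    have "(\<Sum>m\<in>{1..M}. 1 / real m) \<le> 1 + ln (real M)" by (rule sum_inverse_le[OF M1])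
    also have "ln (real M) \<le> ln x" using mx[of M] M1 by simp
    also have "1 + ln x \<le> (1 + ln x)\<^sup>2" using lnx by (simp add: self_le_power)
    finally show "(\<Sum>m\<in>{1..M}. 1 / real m) \<le> (1 + ln x)\<^sup>2" by simp
  qed (use C1n x1 \<sigma>_bounds in auto)
  also have "(\<Sum>m\<in>{1..M} \<inter> U. 3 * x / real m) \<le> (\<Sum>m\<in>U. 3 * x / real m)"
    by (rule sum_mono2) (use fin x1 in \<open>auto simp: U_def\<close>)
  also note U_sum
  finally show ?thesis by (simp add: algebra_simps)
qed

end

section \<open>Powers of x\<close>

text \<open>Trades the logarithms for a small power of \<open>x\<close>, for which the strict
  inequality \<open>\<eta> < \<eta>0 \<delta>\<close> later makes room.\<close>

lemma one_plus_ln_le_powr: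
  fixes x d :: real
  assumes "1 \<le> x" "0 < d"
  shows "(1 + ln x)\<^sup>2 \<le> (1 + 2 / d)\<^sup>2 * x powr d"
proof -
  have p: "1 \<le> x powr (d / 2)" using assms by (simp add: ge_one_powr_ge_zero)
  have "d / 2 * ln x \<le> x powr (d / 2) - 1"
    using ln_le_minus_one[of "x powr (d / 2)"] assms p by (simp add: ln_powr)
  then have "ln x \<le> 2 / d * x powr (d / 2)"
    using assms by (simp add: field_simps)
  then have "1 + ln x \<le> (1 + 2 / d) * x powr (d / 2)" using p by (simp add: algebra_simps)
  moreover have "0 \<le> 1 + ln x" using assms by (simp add: add_nonneg_nonneg)
  ultimately have "(1 + ln x)\<^sup>2 \<le> ((1 + 2 / d) * x powr (d / 2))\<^sup>2" by (intro power_mono)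
  also have "\<dots> = (1 + 2 / d)\<^sup>2 * x powr d"
    using assms by (simp add: power_mult_distrib power2_eq_square flip: powr_add)
  finally show ?thesis .
qed

context digit_params
begin

lemma total_discrepancy_trivial:
  assumes \<epsilon>: "0 < \<epsilon>" "\<epsilon> < 1" and x: "1 \<le> x"
  shows "total_discrepancy \<epsilon> (int q) a (int b) x \<le> 3 * x\<^sup>2"
proof -
  let ?M = "nat \<lfloor>x powr (1 - \<epsilon>)\<rfloor>"
  have xp: "1 \<le> x powr (1 - \<epsilon>)" using \<epsilon> x by (simp add: ge_one_powr_ge_zero)
  have "x powr (1 - \<epsilon>) \<le> x powr 1" using \<epsilon> x by (intro powr_mono) auto
  then have xx: "x powr (1 - \<epsilon>) \<le> x" using x by simp
  have "total_discrepancy \<epsilon> (int q) a (int b) x \<le> (\<Sum>m\<in>{1..?M}. 3 * x)"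
    unfolding total_discrepancy_nat
  proof (rule sum_mono)
    fix m assume "m \<in> {1..?M}"
    then have m: "1 \<le> m" "real m \<le> x" unfolding mem_range_floor[OF xp] using xx by auto
    have "max_discrepancy (int q) a (int b) x (int m) \<le> 3 * x / real m"
      by (rule max_discrepancy_trivial[OF m])
    also have "\<dots> \<le> 3 * x / 1" using m x by (intro divide_left_mono) auto
    finally show "max_discrepancy (int q) a (int b) x (int m) \<le> 3 * x" by simp
  qed
  also have "\<dots> = real ?M * (3 * x)" by simp
  also have "\<dots> \<le> x * (3 * x)"
  proof (rule mult_right_mono)
    have "real ?M \<le> x powr (1 - \<epsilon>)" using xp by simp
    then show "real ?M \<le> x" using xx by linarith
  qed (use x in simp)
  finally show ?thesis by (simp add: power2_eq_square)
qed

text \<open>With \<open>t\<close> about \<open>\<delta> * ln x / ((2 * W + 8) * l * ln q)\<close>,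
  the bound \<open>ln \<sigma> \<le> - c0 / 2 ^ k\<close> makes \<open>\<sigma> ^ t\<close> at most
  a constant times \<open>x powr (- \<eta>0 \<delta>)\<close>.\<close>

definition \<eta>0 :: "real \<Rightarrow> real" where
  "\<eta>0 \<delta> = c0 / 2 ^ k * \<delta> / (real ((2 * W + 8) * l) * ln (real q))"

text \<open>\<open>q ^ ((2 * W + 8) * u) \<le> x powr \<epsilon>\<close> bounds \<open>t\<close>
  from above and \<open>x \<le> q ^ ((k - 2) * (W - 9) * u)\<close> from below. Both can be met
  because \<open>(W - 9) / (2 * W + 8)\<close> is nearly 1/2 and \<open>k - 2\<close> is at least
  \<open>3 / \<delta>\<close>.\<close>

lemma total_discrepancy_powr:
  assumes \<delta>: "0 < \<delta>" "3 / \<delta> \<le> real (k - 2)" and \<epsilon>: "\<delta> \<le> \<epsilon>" "\<epsilon> < 1"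
    and \<eta>: "\<eta> < \<eta>0 \<delta>" "\<eta> \<le> 1"
  shows "\<exists>C>0. \<forall>a x. 0 < x \<longrightarrow> total_discrepancy \<epsilon> (int q) a (int b) x \<le> C * x powr (1 - \<eta>)"
proof -
  define G where "G = real ((2 * W + 8) * l)"
  define lq where "lq = ln (real q)"
  have lq: "0 < lq" using q2 by (simp add: lq_def)
  have W: "800 \<le> W" using q2 by (simp add: W_def)
  have l2: "2 \<le> l" by (simp add: l_def)
  have G: "0 < G" using l2 by (simp add: G_def)
  have \<epsilon>0: "0 < \<epsilon>" using \<delta> \<epsilon> by simp
  define A where "A = 840 * real q ^ 3 * real l"
  define Bc where "Bc = 20 * (real q)\<^sup>2 + 2"
  have A: "0 < A" using q2 l2 by (simp add: A_def)
  have "eventually (\<lambda>n::nat. A * real n + Bc < 2 ^ n) at_top" using A by real_asymp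
  then obtain n0 :: nat where n0: "\<And>n. n0 \<le> n \<Longrightarrow> A * real n + Bc < 2 ^ n"
    unfolding eventually_at_top_linorder by blast
  define Cj where "Cj = real (k - 2) * real (W - 9) * real l * lq"
  \<comment> \<open>From \<open>ln x \<ge> L0\<close> on, the loss \<open>Cj\<close> from rounding
    \<open>T\<close> down to \<open>t\<close> is at most \<open>ln x / 4\<close>, the surplus in the
    lower bound for \<open>t\<close>, and \<open>t\<close> is large enough for
    \<open>big\<close>.\<close>
  define L0 where "L0 = max (4 * Cj) ((real n0 + 4) * G * lq / \<delta>)"
  define C0 where "C0 = 2 * C1 + 2 + 240 * (real q)\<^sup>2"
  have C0: "0 < C0" using C1_ge by (simp add: C0_def add_pos_nonneg)
  define d where "d = \<eta>0 \<delta> - \<eta>"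
  have d: "0 < d" using \<eta> by (simp add: d_def)
  have main: "total_discrepancy \<epsilon> (int q) a (int b) x \<le> 3 * C0 * (1 + 2 / d)\<^sup>2 * x powr (1 - \<eta>)"
    if x1: "1 \<le> x" and xL: "L0 \<le> ln x" for a x
  proof -
    define T where "T = \<delta> * ln x / (G * lq)"
    define t where "t = nat \<lfloor>T\<rfloor>"
    define u where "u = l * t"
    have lnx: "0 \<le> ln x" using x1 by simp
    have "(real n0 + 4) * G * lq / \<delta> \<le> ln x" using xL by (simp add: L0_def)
    then have T0: "real n0 + 4 \<le> T" using \<delta> G lq by (simp add: T_def field_simps)
    have tT: "real t \<le> T" "T - 1 \<le> real t" "n0 + 3 \<le> t"
      using T0 unfolding t_def by linarith+
    have u3: "3 \<le> u" using tT(3) mult_le_mono[of 1 l 3 t] l2 by (simp add: u_def)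
    have big: "10 * (real q)\<^sup>2 * (84 * real q * real u + 2) + 2 < real q ^ u"
    proof -
      have "10 * (real q)\<^sup>2 * (84 * real q * real u + 2) + 2 = A * real t + Bc"
        by (simp add: A_def Bc_def u_def power2_eq_square power3_eq_cube algebra_simps)
      also have "\<dots> < 2 ^ t" using n0 tT(3) by simp
      also have "(2::real) ^ t \<le> 2 ^ u" using l2 by (intro power_increasing) (auto simp: u_def)
      also have "(2::real) ^ u \<le> real q ^ u" using q2 by (intro power_mono) auto
      finally show ?thesis .
    qed
    have lnq: "ln (real q ^ n) = real n * lq" for n using q2 by (simp add: ln_realpow lq_def)
    have x_hi: "real q ^ ((2 * W + 8) * u) \<le> x powr \<epsilon>"
    proof -
      have "real ((2 * W + 8) * u) * lq = G * lq * real t" by (simp add: G_def u_def)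
      also have "\<dots> \<le> G * lq * T" using G lq tT by (intro mult_left_mono) auto
      also have "\<dots> = \<delta> * ln x" using G lq by (simp add: T_def)
      also have "\<dots> \<le> \<epsilon> * ln x" using \<epsilon> lnx by (intro mult_right_mono) auto
      finally have "ln (real q ^ ((2 * W + 8) * u)) \<le> ln (x powr \<epsilon>)"
        using x1 by (simp only: lnq ln_powr)
      moreover have "0 < real q ^ ((2 * W + 8) * u)" "0 < x powr \<epsilon>" using q2 x1 by auto
      ultimately show ?thesis by (simp only: ln_le_cancel_iff)
    qed
    have x_lo: "x \<le> real q ^ ((k - 2) * (W - 9) * u)"
    proof -
      have "5 / 4 * real (2 * W + 8) \<le> 3 * real (W - 9)" using W by (simp add: of_nat_diff)
      then have "5 / 4 \<le> 3 * real (W - 9) / real (2 * W + 8)" by (simp add: le_divide_eq)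
      then have "5 / 4 * ln x \<le> 3 * real (W - 9) / real (2 * W + 8) * ln x" using lnx by (rule mult_right_mono)
      also have "\<dots> = 3 / \<delta> * (real (W - 9) * real l * lq * T)"
      proof -
        have "3 * w / v * y = 3 / e * (w * r * c * (e * y / (v * r * c)))"
          if "v \<noteq> 0" "r \<noteq> 0" "c \<noteq> 0" "e \<noteq> 0" for w v y e r c :: real
          using that by (simp add: field_simps)
        from this[of "real (2 * W + 8)" "real l" lq \<delta> "real (W - 9)" "ln x"]
        show ?thesis using \<delta> lq l2 unfolding T_def G_def of_nat_mult[of "2 * W + 8"] by simp
      qed
      also have "\<dots> \<le> real (k - 2) * (real (W - 9) * real l * lq * T)"
        using \<delta> lq T0 by (intro mult_right_mono) auto
      also have "\<dots> \<le> real (k - 2) * (real (W - 9) * real l * lq * (real t + 1))"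
        using lq tT by (intro mult_left_mono) auto
      also have "\<dots> = real ((k - 2) * (W - 9) * u) * lq + Cj"
      proof -
        have *: "a * (w * r * c * (n + 1)) = a * w * (r * n) * c + a * w * r * c" for a w r c n :: real
          by (simp add: algebra_simps)
        show ?thesis unfolding Cj_def u_def of_nat_mult by (rule *)
      qed
      finally have "5 / 4 * ln x \<le> real ((k - 2) * (W - 9) * u) * lq + Cj" .
      moreover have "4 * Cj \<le> ln x" using xL by (simp add: L0_def)
      ultimately have "ln x \<le> real ((k - 2) * (W - 9) * u) * lq" by linarith
      then have "ln x \<le> ln (real q ^ ((k - 2) * (W - 9) * u))" by (simp only: lnq)
      moreover have "0 < real q ^ ((k - 2) * (W - 9) * u)" "0 < x" using q2 x1 by auto
      ultimately show ?thesis by (simp only: ln_le_cancel_iff)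
    qed
    have "\<sigma> ^ t \<le> 3 * x powr (- \<eta>0 \<delta>)"
    proof -
      let ?r = "c0 / 2 ^ k"
      have r: "0 \<le> ?r" "?r \<le> 1"
      proof -
        have "c0 * 1 \<le> 1 * 2 ^ k" using c0_bounds by (intro mult_mono) auto
        then show "0 \<le> ?r" "?r \<le> 1" using c0_bounds by auto
      qed
      have "ln \<rho>0 \<le> - c0" using ln_le_minus_one[of \<rho>0] \<rho>0_bounds by (simp add: \<rho>0_def)
      then have "ln \<sigma> \<le> - ?r" using \<rho>0_bounds by (simp add: \<sigma>_def ln_root field_simps)
      then have "real t * ln \<sigma> \<le> real t * (- ?r)" by (intro mult_left_mono) auto
      also have "\<dots> \<le> (T - 1) * (- ?r)" using tT r by (intro mult_right_mono_neg) auto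
      also have "\<dots> = ?r + (- \<eta>0 \<delta>) * ln x"
        by (simp add: T_def \<eta>0_def G_def lq_def algebra_simps)
      finally have "exp (real t * ln \<sigma>) \<le> exp (?r + (- \<eta>0 \<delta>) * ln x)" by simp
      also have "\<dots> = exp ?r * x powr (- \<eta>0 \<delta>)" using x1 by (simp only: exp_add) (simp add: powr_def)
      also have "\<dots> \<le> 3 * x powr (- \<eta>0 \<delta>)"
      proof (rule mult_right_mono)
        have "exp ?r \<le> exp 1" using r by simp
        then show "exp ?r \<le> 3" using exp_le by linarith
      qed simp
      finally show ?thesis using \<sigma>_bounds by (simp add: exp_of_nat_mult)
    qed
    then have s: "(1 + ln x)\<^sup>2 * \<sigma> ^ t \<le> ((1 + 2 / d)\<^sup>2 * x powr d) * (3 * x powr (- \<eta>0 \<delta>))"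
      using one_plus_ln_le_powr[OF x1 d] \<sigma>_bounds by (intro mult_mono) auto
    have "total_discrepancy \<epsilon> (int q) a (int b) x \<le> C0 * x * (1 + ln x)\<^sup>2 * \<sigma> ^ t"
      unfolding C0_def by (rule total_discrepancy_le[OF \<epsilon>0 \<epsilon>(2) u_def u3 big x_hi x_lo x1])
    also have "\<dots> = C0 * x * ((1 + ln x)\<^sup>2 * \<sigma> ^ t)" by simp
    also have "\<dots> \<le> C0 * x * (((1 + 2 / d)\<^sup>2 * x powr d) * (3 * x powr (- \<eta>0 \<delta>)))"
      using C0 x1 by (intro mult_left_mono s) auto
    also have "\<dots> = 3 * C0 * (1 + 2 / d)\<^sup>2 * (x powr 1 * x powr d * x powr (- \<eta>0 \<delta>))"
      using x1 by simp
    also have "x powr 1 * x powr d * x powr (- \<eta>0 \<delta>) = x powr (1 - \<eta>)"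
      by (simp only: powr_add[symmetric]) (simp add: d_def)
    finally show ?thesis .
  qed
  \<comment> \<open>The second entry serves the bounded range \<open>1 \<le> x\<close>,
    \<open>ln x < L0\<close> with the trivial bound; there \<open>\<eta> \<le> 1\<close> gives
    \<open>1 \<le> x powr (1 - \<eta>)\<close>.\<close>
  define C where "C = max (3 * C0 * (1 + 2 / d)\<^sup>2) (3 * (exp L0)\<^sup>2)"
  have C: "0 < C" unfolding C_def by (simp add: less_max_iff_disj)
  have "total_discrepancy \<epsilon> (int q) a (int b) x \<le> C * x powr (1 - \<eta>)" if x: "0 < x" for a x
  proof -
    consider "x < 1" | "1 \<le> x" "L0 \<le> ln x" | "1 \<le> x" "ln x < L0" by linarith
    then show ?thesis
    proof cases
      case 1
      then have "x powr (1 - \<epsilon>) < 1" using x \<epsilon> powr_less_mono2[of "1 - \<epsilon>" x 1] by simp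
      then have "nat \<lfloor>x powr (1 - \<epsilon>)\<rfloor> = 0" by (simp add: floor_less_iff)
      then show ?thesis using C by (simp add: total_discrepancy_nat)
    next
      case 2
      have "total_discrepancy \<epsilon> (int q) a (int b) x \<le> 3 * C0 * (1 + 2 / d)\<^sup>2 * x powr (1 - \<eta>)"
        by (rule main[OF 2])
      also have "\<dots> \<le> C * x powr (1 - \<eta>)" by (intro mult_right_mono) (auto simp: C_def)
      finally show ?thesis .
    next
      case 3
      have "x = exp (ln x)" using x by simp
      also have "\<dots> \<le> exp L0" using 3 by (subst exp_le_cancel_iff) simp
      finally have "x \<le> exp L0" .
      then have "3 * x\<^sup>2 \<le> 3 * (exp L0)\<^sup>2" using x by (intro mult_left_mono power_mono) auto
      then have "total_discrepancy \<epsilon> (int q) a (int b) x \<le> C * 1"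
        using total_discrepancy_trivial[OF \<epsilon>0 \<epsilon>(2) 3(1), of a] by (simp add: C_def)
      also have "\<dots> \<le> C * x powr (1 - \<eta>)"
        using 3 \<eta> C by (intro mult_left_mono) (auto simp: ge_one_powr_ge_zero)
      finally show ?thesis .
    qed
  qed
  then show ?thesis using C by blast
qed

end

section \<open>Comparison of the exponents\<close>

text \<open>For \<open>y = 1 / \<delta>\<close> it turns \<open>k \<le> 4 * y\<close> into
  \<open>ln k \<le> y\<close>.\<close>

lemma four_mult_le_exp:
  fixes y :: real
  assumes "3 \<le> y"
  shows "4 * y \<le> exp y"
proof -
  have "3 * y \<le> y * y" using assms by (intro mult_right_mono) auto
  then have "1 + 7 / 8 * y \<le> 1 + y / 2 + (y / 2)\<^sup>2 / 2" by (simp add: power2_eq_square)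
  also have "\<dots> \<le> exp (y / 2)" using assms by (intro exp_lower_Taylor_quadratic) simp
  finally have "(1 + 7 / 8 * y)\<^sup>2 \<le> (exp (y / 2))\<^sup>2" using assms by (intro power_mono) auto
  also have "(exp (y / 2))\<^sup>2 = exp y" by (simp add: power2_eq_square flip: exp_add)
  finally have "1 + 7 / 4 * y + 49 / 64 * (y * y) \<le> exp y"
    by (simp add: power2_eq_square algebra_simps)
  then show ?thesis using \<open>3 * y \<le> y * y\<close> assms by linarith
qed

text \<open>\<open>\<delta> < 1 / 3\<close> absorbs the additive constants in \<open>k\<close> into
  \<open>4 / \<delta>\<close>. Taking \<open>l0\<close> least keeps the block length
  \<open>l\<close> logarithmic in \<open>k\<close>.\<close>

lemma obtain_digit_params:
  fixes q b :: nat and \<delta> :: real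
  assumes q: "2 \<le> q" and b: "2 \<le> b" and cop: "coprime b (q - 1)" and \<delta>: "0 < \<delta>" "\<delta> < 1 / 3"
  obtains k l0 l where "digit_params q b k l0 l" "3 / \<delta> \<le> real (k - 2)" "real k \<le> 4 / \<delta>"
    "q ^ l0 \<le> k * q"
proof -
  define k where "k = nat \<lceil>3 / \<delta>\<rceil> + 2"
  have d3: "3 < 1 / \<delta>" using \<delta> by (simp add: field_simps)
  then have d9: "9 < 3 / \<delta>" by simp
  have k1: "3 / \<delta> \<le> real (k - 2)" unfolding k_def using d9 by simp
  have "real k \<le> 3 / \<delta> + 3" unfolding k_def using d9 by simp linarith
  also have "\<dots> \<le> 4 / \<delta>" using d3 by simp
  finally have k2: "real k \<le> 4 / \<delta>" .
  define l0 where "l0 = (LEAST i. k < q ^ i)"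
  have "k < 2 ^ k" by simp
  also have "(2::nat) ^ k \<le> q ^ k" using q by (rule power_mono) simp
  finally have ex: "k < q ^ k" .
  have l0: "k < q ^ l0" unfolding l0_def by (rule LeastI[of _ k]) (rule ex)
  have "q ^ l0 \<le> k * q"
  proof (cases l0)
    case 0
    then show ?thesis using l0 by (simp add: k_def)
  next
    case (Suc i)
    have "\<not> k < q ^ i" using not_less_Least[of i "\<lambda>i. k < q ^ i"] Suc by (simp add: l0_def)
    then show ?thesis using Suc by (simp add: mult.commute)
  qed
  moreover have "digit_params q b k l0 (2 * l0 + 2)"
    using q b cop l0 by unfold_locales (auto simp: k_def)
  ultimately show ?thesis using that k1 k2 by blast
qed

context digit_params
begin

text \<open>In the logarithm of \<open>1 / \<eta>0 \<delta>\<close> the decisive term is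
  \<open>2 * k * l * ln q\<close>, from the number of digit choices in \<open>c0\<close>. As
  \<open>l * ln q \<le> 2 * ln k + 4 * ln q\<close>, it is at most
  \<open>16 * y ^ 2 + 32 * y * ln q\<close> with \<open>y = 1 / \<delta>\<close>. The constant 25 is
  the one that \<open>eta_exponent\<close> provides.\<close>

lemma \<eta>0_lower_bound:
  assumes \<delta>: "0 < \<delta>" "\<delta> < 1 / 3" and kd: "real k \<le> 4 / \<delta>" and ql0: "q ^ l0 \<le> k * q"
  shows "exp (- (25 * real b * ln (real q) / \<delta>\<^sup>2)) \<le> \<eta>0 \<delta>"
proof -
  define y where "y = 1 / \<delta>"
  define \<Lambda> where "\<Lambda> = ln (real q)"
  have y: "3 \<le> y" using \<delta> by (simp add: y_def field_simps)
  have ky: "real k \<le> 4 * y" using kd by (simp add: y_def)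
  have L: "2 / 3 \<le> \<Lambda>"
  proof -
    have "ln 2 \<le> \<Lambda>" unfolding \<Lambda>_def using q2 by simp
    then show ?thesis using ln2_ge_two_thirds by linarith
  qed
  have k0: "0 < real k" using k2 by simp
  have lnk: "ln (real k) \<le> y"
  proof -
    have "real k \<le> exp y" using ky four_mult_le_exp[OF y] by linarith
    then have "ln (real k) \<le> ln (exp y)" using k0 by (subst ln_le_cancel_iff) auto
    then show ?thesis by simp
  qed
  have lnk0: "0 \<le> ln (real k)" using k2 by simp
  define E where "E = real l * \<Lambda>"
  have E: "E \<le> 2 * ln (real k) + 4 * \<Lambda>"
  proof -
    have "real (q ^ l0) \<le> real (k * q)" using ql0 by (simp only: of_nat_le_iff)
    then have "real q ^ l0 \<le> real k * real q" by simp
    moreover have "0 < real q ^ l0" using q2 by simp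
    ultimately have "ln (real q ^ l0) \<le> ln (real k * real q)" using k0 q2 by (subst ln_le_cancel_iff) auto
    also have "\<dots> = ln (real k) + \<Lambda>" using k0 q2 by (simp add: ln_mult \<Lambda>_def)
    finally have "real l0 * \<Lambda> \<le> ln (real k) + \<Lambda>" using q2 by (simp add: ln_realpow \<Lambda>_def)
    then show ?thesis by (simp add: E_def l_def algebra_simps)
  qed
  have E0: "0 < E" unfolding E_def using L by (simp add: l_def)
  have lnb: "ln (4 * (real b)\<^sup>2) \<le> 2 * real b * \<Lambda>"
  proof -
    have "2 * b \<le> 2 ^ b"
    proof -
      have "b - 1 < 2 ^ (b - 1)" by simp
      then have "b \<le> 2 ^ (b - 1)" by linarith
      then have "2 * b \<le> 2 ^ Suc (b - 1)" by simp
      then show ?thesis using b2 by simp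
    qed
    also have "(2::nat) ^ b \<le> q ^ b" using q2 by (rule power_mono) simp
    finally have "real (2 * b) \<le> real (q ^ b)" by (simp only: of_nat_le_iff)
    then have "ln (real (2 * b)) \<le> ln (real q ^ b)" using b2 q2 by (subst ln_le_cancel_iff) auto
    also have "\<dots> = real b * \<Lambda>" using q2 by (simp add: ln_realpow \<Lambda>_def)
    finally have "2 * ln (real (2 * b)) \<le> 2 * real b * \<Lambda>" by simp
    moreover have "4 * (real b)\<^sup>2 = real (2 * b) ^ 2" by (simp add: power2_eq_square)
    moreover have "ln (real (2 * b) ^ 2) = 2 * ln (real (2 * b))" using b2 by (subst ln_realpow) auto
    ultimately show ?thesis by simp
  qed
  have ln2: "ln 2 \<le> \<Lambda>" unfolding \<Lambda>_def using q2 by simp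
  have lnW: "ln (real (2 * W + 8)) \<le> 11 * \<Lambda>"
  proof -
    have "(2::nat) ^ 10 \<le> q ^ 10" using q2 by (rule power_mono) simp
    then have "2 ^ 10 * q \<le> q ^ 10 * q" by (rule mult_le_mono1)
    also have "q ^ 10 * q = q ^ 11" using power_add[of q 10 1] by simp
    finally have "2 * W + 8 \<le> q ^ 11" unfolding W_def using q2 by simp
    then have "real (2 * W + 8) \<le> real (q ^ 11)" by (simp only: of_nat_le_iff)
    then have "ln (real (2 * W + 8)) \<le> ln (real q ^ 11)" using q2 by (subst ln_le_cancel_iff) auto
    then show ?thesis using q2 by (simp add: ln_realpow \<Lambda>_def)
  qed
  have lnE: "ln E \<le> E" using ln_le_minus_one[OF E0] by linarith
  have lny: "ln y \<le> y" using ln_le_minus_one[of y] y by linarith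
  have \<eta>: "\<eta>0 \<delta> = 1 / (4 * (real b)\<^sup>2 * (real q ^ l) ^ (2 * k) * 2 ^ k * real (2 * W + 8) * E * y)"
    by (simp add: \<eta>0_def c0_def y_def E_def flip: \<Lambda>_def)
  have pos: "0 < 4 * (real b)\<^sup>2" "0 < (real q ^ l) ^ (2 * k)" "0 < (2::real) ^ k" "0 < real (2 * W + 8)"
    "0 < E" "0 < y" using b2 q2 E0 y by auto
  let ?D = "4 * (real b)\<^sup>2 * (real q ^ l) ^ (2 * k) * 2 ^ k * real (2 * W + 8) * E * y"
  have "0 < a * b * c * d * e * f" if "0 < a" "0 < b" "0 < c" "0 < d" "0 < e" "0 < f"
    for a b c d e f :: real using that by simp
  from this[OF pos] have D: "0 < ?D" .
  have ln6: "ln (a * b * c * d * e * f) = ln a + ln b + ln c + ln d + ln e + ln f"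
    if "0 < a" "0 < b" "0 < c" "0 < d" "0 < e" "0 < f" for a b c d e f :: real
    using that by (simp add: ln_mult_pos)
  have "ln ?D = ln (4 * (real b)\<^sup>2) + ln ((real q ^ l) ^ (2 * k)) + ln (2 ^ k) + ln (real (2 * W + 8)) + ln E + ln y"
    by (rule ln6[OF pos])
  also have "ln ((real q ^ l) ^ (2 * k)) = 2 * real k * E" using q2 by (simp add: E_def \<Lambda>_def ln_realpow)
  also have "ln ((2::real) ^ k) = real k * ln 2" by (simp add: ln_realpow)
  finally have lnD: "ln ?D = ln (4 * (real b)\<^sup>2) + 2 * real k * E + real k * ln 2 + ln (real (2 * W + 8)) + ln E + ln y" .
  have kE: "2 * real k * E \<le> 16 * (y * y) + 32 * (y * \<Lambda>)"
  proof -
    have "2 * real k * E \<le> 2 * (4 * y) * (2 * y + 4 * \<Lambda>)"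
      using ky E lnk E0 y L by (intro mult_mono) auto
    also have "\<dots> = 16 * (y * y) + 32 * (y * \<Lambda>)" by (simp add: algebra_simps)
    finally show ?thesis .
  qed
  have k2': "real k * ln 2 \<le> 4 * (y * \<Lambda>)"
  proof -
    have "real k * ln 2 \<le> (4 * y) * \<Lambda>" using ky ln2 y by (intro mult_mono) auto
    then show ?thesis by simp
  qed
  have yyL: "y * y \<le> 3 / 2 * (y * y * \<Lambda>)"
  proof -
    have "y * y * (2 / 3) \<le> y * y * \<Lambda>" using L by (intro mult_left_mono) auto
    then show ?thesis by simp
  qed
  have yL: "3 * (y * \<Lambda>) \<le> y * y * \<Lambda>"
  proof -
    have "3 * (y * \<Lambda>) \<le> y * (y * \<Lambda>)" using y L by (intro mult_right_mono) auto
    then show ?thesis by simp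
  qed
  have LL: "9 * \<Lambda> \<le> y * y * \<Lambda>"
  proof -
    have "3 * 3 \<le> y * y" using y by (intro mult_mono) auto
    then have "9 * \<Lambda> \<le> y * y * \<Lambda>" using L by (intro mult_right_mono) auto
    then show ?thesis .
  qed
  have yy: "3 * y \<le> y * y" using y by (intro mult_right_mono) auto
  have bL: "2 * (y * y * \<Lambda>) \<le> real b * (y * y * \<Lambda>)" using b2 y L by (intro mult_right_mono) auto
  have bL': "9 * (real b * \<Lambda>) \<le> real b * (y * y * \<Lambda>)"
    using mult_left_mono[OF LL, of "real b"] by (simp add: mult_ac)
  have "ln ?D \<le> 2 * (real b * \<Lambda>) + (16 * (y * y) + 32 * (y * \<Lambda>)) + 4 * (y * \<Lambda>) + 11 * \<Lambda> + (2 * y + 4 * \<Lambda>) + y"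
    unfolding lnD using lnb kE k2' lnW lnE E lny lnk by linarith
  also have "\<dots> \<le> 25 * (real b * (y * y * \<Lambda>))"
    using yyL yL LL yy bL bL' y L by linarith
  finally have "ln ?D \<le> 25 * (real b * (y * y * \<Lambda>))" .
  then have "?D \<le> exp (25 * (real b * (y * y * \<Lambda>)))"
    using D by (subst (asm) exp_le_cancel_iff[symmetric]) (simp only: exp_ln)
  then have "exp (- (25 * (real b * (y * y * \<Lambda>)))) \<le> 1 / ?D"
    using D by (simp add: exp_minus inverse_eq_divide frac_le)
  also have "25 * (real b * (y * y * \<Lambda>)) = 25 * real b * ln (real q) / \<delta>\<^sup>2"
    by (simp add: y_def \<Lambda>_def power2_eq_square)
  finally show ?thesis unfolding \<eta> .
qed

end

section \<open>The explicit exponent and the range of \<epsilon>\<close>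

lemma smallest_prime_divisor_ge_2:
  assumes "2 \<le> q"
  shows "2 \<le> smallest_prime_divisor q" "smallest_prime_divisor q \<le> q"
proof -
  let ?P = "{p. prime p \<and> p dvd q}"
  have sub: "?P \<subseteq> {2..q}" using assms by (auto simp: prime_ge_2_int zdvd_imp_le)
  then have fin: "finite ?P" by (rule finite_subset) simp
  have "\<not> is_unit q" using assms by auto
  then obtain p where "prime p" "p dvd q" using prime_divisor_exists[of q] assms by auto
  then have "?P \<noteq> {}" by auto
  then have "Min ?P \<in> ?P" using fin by (rule Min_in[rotated])
  then show "2 \<le> smallest_prime_divisor q" "smallest_prime_divisor q \<le> q"
    using sub by (auto simp: smallest_prime_divisor_def)
qed

text \<open>\<open>(5 / \<epsilon>) * L\<close> contains
  \<open>(5 / \<epsilon>) * (5 * b * ln q / \<epsilon>)\<close>, which is the exponent on the right;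
  the rest of \<open>L\<close> is nonnegative and the factor in front of \<open>exp\<close> is below
  1.\<close>

lemma eta_exponent_bounds:
  fixes \<epsilon> :: real and b q :: int
  assumes \<epsilon>: "0 < \<epsilon>" "\<epsilon> < 1" and b: "2 \<le> b" and q: "2 \<le> q"
  shows "0 < eta_exponent \<epsilon> b q" "eta_exponent \<epsilon> b q < exp (- (25 * of_int b * ln (of_int q) / \<epsilon>\<^sup>2))"
proof -
  define L where "L = ln (4 * of_int q / \<epsilon>) + 5 * of_int b * ln (of_int q) / \<epsilon>"
  define P where "P = min (1 / 4) (3 * log (of_int q) (of_int (smallest_prime_divisor q)))"
  have eta: "eta_exponent \<epsilon> b q = \<epsilon> ^ 3 * P / (7200 * 8 powr (1 / \<epsilon>) * L) * exp (- (5 / \<epsilon>) * L)"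
    by (simp add: eta_exponent_def Let_def L_def P_def)
  have lq: "2 / 3 \<le> ln (real_of_int q)"
  proof -
    have "ln 2 \<le> ln (real_of_int q)" using q by simp
    then show ?thesis using ln2_ge_two_thirds by linarith
  qed
  have "1 \<le> 4 * real_of_int q / \<epsilon>" using \<epsilon> q by (simp add: le_divide_eq)
  then have l4: "0 \<le> ln (4 * of_int q / \<epsilon>)" by simp
  have bl: "5 * of_int b * ln (of_int q) \<le> 5 * of_int b * ln (of_int q) / \<epsilon>"
    using \<epsilon> b lq by (simp add: le_divide_eq mult_le_cancel_left1)
  have "2 * (2 / 3) \<le> real_of_int b * ln (of_int q)" using b lq by (intro mult_mono) auto
  then have L1: "1 \<le> L" unfolding L_def using l4 bl by linarith
  have P: "0 < P" "P \<le> 1 / 4"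
  proof -
    have "0 < log (of_int q) (real_of_int (smallest_prime_divisor q))"
      using smallest_prime_divisor_ge_2[OF q] q by (intro zero_less_log_cancel_iff[THEN iffD2]) auto
    then show "0 < P" "P \<le> 1 / 4" by (auto simp: P_def)
  qed
  have e8: "1 \<le> (8::real) powr (1 / \<epsilon>)" using \<epsilon> by (simp add: ge_one_powr_ge_zero)
  have D: "7200 * 1 * 1 \<le> 7200 * 8 powr (1 / \<epsilon>) * L" using e8 L1 by (intro mult_mono) auto
  show "0 < eta_exponent \<epsilon> b q" unfolding eta using \<epsilon> P e8 L1 by (intro mult_pos_pos divide_pos_pos) auto
  have "\<epsilon> ^ 3 * P < 7200 * 8 powr (1 / \<epsilon>) * L"
  proof -
    have "\<epsilon> ^ 3 * P \<le> 1 * (1 / 4)" using \<epsilon> P by (intro mult_mono power_le_one) auto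
    then show ?thesis using D by linarith
  qed
  moreover have "0 < 7200 * 8 powr (1 / \<epsilon>) * L" using D by linarith
  ultimately have "\<epsilon> ^ 3 * P / (7200 * 8 powr (1 / \<epsilon>) * L) < 1" by (simp only: divide_less_eq_1_pos)
  then have "eta_exponent \<epsilon> b q < 1 * exp (- (5 / \<epsilon>) * L)" unfolding eta by (intro mult_strict_right_mono) auto
  also have "\<dots> \<le> exp (- (25 * of_int b * ln (of_int q) / \<epsilon>\<^sup>2))"
  proof -
    have "5 / \<epsilon> * (5 * of_int b * ln (of_int q) / \<epsilon>) \<le> 5 / \<epsilon> * L"
      using \<epsilon> l4 by (intro mult_left_mono) (auto simp: L_def)
    then show ?thesis by (simp add: power2_eq_square)
  qed
  finally show "eta_exponent \<epsilon> b q < exp (- (25 * of_int b * ln (of_int q) / \<epsilon>\<^sup>2))" .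
qed

text \<open>\<open>sin\<close> increases up to \<open>pi / 2\<close>, so the quotient of the sines
  is at least 1 and the outer logarithm at least \<open>ln q\<close>.\<close>

lemma lambda_exponent_ge:
  assumes b: "2 \<le> b" and q: "2 \<le> q"
  shows "1 / 2 \<le> lambda_exponent b q"
proof -
  let ?x = "pi / (2 * of_int b)" and ?y = "pi / (2 * of_int b * of_int q)"
  have bq: "2 \<le> real_of_int b" "2 \<le> real_of_int q" using b q by auto
  have y0: "0 < ?y" using bq by simp
  have yx: "?y \<le> ?x" using bq by (simp add: divide_le_cancel frac_le mult_le_cancel_left1)
  have "?x \<le> pi / 2" using bq by (intro divide_left_mono) auto
  then have "sin ?y \<le> sin ?x" using y0 yx by (intro sin_monotone_2pi_le) auto
  moreover have sy: "0 < sin ?y"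
  proof (rule sin_gt_zero[OF y0])
    show "?y < pi" using yx \<open>?x \<le> pi / 2\<close> pi_gt_zero by linarith
  qed
  ultimately have "real_of_int q * 1 \<le> real_of_int q * (sin ?x / sin ?y)"
    using bq by (intro mult_left_mono) (simp_all add: le_divide_eq)
  then have "ln (real_of_int q) \<le> ln (of_int q * sin ?x / sin ?y)" using bq by simp
  moreover have "0 < ln (real_of_int q)" using bq by simp
  ultimately show ?thesis unfolding lambda_exponent_def by (simp add: le_divide_eq)
qed

text \<open>Moduli up to \<open>x powr (1 - \<epsilon>)\<close> leave \<open>x / m\<close> at least
  \<open>x powr \<epsilon>\<close>, hence at least \<open>x powr \<delta>\<close> for
  \<open>x \<ge> 1\<close>. So all parameters may be chosen for a smaller \<open>\<delta>\<close>,
  which covers \<open>\<epsilon> \<ge> 1 / 3\<close>.\<close>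

lemma level_of_distribution:
  fixes \<epsilon> \<delta> \<eta> :: real and b q :: int
  assumes \<delta>: "0 < \<delta>" "\<delta> < 1 / 3" and \<epsilon>: "\<delta> \<le> \<epsilon>" "\<epsilon> < 1" and b: "2 \<le> b" and q: "2 \<le> q"
    and cop: "gcd b (q - 1) = 1" and \<eta>: "\<eta> < exp (- (25 * of_int b * ln (of_int q) / \<delta>\<^sup>2))" "\<eta> \<le> 1"
  shows "\<exists>C>0. \<forall>a x. 0 < x \<longrightarrow> total_discrepancy \<epsilon> q a b x \<le> C * x powr (1 - \<eta>)"
proof -
  define q' b' where "q' = nat q" and "b' = nat b"
  have qb: "q = int q'" "b = int b'" "2 \<le> q'" "2 \<le> b'" using q b by (auto simp: q'_def b'_def)
  have "gcd (int b') (int (q' - 1)) = 1" using cop qb by (simp add: of_nat_diff)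
  then have "int (gcd b' (q' - 1)) = int 1" by (simp only: gcd_int_int_eq of_nat_1)
  then have "coprime b' (q' - 1)" by (simp only: of_nat_eq_iff coprime_iff_gcd_eq_1)
  then obtain k l0 l where p: "digit_params q' b' k l0 l" "3 / \<delta> \<le> real (k - 2)" "real k \<le> 4 / \<delta>" "q' ^ l0 \<le> k * q'"
    using obtain_digit_params[OF qb(3,4) _ \<delta>] by blast
  interpret digit_params q' b' k l0 l by (rule p)
  have "exp (- (25 * real b' * ln (real q') / \<delta>\<^sup>2)) \<le> \<eta>0 \<delta>" by (rule \<eta>0_lower_bound[OF \<delta> p(3,4)])
  then have "\<eta> < \<eta>0 \<delta>" using \<eta>(1) by (simp add: qb)
  from total_discrepancy_powr[OF \<delta>(1) p(2) \<epsilon> this \<eta>(2)] show ?thesis by (simp add: qb)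
qed

theorem theorem2:
  fixes \<epsilon> :: real and b q :: int
  assumes "0 < \<epsilon>" and "\<epsilon> < 1"
    and "b \<ge> 2" and "q \<ge> 2"
    and "gcd b (q - 1) = 1"
  shows "(\<exists>C \<eta> :: real. C > 0 \<and> \<eta> > 0 \<and>
            (\<forall>(a :: int) (x :: real). x > 0 \<longrightarrow>
               total_discrepancy \<epsilon> q a b x \<le> C * x powr (1 - \<eta>)))
       \<and> (\<epsilon> < 2 / 3 * (1 - lambda_exponent b q) \<longrightarrow>
            eta_exponent \<epsilon> b q > 0 \<and>
            (\<exists>C :: real. C > 0 \<and>
              (\<forall>(a :: int) (x :: real). x > 0 \<longrightarrow>
                 total_discrepancy \<epsilon> q a b x \<le> C * x powr (1 - eta_exponent \<epsilon> b q))))"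
proof (intro conjI impI)
  have exp_le_1: "exp (- (25 * of_int b * ln (of_int q) / \<delta>\<^sup>2)) \<le> (1::real)" for \<delta> :: real
    using assms by simp
  \<comment> \<open>Any positive value below \<open>1 / 3\<close> and at most
    \<open>\<epsilon>\<close> would serve; the exponent for the first claim is
    \<open>eta_exponent \<delta> b q\<close>.\<close>
  define \<delta> where "\<delta> = min \<epsilon> (1 / 4)"
  have \<delta>: "0 < \<delta>" "\<delta> < 1 / 3" "\<delta> < 1" "\<delta> \<le> \<epsilon>" using assms(1) by (auto simp: \<delta>_def)
  note eta = eta_exponent_bounds[OF \<delta>(1) \<delta>(3) assms(3,4)]
  have "eta_exponent \<delta> b q \<le> 1" using eta(2) exp_le_1[of \<delta>] by linarith
  from level_of_distribution[OF \<delta>(1,2,4) assms(2-5) eta(2) this]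
  show "\<exists>C \<eta> :: real. C > 0 \<and> \<eta> > 0 \<and> (\<forall>(a :: int) (x :: real). x > 0 \<longrightarrow>
               total_discrepancy \<epsilon> q a b x \<le> C * x powr (1 - \<eta>))"
    using eta(1) by blast
  show "eta_exponent \<epsilon> b q > 0" by (rule eta_exponent_bounds(1)[OF assms(1-4)])
  assume "\<epsilon> < 2 / 3 * (1 - lambda_exponent b q)"
  also have "2 / 3 * (1 - lambda_exponent b q) \<le> 2 / 3 * (1 - 1 / 2)"
    by (intro mult_left_mono diff_left_mono lambda_exponent_ge assms(3,4)) simp
  finally have \<epsilon>3: "\<epsilon> < 1 / 3" by simp
  note eta = eta_exponent_bounds[OF assms(1-4)]
  have "eta_exponent \<epsilon> b q \<le> 1" using eta(2) exp_le_1[of \<epsilon>] by linarith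
  from level_of_distribution[OF assms(1) \<epsilon>3 order_refl assms(2-5) eta(2) this]
  show "\<exists>C :: real. C > 0 \<and> (\<forall>(a :: int) (x :: real). x > 0 \<longrightarrow>
                 total_discrepancy \<epsilon> q a b x \<le> C * x powr (1 - eta_exponent \<epsilon> b q))" .
qed

end
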